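(* Let $G$ be an oriented three-dimensional unimodular Lie group with Lie algebra $\mathfrak g$ and let $(H,\mathcal G_g)$ be a divergence-free generalized Einstein structure on $G$. Let $L\in\mathrm{End}\,\mathfrak g$ be the endomorphism encoding the Lie bracket by $[u,v]=L(u\times v)$. If $L$ is diagonalizable, then there exist an oriented $g$-orthonormal basis $(v_1,v_2,v_3)$ of $\mathfrak g$ and $\alpha_1,\alpha_2,\alpha_3,h\in\mathbb R$ such that $$[v_a,v_b]=\alpha_c\varepsilon_cv_c\quad\text{for every cyclic permutation }(a,b,c)\text{ of }(1,2,3),\qquad H=h\,\mathrm{vol}_g,$$ where $\varepsilon_a=g(v_a,v_a)$ satisfies $\varepsilon_1=\varepsilon_2$. The constants $(\alpha_1,\alpha_2,\alpha_3,h)$ can take the following values: (1) $\alpha_1=\alpha_2=\alpha_3=\pm h$, in which case $\mathfrak g$ is either abelian and $g$ is flat (the case $h=0$) or $\mathfrak g$ is isomorphic to $\mathfrak{so}(2,1)$ or $\mathfrak{so}(3)$. The case $\mathfrak{so}(3)$ occurs precisely when $g$ is definite (and $h\ne0$). (2) There exists a cyclic permutation $\sigma\in\mathfrak S_3$ (the identity being allowed) such that $\alpha_{\sigma(1)}=\alpha_{\sigma(2)}\ne0$ and $h=\alpha_{\sigma(3)}=0$. In this case $g$ is flat and $[\mathfrak g,\mathfrak g]$ is abelian of dimension $2$, that is, $\mathfrak g$ is metabelian. More precisely, $\mathfrak g$ is isomorphic to $\mathfrak e(2)$ ($g$ definite on $[\mathfrak g,\mathfrak g]$) or $\mathfrak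 e(1,1)$ ($g$ indefinite on $[\mathfrak g,\mathfrak g]$). If $L$ is not diagonalizable ($g$ is necessarily indefinite in this case), then $h=0$ (where $H=h\,\mathrm{vol}_g$) and the Lie group $G$ is isomorphic to the Heisenberg group.
   Context: A Lie group is called unimodular here if its Lie algebra satisfies $\mathrm{tr}\,\mathrm{ad}_X=0$ for all $X$. $\mathfrak e(p,q)$ denotes the Lie algebra of the isometry group of the pseudo-Euclidean space $\mathbb R^{p,q}$, and $\mathfrak e(2)=\mathfrak e(2,0)$. The Heisenberg group is the three-dimensional Lie group whose Lie algebra has a basis $P,Q,R$ with $[P,Q]=R$, $[P,R]=[Q,R]=0$. Left-invariant tensors are identified with tensors on $\mathfrak g$; $g$ is a left-invariant pseudo-Riemannian metric, $\mathrm{vol}_g$ its volume form (equal to $1$ on oriented orthonormal bases), the cross product is defined by $g(u\times v,w)=\mathrm{vol}_g(u,v,w)$, and $L$ by $[u,v]=L(u\times v)$ for all $u,v\in\mathfrak g$ ($L$ is $g$-symmetric because $\mathfrak g$ is unimodular). Let $E=\mathfrak g\oplus\mathfrak g^*$, with scalar product $\langle X+\xi,Y+\eta\rangle=\frac12(\xi(Y)+\eta(X))$. For $H\in\bigwedge^3\mathfrak g^*$ the Dorfman bracket is $[X+\xi,Y+\eta]_H=[X,Y]-\mathrm{ad}_X^*\eta+\mathrm{ad}_Y^*\xi+H(X,Y,\cdot)$, where $\mathrm{ad}_X^*\eta=\eta\circ\mathrm{ad}_X$. Put $gX=g(X,\cdot)$, $\mathcal G_g(X+\xi,Y+\eta)=\frac12(g(X,Y)+g^{-1}(\xi,\eta))$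 and $E_\pm=\{X\pm gX:X\in\mathfrak g\}$. A left-invariant generalized connection is a linear map $D:E\to\mathfrak{so}(E)$, $u\mapsto D_u$. Its torsion is $T(u,v)=D_uv-D_vu-[u,v]_H+(Du)^*v$, where $Du$ is $w\mapsto D_wu$ and $*$ is the adjoint for $\langle\cdot,\cdot\rangle$. $D$ is Levi-Civita if $T=0$ and $D_uE_\pm\subset E_\pm$ for all $u$. Its divergence is $\delta_D(v)=\mathrm{tr}(u\mapsto D_uv)$. Choose a Levi-Civita $D$ with $\delta_D=0$ (one exists), put $R(u,v)w=D_uD_vw-D_vD_uw-D_{[u,v]_H}w$ and, for $u_\pm\in E_\pm$, $Ric^+_0(u_-,u_+)=\mathrm{tr}(E_+\ni w\mapsto R(w,u_-)u_+\in E_+)$, $Ric^-_0(u_+,u_-)=\mathrm{tr}(E_-\ni w\mapsto R(w,u_+)u_-\in E_-)$; these are known to be independent of the choice of $D$. The pair $(H,\mathcal G_g)$ is a divergence-free generalized Einstein structure if $Ric^+_0=0$ and $Ric^-_0=0$.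
   Formalization: "G is isomorphic to the Heisenberg group" is stated as: the Lie algebra of G is the Heisenberg algebra; for groups it holds only up to coverings, since a quotient by a discrete central subgroup has the same Lie algebra. *)

theory Defs
  imports "HOL-Analysis.Analysis"
begin

text \<open>
  Throughout, the real vector space underlying the Lie algebra is a type of class
  \<open>euclidean_space\<close> (of dimension three in the theorem).  The Euclidean inner product of that class
  plays no role: the Lie bracket, the pseudo-Riemannian metric, the orientation and the three-form
  are all separate data.  Left-invariant tensors on the Lie group are tensors on the Lie algebra.
\<close>

subsection \<open>Linear algebra\<close>

text \<open>Trace of an endomorphism of the subspace \<open>S\<close>; the value does not depend on the basis chosen.\<close>

definition trace_on :: "'v::real_vector set \<Rightarrow> ('v \<Rightarrow> 'v) \<Rightarrow> real" where
  "trace_on S f =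
     (let B = (SOME B. B \<subseteq> S \<and> independent B \<and> span B = S)
      in \<Sum>b\<in>B. representation B (f b) b)"

definition diagonalizable :: "('v::real_vector \<Rightarrow> 'v) \<Rightarrow> bool" where
  "diagonalizable f \<longleftrightarrow>
     (\<exists>B. independent B \<and> span B = UNIV \<and> (\<forall>b\<in>B. \<exists>c. f b = c *\<^sub>R b))"

definition alternating3 :: "('a::real_vector \<Rightarrow> 'a \<Rightarrow> 'a \<Rightarrow> real) \<Rightarrow> bool" where
  "alternating3 \<mu> \<longleftrightarrow>
     (\<forall>y z. linear (\<lambda>x. \<mu> x y z)) \<and> (\<forall>x z. linear (\<lambda>y. \<mu> x y z)) \<and> (\<forall>x y. linear (\<lambda>z. \<mu> x y z)) \<and>
     (\<forall>x y. \<mu> x x y = 0 \<and> \<mu> x y x = 0 \<and> \<mu> x y y = 0)"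

subsection \<open>Lie algebras\<close>

definition lie_bracket :: "('a::real_vector \<Rightarrow> 'a \<Rightarrow> 'a) \<Rightarrow> bool" where
  "lie_bracket br \<longleftrightarrow>
     bilinear br \<and> (\<forall>x. br x x = 0) \<and>
     (\<forall>x y z. br x (br y z) + br y (br z x) + br z (br x y) = 0)"

definition unimodular :: "('a::real_vector \<Rightarrow> 'a \<Rightarrow> 'a) \<Rightarrow> bool" where
  "unimodular br \<longleftrightarrow> (\<forall>x. trace_on UNIV (br x) = 0)"

definition derived_algebra :: "('a::real_vector \<Rightarrow> 'a \<Rightarrow> 'a) \<Rightarrow> 'a set" where
  "derived_algebra br = span {br x y |x y. True}"

definition abelian_on :: "('a::real_vector \<Rightarrow> 'a \<Rightarrow> 'a) \<Rightarrow> 'a set \<Rightarrow> bool" where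
  "abelian_on br S \<longleftrightarrow> (\<forall>x\<in>S. \<forall>y\<in>S. br x y = 0)"

text \<open>Isomorphism of the Lie algebra \<open>('a, br)\<close> with the Lie algebra \<open>br'\<close> on the carrier \<open>T\<close>.\<close>

definition lie_isomorphic ::
  "('a::real_vector \<Rightarrow> 'a \<Rightarrow> 'a) \<Rightarrow> 'b::real_vector set \<Rightarrow> ('b \<Rightarrow> 'b \<Rightarrow> 'b) \<Rightarrow> bool" where
  "lie_isomorphic br T br' \<longleftrightarrow>
     (\<exists>f. linear f \<and> bij_betw f UNIV T \<and> (\<forall>x y. f (br x y) = br' (f x) (f y)))"

text \<open>
  The pseudo-Euclidean scalar product with diagonal entries \<open>s\<close>, its orthogonal Lie algebra, and the
  Lie algebra of the isometry group of the pseudo-Euclidean space, where \<open>(A, x)\<close> is the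
  infinitesimal isometry \<open>y \<mapsto> A y + x\<close>.
\<close>

definition pe_form :: "real^'n::finite \<Rightarrow> real^'n \<Rightarrow> real^'n \<Rightarrow> real" where
  "pe_form s x y = (\<Sum>i\<in>UNIV. s $ i * x $ i * y $ i)"

definition so_alg :: "real^'n::finite \<Rightarrow> (real^'n^'n) set" where
  "so_alg s = {A. \<forall>x y. pe_form s (A *v x) y + pe_form s x (A *v y) = 0}"

definition commutator :: "real^'n::finite^'n \<Rightarrow> real^'n^'n \<Rightarrow> real^'n^'n" where
  "commutator A B = A ** B - B ** A"

definition e_alg :: "real^'n::finite \<Rightarrow> ((real^'n^'n) \<times> (real^'n)) set" where
  "e_alg s = so_alg s \<times> UNIV"

definition e_bracket ::
  "(real^'n::finite^'n) \<times> (real^'n) \<Rightarrow> (real^'n^'n) \<times> (real^'n) \<Rightarrow> (real^'n^'n) \<times> (real^'n)" where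
  "e_bracket u v = (commutator (fst u) (fst v), fst u *v snd v - fst v *v snd u)"

definition is_so3 :: "('a::real_vector \<Rightarrow> 'a \<Rightarrow> 'a) \<Rightarrow> bool" where
  "is_so3 br \<longleftrightarrow> lie_isomorphic br (so_alg (vector [1, 1, 1] :: real^3)) commutator"

definition is_so21 :: "('a::real_vector \<Rightarrow> 'a \<Rightarrow> 'a) \<Rightarrow> bool" where
  "is_so21 br \<longleftrightarrow> lie_isomorphic br (so_alg (vector [1, 1, -1] :: real^3)) commutator"

definition is_e2 :: "('a::real_vector \<Rightarrow> 'a \<Rightarrow> 'a) \<Rightarrow> bool" where
  "is_e2 br \<longleftrightarrow> lie_isomorphic br (e_alg (vector [1, 1] :: real^2)) e_bracket"

definition is_e11 :: "('a::real_vector \<Rightarrow> 'a \<Rightarrow> 'a) \<Rightarrow> bool" where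
  "is_e11 br \<longleftrightarrow> lie_isomorphic br (e_alg (vector [1, -1] :: real^2)) e_bracket"

definition is_heisenberg :: "('a::real_vector \<Rightarrow> 'a \<Rightarrow> 'a) \<Rightarrow> bool" where
  "is_heisenberg br \<longleftrightarrow>
     (\<exists>P Q R. P \<noteq> Q \<and> P \<noteq> R \<and> Q \<noteq> R \<and> independent {P, Q, R} \<and> span {P, Q, R} = UNIV \<and>
              br P Q = R \<and> br P R = 0 \<and> br Q R = 0)"

subsection \<open>Left-invariant pseudo-Riemannian metrics\<close>

definition pseudo_metric :: "('a::real_vector \<Rightarrow> 'a \<Rightarrow> real) \<Rightarrow> bool" where
  "pseudo_metric g \<longleftrightarrow>
     bilinear g \<and> (\<forall>x y. g x y = g y x) \<and> (\<forall>x. (\<forall>y. g x y = 0) \<longrightarrow> x = 0)"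

definition definite_on :: "('a::real_vector \<Rightarrow> 'a \<Rightarrow> real) \<Rightarrow> 'a set \<Rightarrow> bool" where
  "definite_on g S \<longleftrightarrow> (\<forall>x\<in>S. x \<noteq> 0 \<longrightarrow> g x x > 0) \<or> (\<forall>x\<in>S. x \<noteq> 0 \<longrightarrow> g x x < 0)"

definition indefinite_on :: "('a::real_vector \<Rightarrow> 'a \<Rightarrow> real) \<Rightarrow> 'a set \<Rightarrow> bool" where
  "indefinite_on g S \<longleftrightarrow> (\<exists>x\<in>S. g x x > 0) \<and> (\<exists>x\<in>S. g x x < 0)"

definition metric_levi_civita ::
  "('a::real_vector \<Rightarrow> 'a \<Rightarrow> 'a) \<Rightarrow> ('a \<Rightarrow> 'a \<Rightarrow> real) \<Rightarrow> ('a \<Rightarrow> 'a \<Rightarrow> 'a) \<Rightarrow> bool" where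
  "metric_levi_civita br g nab \<longleftrightarrow>
     bilinear nab \<and> (\<forall>x y z. g (nab x y) z + g y (nab x z) = 0) \<and> (\<forall>x y. nab x y - nab y x = br x y)"

text \<open>The Levi-Civita connection exists and is unique.\<close>

definition flat_metric :: "('a::real_vector \<Rightarrow> 'a \<Rightarrow> 'a) \<Rightarrow> ('a \<Rightarrow> 'a \<Rightarrow> real) \<Rightarrow> bool" where
  "flat_metric br g \<longleftrightarrow>
     (\<exists>nab. metric_levi_civita br g nab \<and>
          (\<forall>x y z. nab x (nab y z) - nab y (nab x z) - nab (br x y) z = 0))"

subsection \<open>Orientation, volume form and cross product in dimension three\<close>

text \<open>
  An orientation is represented by a nonzero alternating three-form \<open>\<omega>\<close>, which matters only up to
  positive multiples: a triple with \<open>\<omega> > 0\<close> is automatically a basis, and these are the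
  oriented bases.  Frames are functions on \<open>nat\<close> of which only the values at 1, 2, 3 are used.
\<close>

definition oriented_orthonormal ::
  "('a::real_vector \<Rightarrow> 'a \<Rightarrow> real) \<Rightarrow> ('a \<Rightarrow> 'a \<Rightarrow> 'a \<Rightarrow> real) \<Rightarrow> (nat \<Rightarrow> 'a) \<Rightarrow> bool" where
  "oriented_orthonormal g \<omega> v \<longleftrightarrow>
     (\<forall>a\<in>{1..3}. \<bar>g (v a) (v a)\<bar> = 1) \<and>
     (\<forall>a\<in>{1..3}. \<forall>b\<in>{1..3}. a \<noteq> b \<longrightarrow> g (v a) (v b) = 0) \<and>
     \<omega> (v 1) (v 2) (v 3) > 0"

definition vol_form ::
  "('a::real_vector \<Rightarrow> 'a \<Rightarrow> real) \<Rightarrow> ('a \<Rightarrow> 'a \<Rightarrow> 'a \<Rightarrow> real) \<Rightarrow> 'a \<Rightarrow> 'a \<Rightarrow> 'a \<Rightarrow> real" where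
  "vol_form g \<omega> =
     (THE \<mu>. alternating3 \<mu> \<and> (\<forall>v. oriented_orthonormal g \<omega> v \<longrightarrow> \<mu> (v 1) (v 2) (v 3) = 1))"

definition cross_prod ::
  "('a::real_vector \<Rightarrow> 'a \<Rightarrow> real) \<Rightarrow> ('a \<Rightarrow> 'a \<Rightarrow> 'a \<Rightarrow> real) \<Rightarrow> 'a \<Rightarrow> 'a \<Rightarrow> 'a" where
  "cross_prod g \<omega> u v = (THE z. \<forall>w. g z w = vol_form g \<omega> u v w)"

subsection \<open>Generalized geometry on \<open>E = \<gg> \<oplus> \<gg>*\<close>\<close>

text \<open>In finite dimension every linear functional is bounded, so the dual space is the type of
  bounded linear functionals.\<close>

type_synonym 'a gen = "'a \<times> ('a \<Rightarrow>\<^sub>L real)"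

definition gen_sp :: "'a::euclidean_space gen \<Rightarrow> 'a gen \<Rightarrow> real" where
  "gen_sp u v = (1 / 2) * (blinfun_apply (snd u) (fst v) + blinfun_apply (snd v) (fst u))"

definition coad :: "('a::euclidean_space \<Rightarrow> 'a \<Rightarrow> 'a) \<Rightarrow> 'a \<Rightarrow> ('a \<Rightarrow>\<^sub>L real) \<Rightarrow> ('a \<Rightarrow>\<^sub>L real)" where
  "coad br X \<eta> = Blinfun (\<lambda>Z. blinfun_apply \<eta> (br X Z))"

definition dorfman ::
  "('a::euclidean_space \<Rightarrow> 'a \<Rightarrow> 'a) \<Rightarrow> ('a \<Rightarrow> 'a \<Rightarrow> 'a \<Rightarrow> real) \<Rightarrow> 'a gen \<Rightarrow> 'a gen \<Rightarrow> 'a gen" where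
  "dorfman br H u v =
     (br (fst u) (fst v),
      - coad br (fst u) (snd v) + coad br (fst v) (snd u) + Blinfun (H (fst u) (fst v)))"

definition gen_plus :: "('a::euclidean_space \<Rightarrow> 'a \<Rightarrow> real) \<Rightarrow> 'a gen set" where
  "gen_plus g = {(X, Blinfun (g X)) |X. True}"

definition gen_minus :: "('a::euclidean_space \<Rightarrow> 'a \<Rightarrow> real) \<Rightarrow> 'a gen set" where
  "gen_minus g = {(X, - Blinfun (g X)) |X. True}"

definition gen_adjoint :: "('a::euclidean_space gen \<Rightarrow> 'a gen) \<Rightarrow> 'a gen \<Rightarrow> 'a gen" where
  "gen_adjoint A v = (THE z. \<forall>w. gen_sp z w = gen_sp v (A w))"

definition gen_connection :: "('a::euclidean_space gen \<Rightarrow> 'a gen \<Rightarrow> 'a gen) \<Rightarrow> bool" where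
  "gen_connection D \<longleftrightarrow>
     bilinear D \<and> (\<forall>u v w. gen_sp (D u v) w + gen_sp v (D u w) = 0)"

definition gen_torsion ::
  "('a::euclidean_space \<Rightarrow> 'a \<Rightarrow> 'a) \<Rightarrow> ('a \<Rightarrow> 'a \<Rightarrow> 'a \<Rightarrow> real) \<Rightarrow>
   ('a gen \<Rightarrow> 'a gen \<Rightarrow> 'a gen) \<Rightarrow> 'a gen \<Rightarrow> 'a gen \<Rightarrow> 'a gen" where
  "gen_torsion br H D u v =
     D u v - D v u - dorfman br H u v + gen_adjoint (\<lambda>w. D w u) v"

definition gen_levi_civita ::
  "('a::euclidean_space \<Rightarrow> 'a \<Rightarrow> 'a) \<Rightarrow> ('a \<Rightarrow> 'a \<Rightarrow> 'a \<Rightarrow> real) \<Rightarrow> ('a \<Rightarrow> 'a \<Rightarrow> real) \<Rightarrow>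
   ('a gen \<Rightarrow> 'a gen \<Rightarrow> 'a gen) \<Rightarrow> bool" where
  "gen_levi_civita br H g D \<longleftrightarrow>
     gen_connection D \<and> (\<forall>u v. gen_torsion br H D u v = 0) \<and>
     (\<forall>u. D u ` gen_plus g \<subseteq> gen_plus g \<and> D u ` gen_minus g \<subseteq> gen_minus g)"

definition gen_divergence :: "('a::euclidean_space gen \<Rightarrow> 'a gen \<Rightarrow> 'a gen) \<Rightarrow> 'a gen \<Rightarrow> real" where
  "gen_divergence D v = trace_on UNIV (\<lambda>u. D u v)"

definition gen_curvature ::
  "('a::euclidean_space \<Rightarrow> 'a \<Rightarrow> 'a) \<Rightarrow> ('a \<Rightarrow> 'a \<Rightarrow> 'a \<Rightarrow> real) \<Rightarrow>
   ('a gen \<Rightarrow> 'a gen \<Rightarrow> 'a gen) \<Rightarrow> 'a gen \<Rightarrow> 'a gen \<Rightarrow> 'a gen \<Rightarrow> 'a gen" where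
  "gen_curvature br H D u v w = D u (D v w) - D v (D u w) - D (dorfman br H u v) w"

definition ric_plus ::
  "('a::euclidean_space \<Rightarrow> 'a \<Rightarrow> 'a) \<Rightarrow> ('a \<Rightarrow> 'a \<Rightarrow> 'a \<Rightarrow> real) \<Rightarrow> ('a \<Rightarrow> 'a \<Rightarrow> real) \<Rightarrow>
   ('a gen \<Rightarrow> 'a gen \<Rightarrow> 'a gen) \<Rightarrow> 'a gen \<Rightarrow> 'a gen \<Rightarrow> real" where
  "ric_plus br H g D um up = trace_on (gen_plus g) (\<lambda>w. gen_curvature br H D w um up)"

definition ric_minus ::
  "('a::euclidean_space \<Rightarrow> 'a \<Rightarrow> 'a) \<Rightarrow> ('a \<Rightarrow> 'a \<Rightarrow> 'a \<Rightarrow> real) \<Rightarrow> ('a \<Rightarrow> 'a \<Rightarrow> real) \<Rightarrow>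
   ('a gen \<Rightarrow> 'a gen \<Rightarrow> 'a gen) \<Rightarrow> 'a gen \<Rightarrow> 'a gen \<Rightarrow> real" where
  "ric_minus br H g D up um = trace_on (gen_minus g) (\<lambda>w. gen_curvature br H D w up um)"

text \<open>
  The generalized metric enters only through its eigenspaces \<open>gen_plus g\<close> and \<open>gen_minus g\<close>.
  A divergence-free Levi-Civita connection exists, and the two Ricci tensors do not depend on the
  one chosen; so it does not matter whether the connection is quantified existentially or
  universally.
\<close>

definition gen_einstein ::
  "('a::euclidean_space \<Rightarrow> 'a \<Rightarrow> 'a) \<Rightarrow> ('a \<Rightarrow> 'a \<Rightarrow> 'a \<Rightarrow> real) \<Rightarrow> ('a \<Rightarrow> 'a \<Rightarrow> real) \<Rightarrow> bool" where
  "gen_einstein br H g \<longleftrightarrow>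
     (\<exists>D. gen_levi_civita br H g D \<and> (\<forall>v. gen_divergence D v = 0) \<and>
          (\<forall>um\<in>gen_minus g. \<forall>up\<in>gen_plus g. ric_plus br H g D um up = 0) \<and>
          (\<forall>up\<in>gen_plus g. \<forall>um\<in>gen_minus g. ric_minus br H g D up um = 0))"

subsection \<open>The data of the classification\<close>

definition einstein_group ::
  "('a::euclidean_space \<Rightarrow> 'a \<Rightarrow> 'a) \<Rightarrow> ('a \<Rightarrow> 'a \<Rightarrow> 'a \<Rightarrow> real) \<Rightarrow> ('a \<Rightarrow> 'a \<Rightarrow> real) \<Rightarrow>
   ('a \<Rightarrow> 'a \<Rightarrow> 'a \<Rightarrow> real) \<Rightarrow> bool" where
  "einstein_group br \<omega> g H \<longleftrightarrow>
     lie_bracket br \<and> unimodular br \<and> alternating3 \<omega> \<and> \<omega> \<noteq> (\<lambda>x y z. 0) \<and>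
     pseudo_metric g \<and> alternating3 H \<and> gen_einstein br H g"

text \<open>The cyclic permutations of \<open>(1, 2, 3)\<close>, written as the triples \<open>(\<sigma> 1, \<sigma> 2, \<sigma> 3)\<close>.\<close>

definition cyclic3 :: "(nat \<times> nat \<times> nat) set" where
  "cyclic3 = {(1, 2, 3), (2, 3, 1), (3, 1, 2)}"

definition adapted_frame ::
  "('a::euclidean_space \<Rightarrow> 'a \<Rightarrow> 'a) \<Rightarrow> ('a \<Rightarrow> 'a \<Rightarrow> 'a \<Rightarrow> real) \<Rightarrow> ('a \<Rightarrow> 'a \<Rightarrow> real) \<Rightarrow>
   ('a \<Rightarrow> 'a \<Rightarrow> 'a \<Rightarrow> real) \<Rightarrow> (nat \<Rightarrow> 'a) \<Rightarrow> (nat \<Rightarrow> real) \<Rightarrow> real \<Rightarrow> bool" where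
  "adapted_frame br \<omega> g H v \<alpha> h \<longleftrightarrow>
     oriented_orthonormal g \<omega> v \<and>
     (\<forall>(a, b, c)\<in>cyclic3. br (v a) (v b) = (\<alpha> c * g (v c) (v c)) *\<^sub>R v c) \<and>
     (\<forall>x y z. H x y z = h * vol_form g \<omega> x y z) \<and>
     g (v 1) (v 1) = g (v 2) (v 2)"

definition values1 :: "(nat \<Rightarrow> real) \<Rightarrow> real \<Rightarrow> bool" where
  "values1 \<alpha> h \<longleftrightarrow> \<alpha> 1 = \<alpha> 2 \<and> \<alpha> 2 = \<alpha> 3 \<and> (\<alpha> 3 = h \<or> \<alpha> 3 = - h)"

definition values2 :: "(nat \<Rightarrow> real) \<Rightarrow> real \<Rightarrow> bool" where
  "values2 \<alpha> h \<longleftrightarrow> (\<exists>(a, b, c)\<in>cyclic3. \<alpha> a = \<alpha> b \<and> \<alpha> a \<noteq> 0 \<and> h = 0 \<and> \<alpha> c = 0)"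

end

theory Submission
  imports Defs
begin

text \<open>
  Torsion-freeness forces the mixed components of a generalized Levi-Civita connection \<open>D\<close>, namely
  \<open>D\<^sub>u v\<close> is the \<open>E\<^sub>\<plusminus>\<close>-part of the Dorfman bracket of \<open>u\<close> and \<open>v\<close> for \<open>u \<in> E\<^sub>\<mp>\<close> and \<open>v \<in> E\<^sub>\<plusminus>\<close>.
  In the trace defining the Ricci tensor the pure components then drop out: one term is a divergence,
  two others cancel because \<open>tr (A B) = tr (B A)\<close>.  What remains is a quadratic
  expression in the Dorfman coefficients, and both Ricci tensors are transposes of each other.

  In dimension three this expression is, for \<open>H = h vol\<close> and \<open>M = tr L - 2 L\<close>, a multiple of
  \<open>adj M - h\<^sup>2\<close>, so the Einstein condition reads \<open>adj M = h\<^sup>2\<close>.  If \<open>h \<noteq> 0\<close>, then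
  \<open>det M = M adj M = h\<^sup>2 M\<close> makes \<open>M\<close>, hence \<open>L\<close>, a scalar.  If \<open>h = 0\<close>, then \<open>M = \<kappa> g(w, \<cdot>) w\<close> has rank at
  most one; it is diagonalizable unless \<open>w\<close> is a nonzero null vector, and in that
  case \<open>[u, v] = c vol(u, v, w) w\<close>, which is the Heisenberg algebra.
\<close>

subsection \<open>Traces and orthonormal frames\<close>

text \<open>For an indefinite metric a \<open>g\<close>-symmetric \<open>L\<close> need not have
  eigenvectors enough for a normal form, so none is assumed: the Einstein condition is solved for
  \<open>M\<close> in an arbitrary orthonormal frame, and the solution decides whether an eigenframe
  exists. \<open>M\<close> comes from the Koszul formula: \<open>T s x y z / 2\<close> is the
  coefficient of the Levi-Civita connection of \<open>g\<close> plus \<open>s * H x y z / 2\<close>,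
  and in dimension three \<open>T s x y z\<close> is \<open>M + s h g\<close> evaluated at
  \<open>x\<close> and \<open>y \<times> z\<close>. The trace pairs \<open>T s\<close> with
  \<open>T (-s)\<close>, which gives one half of the polarised adjugate of \<open>M + s h\<close>
  and \<open>M - s h\<close>; the parts linear in \<open>h\<close> cancel, and this is the origin of
  \<open>adj M - h\<^sup>2\<close>. A converse is needed as well, since every listed value has to
  occur. As the Einstein predicate asks for some divergence-free Levi-Civita connection, one is
  constructed explicitly; any other choice gives the same condition, because only the forced mixed
  components survive in the trace.\<close>

text \<open>\<open>trace_on\<close> picks an unspecified basis \<open>B\<close>. Expanding
  \<open>f b\<close> in the family \<open>e\<close>, and \<open>e i\<close> in \<open>B\<close>,
  turns both expressions into the same double sum.\<close>

lemma trace_on_dual_family: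
  fixes e :: "'i \<Rightarrow> 'v::real_vector" and f :: "'v \<Rightarrow> 'v"
  assumes fin: "finite I" and lin: "linear f" and lin_dual: "\<And>i. i \<in> I \<Longrightarrow> linear (d i)"
    and S: "S = span (e ` I)" and dual: "\<And>i j. i \<in> I \<Longrightarrow> j \<in> I \<Longrightarrow> d i (e j) = (if i = j then 1 else 0)"
    and into: "f ` S \<subseteq> S"
  shows "trace_on S f = (\<Sum>i\<in>I. d i (f (e i)) :: real)"
proof -
  have expand: "(\<Sum>i\<in>I. d i w *\<^sub>R e i) = w" if "w \<in> S" for w
    using that unfolding S
  proof (induction rule: span_induct_alt)
    case base
    then show ?case using lin_dual by (simp add: linear_0)
  next
    case (step c x y)
    then obtain j where j: "j \<in> I" "x = e j" by auto
    have "(\<Sum>i\<in>I. d i (c *\<^sub>R x + y) *\<^sub>R e i)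
        = c *\<^sub>R (\<Sum>i\<in>I. (if i = j then 1 else 0) *\<^sub>R e i) + (\<Sum>i\<in>I. d i y *\<^sub>R e i)"
      unfolding scaleR_sum_right sum.distrib[symmetric]
      by (rule sum.cong) (auto simp: linear_add[OF lin_dual] linear_scale[OF lin_dual] dual j scaleR_add_left)
    also have "(\<Sum>i\<in>I. (if i = j then 1 else 0) *\<^sub>R e i) = (\<Sum>i\<in>I. if i = j then e i else 0)"
      by (rule sum.cong) auto
    also have "\<dots> = e j"
      using fin j by simp
    finally show ?case using step j by simp
  qed
  define B where "B = (SOME B. B \<subseteq> S \<and> independent B \<and> span B = S)"
  have "subspace S" unfolding S by simp
  then have "\<exists>B. B \<subseteq> S \<and> independent B \<and> span B = S"
    by (metis basis_exists span_eq span_eq_iff)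
  then have B: "B \<subseteq> S" "independent B" "span B = S"
    unfolding B_def by (metis (mono_tags, lifting) someI_ex)+
  have finB: "finite B"
    using independent_span_bound[OF _ B(2), of "e ` I"] fin B(1) S by auto
  have eS: "e i \<in> S" if "i \<in> I" for i
    using that by (simp add: S span_base)
  have expB: "(\<Sum>b\<in>B. representation B w b *\<^sub>R b) = w" if "w \<in> S" for w
    using sum_representation_eq[OF B(2) _ finB] that B(3) by auto
  have "trace_on S f = (\<Sum>b\<in>B. representation B (f b) b)"
    unfolding trace_on_def B_def Let_def ..
  also have "\<dots> = (\<Sum>b\<in>B. \<Sum>i\<in>I. d i (f b) * representation B (e i) b)"
  proof (rule sum.cong[OF refl])
    fix b assume b: "b \<in> B"
    have "representation B (f b) b = representation B (\<Sum>i\<in>I. d i (f b) *\<^sub>R e i) b"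
      using expand[of "f b"] b B(1) into by (metis image_subset_iff subset_eq)
    also have "\<dots> = (\<Sum>i\<in>I. representation B (d i (f b) *\<^sub>R e i) b)"
      using B eS by (subst representation_sum) (auto intro: span_scale)
    also have "\<dots> = (\<Sum>i\<in>I. d i (f b) * representation B (e i) b)"
      using B eS by (intro sum.cong) (auto simp: representation_scale)
    finally show "representation B (f b) b = (\<Sum>i\<in>I. d i (f b) * representation B (e i) b)" .
  qed
  also have "\<dots> = (\<Sum>i\<in>I. \<Sum>b\<in>B. d i (f b) * representation B (e i) b)"
    by (rule sum.swap)
  also have "\<dots> = (\<Sum>i\<in>I. d i (f (e i)))"
  proof (rule sum.cong[OF refl])
    fix i assume i: "i \<in> I"
    have "d i (f (e i)) = d i (f (\<Sum>b\<in>B. representation B (e i) b *\<^sub>R b))"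
      using expB eS i by simp
    also have "\<dots> = (\<Sum>b\<in>B. d i (f b) * representation B (e i) b)"
      using i by (simp add: linear_sum[OF lin] linear_scale[OF lin] linear_sum[OF lin_dual]
          linear_scale[OF lin_dual] mult.commute)
    finally show "(\<Sum>b\<in>B. d i (f b) * representation B (e i) b) = d i (f (e i))" ..
  qed
  finally show ?thesis .
qed

section \<open>Bilinear and alternating maps\<close>

lemma bilinear_sums:
  assumes "bilinear b"
  shows "b (\<Sum>i\<in>A. f i) y = (\<Sum>i\<in>A. b (f i) y)" "b x (\<Sum>i\<in>A. f i) = (\<Sum>i\<in>A. b x (f i))"
  using assms by (auto simp: bilinear_def intro: linear_sum[of "b x"] linear_sum[of "\<lambda>x. b x y"])

lemmas bilin_simps = bilinear_ladd bilinear_radd bilinear_lsub bilinear_rsub bilinear_lmul bilinear_rmul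
  bilinear_lneg bilinear_rneg bilinear_lzero bilinear_rzero bilinear_sums

lemma bilinear_linear:
  assumes "bilinear b"
  shows "linear (b x)" "linear (\<lambda>x. b x y)"
  using assms by (auto simp: bilinear_def)

lemma skew_bilinear:
  assumes "bilinear b" "\<And>x. b x x = 0"
  shows "b y x = - b x y"
proof -
  have "b (x + y) (x + y) = b x x + b x y + (b y x + b y y)"
    by (simp add: bilinear_ladd[OF assms(1)] bilinear_radd[OF assms(1)] add_ac)
  then have "b x y + b y x = 0"
    unfolding assms(2) by (metis add_0 add.right_neutral)
  then show ?thesis by (metis add.commute eq_neg_iff_add_eq_0)
qed

lemma alternating3_linear:
  assumes "alternating3 H"
  shows "linear (\<lambda>x. H x y z)" "linear (\<lambda>y. H x y z)" "linear (\<lambda>z. H x y z)"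
  using assms by (auto simp: alternating3_def)

lemma alternating3_bilinear:
  assumes "alternating3 H"
  shows "bilinear (\<lambda>y z. H x y z)" "bilinear (\<lambda>x z. H x y z)" "bilinear (\<lambda>x y. H x y z)"
  using assms by (auto simp: alternating3_def bilinear_def)

lemma alternating3_swap:
  assumes "alternating3 H"
  shows "H y x z = - H x y z" "H x z y = - H x y z"
  by (rule skew_bilinear[OF alternating3_bilinear(3)[OF assms]]
      skew_bilinear[OF alternating3_bilinear(1)[OF assms]],
      use assms in \<open>simp add: alternating3_def\<close>)+

lemma blinfun_apply_Blinfun_linear:
  fixes f :: "'a::euclidean_space \<Rightarrow> real"
  shows "linear f \<Longrightarrow> blinfun_apply (Blinfun f) = f"
  by (simp add: bounded_linear_Blinfun_apply linear_conv_bounded_linear)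

lemma gen_sp_bilinear: "bilinear gen_sp"
  unfolding bilinear_def
  by (auto intro!: linearI simp: gen_sp_def blinfun.add_left blinfun.add_right blinfun.scaleR_left
      blinfun.scaleR_right add_divide_distrib algebra_simps)

lemma gen_sp_commute: "gen_sp u v = gen_sp v u"
  by (simp add: gen_sp_def)

section \<open>Orthonormal frames of \<open>g\<close> and the induced frames of
  \<open>E\<close>\<close>

text \<open>The index set is arbitrary, so the Ricci formula is obtained in every dimension. The
  condition on the signs is polynomial, which lets simplification cancel them.\<close>

locale orthonormal_frame =
  fixes g :: "'a::euclidean_space \<Rightarrow> 'a \<Rightarrow> real" and I :: "'i set" and e :: "'i \<Rightarrow> 'a"
  assumes metric: "pseudo_metric g" and finite_I: "finite I"
    and unit: "i \<in> I \<Longrightarrow> g (e i) (e i) * g (e i) (e i) = 1"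
    and orthogonal: "i \<in> I \<Longrightarrow> j \<in> I \<Longrightarrow> i \<noteq> j \<Longrightarrow> g (e i) (e j) = 0"
    and spanning: "span (e ` I) = UNIV"
begin

abbreviation sg :: "'i \<Rightarrow> real" where "sg i \<equiv> g (e i) (e i)"

lemma g_bilinear: "bilinear g" and g_sym: "g x y = g y x"
  using metric by (auto simp: pseudo_metric_def)

lemmas g_simps = bilin_simps[OF g_bilinear]

lemma g_nondeg: "(\<And>i. i \<in> I \<Longrightarrow> g x (e i) = g y (e i)) \<Longrightarrow> x = y"
proof -
  assume a: "\<And>i. i \<in> I \<Longrightarrow> g x (e i) = g y (e i)"
  have "g (x - y) z = 0" for z
  proof -
    have "z \<in> span (e ` I)" using spanning by simp
    then show ?thesis
      by (induction rule: span_induct_alt) (auto simp: g_simps a)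
  qed
  then have "x - y = 0" using metric unfolding pseudo_metric_def by blast
  then show ?thesis by simp
qed

lemma g_frame_sum: "j \<in> I \<Longrightarrow> g (\<Sum>i\<in>I. (sg i * c i) *\<^sub>R e i) (e j) = c j"
proof -
  assume j: "j \<in> I"
  have "g (\<Sum>i\<in>I. (sg i * c i) *\<^sub>R e i) (e j) = (\<Sum>i\<in>I. sg i * c i * g (e i) (e j))"
    by (simp add: g_simps)
  also have "\<dots> = (\<Sum>i\<in>I. if i = j then sg i * c i * sg i else 0)"
    using j by (intro sum.cong) (auto simp: orthogonal)
  also have "\<dots> = c j"
    using j unit[OF j] finite_I by (simp add: mult.commute mult.left_commute)
  finally show ?thesis .
qed

lemma frame_expand: "(\<Sum>i\<in>I. (sg i * g x (e i)) *\<^sub>R e i) = x"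
  by (rule g_nondeg) (rule g_frame_sum)

lemma g_frame: "g x y = (\<Sum>i\<in>I. sg i * g x (e i) * g y (e i))"
proof -
  have "g x y = g (\<Sum>i\<in>I. (sg i * g x (e i)) *\<^sub>R e i) y" by (simp add: frame_expand)
  then show ?thesis by (simp add: g_simps g_sym[of y])
qed

lemma frame_trace:
  assumes "linear f"
  shows "trace_on UNIV f = (\<Sum>i\<in>I. sg i * g (f (e i)) (e i))"
proof (rule trace_on_dual_family[where d = "\<lambda>i x. sg i * g x (e i)"])
  show "linear (\<lambda>x. sg i * g x (e i))" for i
    by (rule linearI) (auto simp: g_simps algebra_simps)
qed (use assms finite_I spanning in \<open>auto simp: orthogonal unit\<close>)

lemma frame_trace_comp:
  assumes "linear f" "linear h"
  shows "trace_on UNIV (\<lambda>x. f (h x)) = (\<Sum>i\<in>I. \<Sum>j\<in>I. sg i * sg j * g (h (e i)) (e j) * g (f (e j)) (e i))"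
proof -
  have "g (f (h (e i))) (e i) = (\<Sum>j\<in>I. sg j * g (h (e i)) (e j) * g (f (e j)) (e i))" for i
  proof -
    have "f (h (e i)) = f (\<Sum>j\<in>I. (sg j * g (h (e i)) (e j)) *\<^sub>R e j)" by (simp add: frame_expand)
    then show ?thesis by (simp add: linear_sum[OF assms(1)] linear_scale[OF assms(1)] g_simps)
  qed
  moreover have "linear (\<lambda>x. f (h x))"
    using linear_compose[OF assms(2,1)] by (simp add: o_def)
  ultimately show ?thesis
    by (simp add: frame_trace sum_distrib_left mult.assoc)
qed

lemma frame_trace_commute:
  fixes f h :: "'a \<Rightarrow> 'a"
  assumes "linear f" "linear h"
  shows "trace_on UNIV (\<lambda>x. f (h x)) = trace_on UNIV (\<lambda>x. h (f x))"
  unfolding frame_trace_comp[OF assms] frame_trace_comp[OF assms(2,1)]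
  by (subst sum.swap) (simp add: mult.commute mult.left_commute)

text \<open>The values \<open>s = 1\<close> and \<open>s = -1\<close> parametrise the two
  eigenspaces of the generalized metric; keeping \<open>s\<close> as a parameter treats both Ricci
  tensors by one argument.\<close>

definition emb :: "real \<Rightarrow> 'a \<Rightarrow> 'a gen" where
  "emb s x = (x, s *\<^sub>R Blinfun (g x))"

lemma apply_g [simp]: "blinfun_apply (Blinfun (g x)) = g x"
  by (rule blinfun_apply_Blinfun_linear) (rule bilinear_linear[OF g_bilinear])

lemma emb_linear: "linear (emb s)"
  by (rule linearI) (auto simp: emb_def g_simps blinfun.add_left blinfun.scaleR_left
      algebra_simps intro!: blinfun_eqI)

lemma fst_emb [simp]: "fst (emb s x) = x"
  by (simp add: emb_def)

lemma snd_emb: "blinfun_apply (snd (emb s x)) y = s * g x y"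
  by (simp add: emb_def blinfun.scaleR_left)

lemma gen_plus_emb: "gen_plus g = range (emb 1)" and gen_minus_emb: "gen_minus g = range (emb (-1))"
  by (auto simp: gen_plus_def gen_minus_def emb_def)

lemma gen_sp_emb: "gen_sp w (emb s x) = (blinfun_apply (snd w) x + s * g x (fst w)) / 2"
  by (simp add: gen_sp_def snd_emb)

text \<open>On the image of \<open>emb s\<close> the form \<open>gen_sp\<close> is
  \<open>s * g\<close>, and the two images are orthogonal; so the vectors \<open>emb s (e i)\<close>
  are an orthogonal basis of \<open>E\<close> with squares \<open>s * sg i\<close>.\<close>

lemma gen_expand:
  "(\<Sum>s\<in>{1,-1}. \<Sum>i\<in>I. (s * sg i * gen_sp w (emb s (e i))) *\<^sub>R emb s (e i)) = w"
proof (rule prod_eqI)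
  have lin: "linear (emb s)" for s by (rule emb_linear)
  let ?x = "\<lambda>s. \<Sum>i\<in>I. (s * sg i * gen_sp w (emb s (e i))) *\<^sub>R e i"
  have sum_emb: "(\<Sum>i\<in>I. (s * sg i * gen_sp w (emb s (e i))) *\<^sub>R emb s (e i)) = emb s (?x s)" for s
    by (simp add: linear_sum[OF lin] linear_scale[OF lin])
  \<comment> \<open>Summed over the two signs, these values lose the part from \<open>snd w\<close>;
    summed with weight \<open>s\<close>, they lose the part from \<open>fst w\<close>.\<close>
  have x: "g (?x s) y = (s * blinfun_apply (snd w) y + s * s * g y (fst w)) / 2" for s y
  proof -
    have "g (?x s) y = (\<Sum>i\<in>I. sg i * g y (e i) * ((s * blinfun_apply (snd w) (e i) + s * s * g (e i) (fst w)) / 2))"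
      by (auto simp: g_simps gen_sp_emb g_sym[of y] algebra_simps intro!: sum.cong)
    also have "\<dots> = (s * blinfun_apply (snd w) (\<Sum>i\<in>I. (sg i * g y (e i)) *\<^sub>R e i)
          + s * s * g (\<Sum>i\<in>I. (sg i * g y (e i)) *\<^sub>R e i) (fst w)) / 2"
      by (simp add: blinfun.sum_right blinfun.scaleR_right g_simps sum_distrib_left sum.distrib[symmetric]
          sum_divide_distrib algebra_simps)
    finally show ?thesis by (simp add: frame_expand)
  qed
  show "fst (\<Sum>s\<in>{1,-1}. \<Sum>i\<in>I. (s * sg i * gen_sp w (emb s (e i))) *\<^sub>R emb s (e i)) = fst w"
  proof (rule g_nondeg)
    fix i
    have "g (fst (\<Sum>s\<in>{1,-1}. emb s (?x s))) (e i) = g (fst w) (e i)"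
      using x[of 1 "e i"] x[of "-1" "e i"]
      by (simp add: bilinear_ladd[OF g_bilinear] g_sym[of "fst w"] del: scaleR_minus_left mult_minus_left)
    then show "g (fst (\<Sum>s\<in>{1,-1}. \<Sum>i\<in>I. (s * sg i * gen_sp w (emb s (e i))) *\<^sub>R emb s (e i))) (e i) = g (fst w) (e i)"
      unfolding sum_emb .
  qed
  show "snd (\<Sum>s\<in>{1,-1}. \<Sum>i\<in>I. (s * sg i * gen_sp w (emb s (e i))) *\<^sub>R emb s (e i)) = snd w"
  proof (rule blinfun_eqI)
    fix y
    have "snd (\<Sum>s\<in>{1,-1}. emb s (?x s)) y = snd w y"
      using x[of 1 y] x[of "-1" y]
      by (simp add: blinfun.add_left snd_emb del: scaleR_minus_left mult_minus_left)
    then show "snd (\<Sum>s\<in>{1,-1}. \<Sum>i\<in>I. (s * sg i * gen_sp w (emb s (e i))) *\<^sub>R emb s (e i)) y = snd w y"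
      unfolding sum_emb .
  qed
qed

lemma gen_nondeg:
  assumes "\<And>s i. s = 1 \<or> s = -1 \<Longrightarrow> i \<in> I \<Longrightarrow> gen_sp w (emb s (e i)) = gen_sp w' (emb s (e i))"
  shows "w = w'"
proof -
  have "w = (\<Sum>s\<in>{1,-1}. \<Sum>i\<in>I. (s * sg i * gen_sp w (emb s (e i))) *\<^sub>R emb s (e i))"
    by (simp only: gen_expand)
  also have "\<dots> = (\<Sum>s\<in>{1,-1}. \<Sum>i\<in>I. (s * sg i * gen_sp w' (emb s (e i))) *\<^sub>R emb s (e i))"
    by (intro sum.cong refl) (use assms in auto)
  also have "\<dots> = w'" by (rule gen_expand)
  finally show ?thesis .
qed

end

subsection \<open>The generalized tangent space and the Ricci tensors\<close>

context orthonormal_frame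
begin

lemma gen_sp_emb_emb: "gen_sp (emb r x) (emb s y) = (r + s) / 2 * g x y"
  by (simp add: gen_sp_emb snd_emb g_sym[of y] algebra_simps add_divide_distrib)

text \<open>The Riesz vector of a functional, read off from \<open>gen_expand\<close>. It supplies
  both the adjoint in the torsion and the explicit connection.\<close>

lemma gen_sp_represent:
  assumes "linear \<phi>"
  shows "gen_sp (\<Sum>s\<in>{1,-1}. \<Sum>i\<in>I. (s * sg i * \<phi> (emb s (e i))) *\<^sub>R emb s (e i)) w = \<phi> w"
proof -
  have "\<phi> w = \<phi> (\<Sum>s\<in>{1,-1}. \<Sum>i\<in>I. (s * sg i * gen_sp w (emb s (e i))) *\<^sub>R emb s (e i))"
    by (simp only: gen_expand)
  also have "\<dots> = (\<Sum>s\<in>{1,-1}. \<Sum>i\<in>I. (s * sg i * gen_sp w (emb s (e i))) * \<phi> (emb s (e i)))"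
    by (simp only: linear_sum[OF assms] linear_scale[OF assms] real_scaleR_def)
  also have "\<dots> = gen_sp (\<Sum>s\<in>{1,-1}. \<Sum>i\<in>I. (s * sg i * \<phi> (emb s (e i))) *\<^sub>R emb s (e i)) w"
    unfolding bilin_simps[OF gen_sp_bilinear]
    by (intro sum.cong refl) (simp only: gen_sp_commute[of w] real_scaleR_def mult_ac)
  finally show ?thesis ..
qed

lemma gen_sp_nondeg:
  fixes z z' :: "'a gen"
  shows "(\<And>w. gen_sp z w = gen_sp z' w) \<Longrightarrow> z = z'"
  by (rule gen_nondeg) simp

lemma gen_sp_adjoint:
  fixes A :: "'a gen \<Rightarrow> 'a gen"
  assumes "linear A"
  shows "gen_sp (gen_adjoint A v) w = gen_sp v (A w)"
proof -
  let ?z = "\<Sum>s\<in>{1,-1}. \<Sum>i\<in>I. (s * sg i * gen_sp v (A (emb s (e i)))) *\<^sub>R emb s (e i)"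
  have lin: "linear (\<lambda>w. gen_sp v (A w))"
    using linear_compose[OF assms bilinear_linear(1)[OF gen_sp_bilinear]] by (simp add: o_def)
  have z: "\<forall>w. gen_sp ?z w = gen_sp v (A w)"
    using gen_sp_represent[OF lin] by blast
  have "gen_adjoint A v = ?z"
    unfolding gen_adjoint_def
    by (rule the_equality[where a = ?z]) (use z in \<open>auto intro!: gen_sp_nondeg\<close>)
  then show ?thesis using z by metis
qed

lemma gen_trace:
  assumes "linear F"
  shows "trace_on UNIV F = (\<Sum>s\<in>{1,-1}. \<Sum>i\<in>I. s * sg i * gen_sp (F (emb s (e i))) (emb s (e i)))"
proof -
  have "trace_on UNIV F = (\<Sum>p\<in>{1,-1} \<times> I. fst p * sg (snd p) *
      gen_sp (F (emb (fst p) (e (snd p)))) (emb (fst p) (e (snd p))))"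
  proof (rule trace_on_dual_family[where d = "\<lambda>p w. fst p * sg (snd p) * gen_sp w (emb (fst p) (e (snd p)))"])
    show "linear (\<lambda>w. fst p * sg (snd p) * gen_sp w (emb (fst p) (e (snd p))))" for p
      by (rule linearI) (simp_all add: bilin_simps[OF gen_sp_bilinear] algebra_simps)
    show "UNIV = span ((\<lambda>p. emb (fst p) (e (snd p))) ` ({1, - 1} \<times> I))"
    proof -
      have "w \<in> span ((\<lambda>p. emb (fst p) (e (snd p))) ` ({1, - 1} \<times> I))" for w
        by (subst gen_expand[of w, symmetric]) (intro span_sum span_scale span_base, force)
      then show ?thesis by blast
    qed
    show "fst p * sg (snd p) * gen_sp (emb (fst q) (e (snd q))) (emb (fst p) (e (snd p))) = (if p = q then 1 else 0)"
      if "p \<in> {1,-1} \<times> I" "q \<in> {1,-1} \<times> I" for p q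
      using that by (cases "snd p = snd q") (auto simp: gen_sp_emb_emb orthogonal unit prod_eq_iff)
  qed (use finite_I assms in auto)
  also have "\<dots> = (\<Sum>s\<in>{1,-1}. \<Sum>i\<in>I. s * sg i * gen_sp (F (emb s (e i))) (emb s (e i)))"
    by (simp only: sum.cartesian_product split_def)
  finally show ?thesis .
qed

lemma trace_on_emb:
  assumes s: "s * s = 1" and F: "linear F" and f: "\<And>x. F (emb s x) = emb s (f x)"
  shows "trace_on (range (emb s)) F = trace_on UNIV f"
proof -
  note lin = emb_linear[of s]
  have f_eq: "f = (\<lambda>x. fst (F (emb s x)))" by (simp add: f)
  have "linear f"
    unfolding f_eq by (rule linearI)
      (simp_all add: linear_add[OF lin] linear_add[OF F] linear_scale[OF lin] linear_scale[OF F])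
  have "trace_on (range (emb s)) F = (\<Sum>i\<in>I. s * sg i * gen_sp (F (emb s (e i))) (emb s (e i)))"
  proof (rule trace_on_dual_family[where d = "\<lambda>i w. s * sg i * gen_sp w (emb s (e i))"])
    show "linear (\<lambda>w. s * sg i * gen_sp w (emb s (e i)))" for i
      by (rule linearI) (simp_all add: bilin_simps[OF gen_sp_bilinear] algebra_simps)
    show "range (emb s) = span ((\<lambda>i. emb s (e i)) ` I)"
      using linear_span_image[OF lin, of "e ` I"] by (simp add: spanning image_image)
    show "s * sg i * gen_sp (emb s (e j)) (emb s (e i)) = (if i = j then 1 else 0)" if "i \<in> I" "j \<in> I" for i j
    proof (cases "i = j")
      case True
      then have "s * sg i * gen_sp (emb s (e j)) (emb s (e i)) = (s * s) * (sg i * sg i)"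
        by (simp add: gen_sp_emb_emb)
      then show ?thesis using True that unit s by simp
    qed (use that in \<open>simp add: gen_sp_emb_emb orthogonal\<close>)
  qed (use finite_I F f in auto)
  also have "\<dots> = (\<Sum>i\<in>I. (s * s) * (sg i * g (f (e i)) (e i)))"
    by (intro sum.cong refl) (simp add: f gen_sp_emb_emb)
  finally show ?thesis by (simp add: s frame_trace[OF \<open>linear f\<close>])
qed

text \<open>The projection to the image of \<open>emb s\<close>, pulled back to the Lie algebra: for
  \<open>s = 1\<close> and \<open>s = -1\<close> the component of \<open>u\<close> in the eigenspace
  is \<open>emb s (part s u)\<close>.\<close>

definition part :: "real \<Rightarrow> 'a gen \<Rightarrow> 'a" where
  "part s u = (\<Sum>i\<in>I. (s * sg i * gen_sp u (emb s (e i))) *\<^sub>R e i)"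

lemma part_linear: "linear (part s)"
  by (rule linearI) (simp_all add: part_def bilin_simps[OF gen_sp_bilinear] algebra_simps
      sum.distrib scaleR_sum_right)

lemma emb_part: "emb 1 (part 1 u) + emb (-1) (part (-1) u) = u"
proof -
  have "emb s (part s u) = (\<Sum>i\<in>I. (s * sg i * gen_sp u (emb s (e i))) *\<^sub>R emb s (e i))" for s
    by (simp add: part_def linear_sum[OF emb_linear] linear_scale[OF emb_linear])
  then have "emb 1 (part 1 u) + emb (-1) (part (-1) u)
      = (\<Sum>s\<in>{1,-1}. \<Sum>i\<in>I. (s * sg i * gen_sp u (emb s (e i))) *\<^sub>R emb s (e i))"
    by simp
  then show ?thesis by (simp only: gen_expand)
qed

lemma part_emb:
  assumes "s = 1 \<or> s = -1" "r = 1 \<or> r = -1"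
  shows "part s (emb r x) = (if s = r then x else 0)"
proof (cases "s = r")
  case True
  have "s * gen_sp (emb s x) (emb s (e i)) = g x (e i)" for i
    using assms(1) by (auto simp: gen_sp_emb_emb)
  then show ?thesis
    using True frame_expand[of x] by (simp add: part_def mult.assoc mult.left_commute[of r "sg _"])
next
  case False
  then have "r + s = 0" using assms by auto
  then show ?thesis using False by (simp add: part_def gen_sp_emb_emb)
qed

end

locale bracket_frame = orthonormal_frame +
  fixes br :: "'a \<Rightarrow> 'a \<Rightarrow> 'a" and H :: "'a \<Rightarrow> 'a \<Rightarrow> 'a \<Rightarrow> real"
  assumes br_bilinear: "bilinear br" and br_self: "br x x = 0" and H_alt: "alternating3 H"
begin

lemmas br_simps = bilin_simps[OF br_bilinear]
lemmas br_skew = skew_bilinear[OF br_bilinear br_self]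

lemma gen_sp_dorfman:
  "gen_sp (dorfman br H u v) w = (blinfun_apply (snd w) (br (fst u) (fst v)) - blinfun_apply (snd v) (br (fst u) (fst w))
     + blinfun_apply (snd u) (br (fst v) (fst w)) + H (fst u) (fst v) (fst w)) / 2"
proof -
  have "linear (\<lambda>Z. blinfun_apply \<eta> (br X Z))" for X \<eta>
    by (rule linearI) (simp_all add: br_simps blinfun.add_right blinfun.scaleR_right)
  then have "blinfun_apply (coad br X \<eta>) Z = blinfun_apply \<eta> (br X Z)" for X \<eta> Z
    unfolding coad_def by (subst blinfun_apply_Blinfun_linear) auto
  then show ?thesis
    using blinfun_apply_Blinfun_linear[OF alternating3_linear(3)[OF H_alt]]
    by (simp add: gen_sp_def dorfman_def blinfun.add_left blinfun.minus_left blinfun.diff_left)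
qed

text \<open>On left-invariant sections the scalar product is constant, so the usual defect of
  skewness of the Dorfman bracket vanishes and its coefficients form a three-form on
  \<open>E\<close>.\<close>

lemma gen_sp_dorfman_alternating: "alternating3 (\<lambda>u v w. gen_sp (dorfman br H u v) w)"
proof -
  note lin = alternating3_linear[OF H_alt]
  have skew: "blinfun_apply \<eta> (br x y) = - blinfun_apply \<eta> (br y x)" for \<eta> x y
    by (subst br_skew) (simp add: blinfun.minus_right)
  show ?thesis
    unfolding alternating3_def
  proof (intro conjI allI linearI)
    fix x y :: "'a gen"
    have "H p p q = 0 \<and> H p q p = 0 \<and> H p q q = 0" for p q
      using H_alt unfolding alternating3_def by blast
    then show "gen_sp (dorfman br H x x) y = 0" "gen_sp (dorfman br H x y) x = 0" "gen_sp (dorfman br H x y) y = 0"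
      unfolding gen_sp_dorfman using skew[of "snd x" "fst x" "fst y"]
      by (simp_all add: br_self blinfun.zero_right)
  qed (simp_all add: gen_sp_dorfman br_simps blinfun.add_left blinfun.add_right blinfun.scaleR_left
      blinfun.scaleR_right lin[THEN linear_add] lin[THEN linear_scale] field_simps)
qed

lemma dorfman_bilinear: "bilinear (dorfman br H)"
  unfolding bilinear_def
proof (intro conjI allI linearI; rule gen_sp_nondeg)
qed (simp_all add: bilin_simps[OF gen_sp_bilinear]
    alternating3_linear(1,2)[OF gen_sp_dorfman_alternating, THEN linear_add]
    alternating3_linear(1,2)[OF gen_sp_dorfman_alternating, THEN linear_scale])

text \<open>\<open>s * T s x y z / 2\<close> is the Dorfman coefficient of \<open>emb (-s) x\<close>, \<open>emb s y\<close>, \<open>emb s z\<close> for \<open>s = \<plusminus>1\<close>.\<close>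

definition T :: "real \<Rightarrow> 'a \<Rightarrow> 'a \<Rightarrow> 'a \<Rightarrow> real" where
  "T s x y z = s * H x y z + g (br x y) z + g (br z x) y - g (br y z) x"

text \<open>Each factor \<open>T / 2\<close> is a mixed component of the connection, whence the
  divisor 4; the double sum is the trace of a composition of two such components, and the minus sign
  comes from the bracket term of the curvature.\<close>

definition ricci :: "real \<Rightarrow> 'a \<Rightarrow> 'a \<Rightarrow> real" where
  "ricci s u a = - (\<Sum>i\<in>I. \<Sum>j\<in>I. sg i * sg j * T (-s) (e i) u (e j) * T s (e j) a (e i)) / 4"

text \<open>Exchange of the two summation indices. It makes the vanishing of the two Ricci tensors a
  single condition.\<close>

lemma ricci_swap: "ricci s u a = ricci (-s) a u"
  unfolding ricci_def by (subst sum.swap) (simp add: mult_ac)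

section \<open>The Ricci tensors of a divergence-free Levi-Civita connection\<close>

context
  fixes D
  assumes D: "gen_levi_civita br H g D" and div: "\<And>v. gen_divergence D v = 0"
begin

lemma D_bilinear: "bilinear D"
  using D by (simp add: gen_levi_civita_def gen_connection_def)

lemmas D_simps = bilin_simps[OF D_bilinear]

lemma D_emb:
  assumes "s = 1 \<or> s = -1"
  shows "D u (emb s y) = emb s (fst (D u (emb s y)))"
proof -
  have "D u (emb s y) \<in> range (emb s)"
    using D assms unfolding gen_levi_civita_def gen_plus_emb gen_minus_emb by blast
  then show ?thesis by auto
qed

text \<open>The adjoint term of the torsion drops out: paired with \<open>w\<close> it is the
  product of a vector of one eigenspace with \<open>D w\<close> of a vector of the other, and
  \<open>D\<close> preserves the eigenspaces, which are orthogonal.\<close>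

lemma dorfman_mixed:
  assumes s: "s = 1 \<or> s = -1"
  shows "dorfman br H (emb (-s) x) (emb s y) = D (emb (-s) x) (emb s y) - D (emb s y) (emb (-s) x)"
proof -
  have "gen_sp (gen_adjoint (\<lambda>w. D w (emb (-s) x)) (emb s y)) w = gen_sp 0 w" for w
  proof -
    have "gen_sp (gen_adjoint (\<lambda>w. D w (emb (-s) x)) (emb s y)) w = gen_sp (emb s y) (D w (emb (-s) x))"
      by (rule gen_sp_adjoint) (rule bilinear_linear(2)[OF D_bilinear])
    also have "\<dots> = 0"
      using s by (subst D_emb) (auto simp: gen_sp_emb_emb)
    finally show ?thesis by (simp add: gen_sp_def)
  qed
  then have "gen_adjoint (\<lambda>w. D w (emb (-s) x)) (emb s y) = 0"
    by (rule gen_sp_nondeg)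
  moreover have "gen_torsion br H D (emb (-s) x) (emb s y) = 0"
    using D unfolding gen_levi_civita_def by blast
  ultimately show ?thesis
    by (simp add: gen_torsion_def algebra_simps)
qed

text \<open>Pairing \<open>dorfman_mixed\<close> with \<open>emb s z\<close> kills its second term,
  which lies in the opposite eigenspace. The result is a metric connection with torsion given by
  \<open>s * H\<close>, in Koszul form.\<close>

lemma D_mixed:
  assumes s: "s = 1 \<or> s = -1"
  shows "g (fst (D (emb (-s) x) (emb s y))) z = T s x y z / 2"
proof -
  have "gen_sp (dorfman br H (emb (-s) x) (emb s y)) (emb s z) = s * g (fst (D (emb (-s) x) (emb s y))) z"
    using s by (subst dorfman_mixed, simp, subst (1 2) D_emb)
      (auto simp: bilin_simps[OF gen_sp_bilinear] gen_sp_emb_emb)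
  moreover have "gen_sp (dorfman br H (emb (-s) x) (emb s y)) (emb s z) = s * T s x y z / 2"
  proof -
    have "g z (br x y) = g (br x y) z" "g y (br x z) = - g (br z x) y" "g x (br y z) = g (br y z) x"
      unfolding br_skew[of z x] by (simp_all add: g_sym g_simps)
    then show ?thesis
      using s by (auto simp: gen_sp_dorfman snd_emb T_def)
  qed
  ultimately have "s * g (fst (D (emb (-s) x) (emb s y))) z = s * (T s x y z / 2)"
    by (simp only: times_divide_eq_right)
  moreover have "s \<noteq> 0" using s by auto
  ultimately show ?thesis using mult_cancel_left by blast
qed

lemma trace_curvature:
  assumes s: "s = 1 \<or> s = -1"
  shows "trace_on (range (emb s)) (\<lambda>w. gen_curvature br H D w (emb (-s) u) (emb s a)) = ricci s u a"
proof -
  \<comment> \<open>\<open>K\<close> collects the mixed components, which torsion-freeness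
    determines, and \<open>G\<close> the pure ones, which remain undetermined.\<close>
  define K where "K s x y = fst (D (emb (-s) x) (emb s y))" for s x y
  define G where "G x y = fst (D (emb s x) (emb s y))" for x y
  have K: "D (emb (-s) x) (emb s y) = emb s (K s x y)" and K': "D (emb s x) (emb (-s) y) = emb (-s) (K (-s) x y)"
    and G: "D (emb s x) (emb s y) = emb s (G x y)" for x y
    unfolding K_def G_def using s by (auto intro: D_emb)
  note lin_simps = linear_add[OF emb_linear] linear_scale[OF emb_linear] D_simps
  have K_lin: "linear (\<lambda>x. K r x y)" "linear (\<lambda>y. K r x y)" for r x y
    unfolding K_def by (rule linearI; simp add: lin_simps)+
  have G_lin: "linear (\<lambda>x. G x y)" "linear (\<lambda>y. G x y)" for x y
    unfolding G_def by (rule linearI; simp add: lin_simps)+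
  have curv: "gen_curvature br H D (emb s x) (emb (-s) u) (emb s a)
      = emb s (G x (K s u a) - K s u (G x a) + G (K s u x) a - K s (K (-s) x u) a)" for x
  proof -
    \<comment> \<open>The mixed bracket splits into one vector in each eigenspace; differentiating
      along them produces the last two terms of \<open>curv\<close>, one pure and one mixed.\<close>
    have "dorfman br H (emb s x) (emb (-s) u) = emb (-s) (K (-s) x u) - emb s (K s u x)"
      using dorfman_mixed[of "-s" x u] s K K' by (metis minus_equation_iff)
    then show ?thesis
      by (simp add: gen_curvature_def K K' G D_simps linear_diff[OF emb_linear] linear_add[OF emb_linear])
  qed
  have "trace_on (range (emb s)) (\<lambda>w. gen_curvature br H D w (emb (-s) u) (emb s a))
      = trace_on UNIV (\<lambda>x. G x (K s u a) - K s u (G x a) + G (K s u x) a - K s (K (-s) x u) a)"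
  proof (rule trace_on_emb)
    show "linear (\<lambda>w. gen_curvature br H D w (emb (-s) u) (emb s a))"
      by (rule linearI) (simp_all add: gen_curvature_def D_simps bilin_simps[OF dorfman_bilinear] algebra_simps)
  qed (use s in \<open>auto simp: curv\<close>)
  also have "\<dots> = trace_on UNIV (\<lambda>x. G x (K s u a)) - trace_on UNIV (\<lambda>x. K s u (G x a))
      + trace_on UNIV (\<lambda>x. G (K s u x) a) - trace_on UNIV (\<lambda>x. K s (K (-s) x u) a)"
  proof -
    have lins: "linear (\<lambda>x. K s u (G x a))" "linear (\<lambda>x. G (K s u x) a)" "linear (\<lambda>x. K s (K (-s) x u) a)"
      using linear_compose[OF G_lin(1) K_lin(2)] linear_compose[OF K_lin(2) G_lin(1)]
        linear_compose[OF K_lin(1) K_lin(1)] by (simp_all add: o_def)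
    show ?thesis
      using lins G_lin by (simp add: frame_trace linear_compose_sub linear_compose_add g_simps
          algebra_simps sum.distrib sum_subtractf)
  qed
  also have "trace_on UNIV (\<lambda>x. G (K s u x) a) = trace_on UNIV (\<lambda>x. K s u (G x a))"
    by (rule frame_trace_commute[OF G_lin(1) K_lin(2)])
  \<comment> \<open>Directions from the opposite eigenspace contribute nothing to the trace, since
    \<open>D\<close> of them on \<open>emb s b\<close> stays orthogonal to them. So the divergence
    of \<open>emb s b\<close> is the trace of the pure part alone.\<close>
  also have "trace_on UNIV (\<lambda>x. G x b) = 0" for b
  proof -
    have "0 = trace_on UNIV (\<lambda>w. D w (emb s b))"
      using div[of "emb s b"] by (simp add: gen_divergence_def)
    also have "\<dots> = (\<Sum>r\<in>{1,-1}. \<Sum>i\<in>I. r * sg i * gen_sp (D (emb r (e i)) (emb s b)) (emb r (e i)))"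
      by (rule gen_trace) (rule bilinear_linear(2)[OF D_bilinear])
    also have "\<dots> = (\<Sum>r\<in>{1,-1}. if r = s then \<Sum>i\<in>I. sg i * g (G (e i) b) (e i) else 0)"
    proof (intro sum.cong refl)
      fix r :: real assume r: "r \<in> {1,-1}"
      show "(\<Sum>i\<in>I. r * sg i * gen_sp (D (emb r (e i)) (emb s b)) (emb r (e i)))
          = (if r = s then \<Sum>i\<in>I. sg i * g (G (e i) b) (e i) else 0)"
      proof (cases "r = s")
        case True
        then show ?thesis using s by (auto simp: G gen_sp_emb_emb intro!: sum.cong)
      next
        case False
        then have "r = -s" using r s by auto
        then show ?thesis using s by (auto simp: K gen_sp_emb_emb)
      qed
    qed
    also have "\<dots> = trace_on UNIV (\<lambda>x. G x b)"
      using s by (auto simp: frame_trace[OF G_lin(1)])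
    finally show ?thesis ..
  qed
  also have "trace_on UNIV (\<lambda>x. K s (K (-s) x u) a) = - ricci s u a"
  proof -
    have T: "g (K r x y) z = T r x y z / 2" if "r = s \<or> r = -s" for r x y z
      unfolding K_def using that s by (intro D_mixed) auto
    show ?thesis
      by (subst frame_trace_comp[OF K_lin(1) K_lin(1)])
        (simp add: T ricci_def sum_divide_distrib mult_ac)
  qed
  finally show ?thesis by simp
qed

end

end

subsection \<open>A divergence-free Levi-Civita connection\<close>

context bracket_frame
begin

abbreviation proj :: "real \<Rightarrow> 'a gen \<Rightarrow> 'a gen" where
  "proj s u \<equiv> emb s (part s u)"

text \<open>
  The factor \<open>1 / 3\<close> makes the cyclic sum of the pure components equal to the Dorfman coefficient, and
  their total antisymmetry makes the divergence vanish.
\<close>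

definition lc_form :: "'a gen \<Rightarrow> 'a gen \<Rightarrow> 'a gen \<Rightarrow> real" where
  "lc_form u v w = (\<Sum>s\<in>{1,-1}. gen_sp (dorfman br H (proj (-s) u) (proj s v)) (proj s w)
     + gen_sp (dorfman br H (proj s u) (proj s v)) (proj s w) / 3)"

definition lc_connection :: "'a gen \<Rightarrow> 'a gen \<Rightarrow> 'a gen" where
  "lc_connection u v = (\<Sum>s\<in>{1,-1}. \<Sum>i\<in>I. (s * sg i * lc_form u v (emb s (e i))) *\<^sub>R emb s (e i))"

lemma lc_form_linear:
  "linear (\<lambda>u. lc_form u v w)" "linear (\<lambda>v. lc_form u v w)" "linear (\<lambda>w. lc_form u v w)"
  by (rule linearI; simp add: lc_form_def linear_add[OF part_linear] linear_scale[OF part_linear]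
      linear_add[OF emb_linear] linear_scale[OF emb_linear]
      bilin_simps[OF gen_sp_bilinear] bilin_simps[OF dorfman_bilinear] field_simps)+

lemma gen_sp_lc_connection: "gen_sp (lc_connection u v) w = lc_form u v w"
  unfolding lc_connection_def by (rule gen_sp_represent) (rule lc_form_linear)

lemma lc_form_skew: "lc_form u v w + lc_form u w v = 0"
  unfolding lc_form_def sum.distrib[symmetric]
proof (rule sum.neutral, rule ballI)
  fix s :: real
  show "gen_sp (dorfman br H (proj (-s) u) (proj s v)) (proj s w)
     + gen_sp (dorfman br H (proj s u) (proj s v)) (proj s w) / 3 +
     (gen_sp (dorfman br H (proj (-s) u) (proj s w)) (proj s v)
     + gen_sp (dorfman br H (proj s u) (proj s w)) (proj s v) / 3) = 0"
    using alternating3_swap(2)[OF gen_sp_dorfman_alternating, of "proj s u" "proj s v" "proj s w"]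
      alternating3_swap(2)[OF gen_sp_dorfman_alternating, of "proj (-s) u" "proj s v" "proj s w"]
    by linarith
qed

text \<open>Torsion-freeness of \<open>lc_connection\<close>, once \<open>lc_form_skew\<close> has
  been applied. Splitting all three arguments gives eight components: the two pure ones occur three
  times with weight \<open>1 / 3\<close>, each of the six mixed ones exactly once.\<close>

lemma lc_form_cyclic: "lc_form u v w + lc_form v w u + lc_form w u v = gen_sp (dorfman br H u v) w"
proof -
  have cyc: "gen_sp (dorfman br H y z) x = gen_sp (dorfman br H x y) z" for x y z
    using alternating3_swap(1)[OF gen_sp_dorfman_alternating, of y x z]
      alternating3_swap(2)[OF gen_sp_dorfman_alternating, of y z x] by linarith
  let ?p = "proj 1" and ?m = "proj (-1)"
  have "gen_sp (dorfman br H u v) w = gen_sp (dorfman br H (?p u + ?m u) (?p v + ?m v)) (?p w + ?m w)"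
    by (simp only: emb_part)
  also have "\<dots> = lc_form u v w + lc_form v w u + lc_form w u v"
    using cyc[of "?p u" "?p v" "?p w"] cyc[of "?m u" "?m v" "?m w"]
      cyc[of "?p v" "?p w" "?p u"] cyc[of "?m v" "?m w" "?m u"]
      cyc[of "?m v" "?p w" "?p u"] cyc[of "?p v" "?m w" "?m u"]
      cyc[of "?p u" "?p v" "?m w"] cyc[of "?m u" "?m v" "?p w"]
    by (simp add: lc_form_def bilin_simps[OF gen_sp_bilinear] bilin_simps[OF dorfman_bilinear])
  finally show ?thesis ..
qed

lemma lc_connection_levi_civita: "gen_levi_civita br H g lc_connection"
  unfolding gen_levi_civita_def gen_connection_def
proof (intro conjI allI)
  show bil: "bilinear lc_connection"
    unfolding bilinear_def
    by (intro conjI allI linearI; rule gen_sp_nondeg)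
      (simp_all add: bilin_simps[OF gen_sp_bilinear] gen_sp_lc_connection
        lc_form_linear[THEN linear_add] lc_form_linear[THEN linear_scale])
  show "gen_sp (lc_connection u v) w + gen_sp v (lc_connection u w) = 0" for u v w
    using lc_form_skew by (simp add: gen_sp_commute[of v] gen_sp_lc_connection)
  show "gen_torsion br H lc_connection u v = 0" for u v
  proof (rule gen_sp_nondeg)
    fix w
    have "gen_sp (gen_adjoint (\<lambda>w. lc_connection w u) v) w = lc_form w u v"
      by (subst gen_sp_adjoint[OF bilinear_linear(2)[OF bil]])
        (simp add: gen_sp_commute[of v] gen_sp_lc_connection)
    then show "gen_sp (gen_torsion br H lc_connection u v) w = gen_sp 0 w"
      using lc_form_cyclic[of u v w] lc_form_skew[of v u w]
      by (simp add: gen_torsion_def bilin_simps[OF gen_sp_bilinear] gen_sp_lc_connection)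
  qed
  \<comment> \<open>The product with every vector of the opposite eigenspace vanishes, so the
    opposite projection does.\<close>
  have pres: "lc_connection u (emb s y) \<in> range (emb s)" if s: "s = 1 \<or> s = -1" for s u y
  proof -
    have "lc_form u (emb s y) (emb (-s) x) = 0" for x
      using s by (auto simp: lc_form_def part_emb linear_0[OF emb_linear] bilin_simps[OF gen_sp_bilinear]
          bilin_simps[OF dorfman_bilinear])
    then have "part (-s) (lc_connection u (emb s y)) = 0"
      by (simp add: part_def gen_sp_lc_connection)
    then have "emb s (part s (lc_connection u (emb s y))) = lc_connection u (emb s y)"
      using emb_part[of "lc_connection u (emb s y)"] s by (auto simp: linear_0[OF emb_linear])
    then show ?thesis by (metis rangeI)
  qed
  show "lc_connection u ` gen_plus g \<subseteq> gen_plus g" "lc_connection u ` gen_minus g \<subseteq> gen_minus g" for u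
    unfolding gen_plus_emb gen_minus_emb by (intro image_subsetI, elim rangeE, simp add: pres)+
qed

lemma lc_connection_divergence: "gen_divergence lc_connection v = 0"
proof -
  have alt: "gen_sp (dorfman br H x y) x = 0" for x y
    using gen_sp_dorfman_alternating unfolding alternating3_def by blast
  have "lc_form (emb s x) v (emb s x) = 0" if "s = 1 \<or> s = -1" for s x
    using that by (auto simp: lc_form_def part_emb linear_0[OF emb_linear] alt
        bilin_simps[OF gen_sp_bilinear] bilin_simps[OF dorfman_bilinear])
  moreover have "bilinear lc_connection"
    using lc_connection_levi_civita by (simp add: gen_levi_civita_def gen_connection_def)
  ultimately show ?thesis
    by (simp add: gen_divergence_def gen_trace bilinear_linear(2) gen_sp_lc_connection)
qed

text \<open>\<open>trace_curvature\<close> gives the condition for each admissible connection; the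
  existence of \<open>lc_connection\<close> is what makes the implication from right to left
  work.\<close>

lemma gen_einstein_iff: "gen_einstein br H g \<longleftrightarrow> (\<forall>u a. ricci 1 u a = 0)"
proof -
  have ric: "(\<forall>um\<in>gen_minus g. \<forall>up\<in>gen_plus g. ric_plus br H g D um up = 0) \<and>
      (\<forall>up\<in>gen_plus g. \<forall>um\<in>gen_minus g. ric_minus br H g D up um = 0) \<longleftrightarrow> (\<forall>u a. ricci 1 u a = 0)"
    if "gen_levi_civita br H g D" "\<forall>v. gen_divergence D v = 0" for D
    using trace_curvature[OF that(1), of 1] trace_curvature[OF that(1), of "-1"] that(2) ricci_swap[of 1]
    by (simp add: gen_plus_emb gen_minus_emb ric_plus_def ric_minus_def) blast
  then show ?thesis
    unfolding gen_einstein_def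
    using lc_connection_levi_civita lc_connection_divergence by meson
qed

end

subsection \<open>Oriented frames in dimension three\<close>

text \<open>Keeps the frame index \<open>1\<close> from being rewritten to \<open>Suc 0\<close>.\<close>

declare One_nat_def [simp del]

lemma alternating3_divide:
  assumes "alternating3 \<mu>"
  shows "alternating3 (\<lambda>x y z. \<mu> x y z / c)"
proof -
  note lin = alternating3_linear[OF assms]
  show ?thesis
    unfolding alternating3_def
    using assms[unfolded alternating3_def]
    by (auto intro!: linearI simp: lin[THEN linear_add] lin[THEN linear_scale] add_divide_distrib)
qed

lemma sum_1_3: "(\<Sum>i\<in>{1..3::nat}. f i) = f 1 + f 2 + f 3"
proof -
  have "{1..3::nat} = {1, 2, 3}" by auto
  then show ?thesis by (simp add: add.assoc)
qed

lemma ball_1_3: "(\<forall>i\<in>{1..3::nat}. P i) \<longleftrightarrow> P 1 \<and> P 2 \<and> P 3"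
proof -
  have "{1..3::nat} = {1, 2, 3}" by auto
  then show ?thesis by simp
qed

lemma bilinear_zero_iff:
  fixes b :: "'a::real_vector \<Rightarrow> 'a \<Rightarrow> real"
  assumes b: "bilinear b" and "span S = UNIV"
  shows "(\<forall>x y. b x y = 0) \<longleftrightarrow> (\<forall>x\<in>S. \<forall>y\<in>S. b x y = 0)"
proof
  assume a: "\<forall>x\<in>S. \<forall>y\<in>S. b x y = 0"
  have "b x y = 0" if "x \<in> S" for x y
  proof -
    have "y \<in> span S" using assms(2) by simp
    then show ?thesis
      by (induction rule: span_induct_alt) (use that a in \<open>auto simp: bilin_simps[OF b]\<close>)
  qed
  then have "b x y = 0" for x y
  proof -
    have "x \<in> span S" using assms(2) by simp
    then show ?thesis
      by (induction rule: span_induct_alt) (use \<open>\<And>x y. x \<in> S \<Longrightarrow> b x y = 0\<close> in \<open>auto simp: bilin_simps[OF b]\<close>)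
  qed
  then show "\<forall>x y. b x y = 0" by blast
qed blast

text \<open>The identity \<open>det (P E P\<^sup>T) = (det P)\<^sup>2 det E\<close> for a diagonal
  matrix \<open>E\<close>: the right-hand side is the Gram determinant of the rows of
  \<open>P\<close>.\<close>

lemma gram_det3:
  fixes e1 e2 e3 :: real
  shows "(x1 * (y2 * z3 - y3 * z2) - x2 * (y1 * z3 - y3 * z1) + x3 * (y1 * z2 - y2 * z1))\<^sup>2 * (e1 * e2 * e3)
    = (e1*x1*x1 + e2*x2*x2 + e3*x3*x3) * ((e1*y1*y1 + e2*y2*y2 + e3*y3*y3) * (e1*z1*z1 + e2*z2*z2 + e3*z3*z3)
        - (e1*y1*z1 + e2*y2*z2 + e3*y3*z3) * (e1*y1*z1 + e2*y2*z2 + e3*y3*z3))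
      - (e1*x1*y1 + e2*x2*y2 + e3*x3*y3) * ((e1*x1*y1 + e2*x2*y2 + e3*x3*y3) * (e1*z1*z1 + e2*z2*z2 + e3*z3*z3)
        - (e1*y1*z1 + e2*y2*z2 + e3*y3*z3) * (e1*x1*z1 + e2*x2*z2 + e3*x3*z3))
      + (e1*x1*z1 + e2*x2*z2 + e3*x3*z3) * ((e1*x1*y1 + e2*x2*y2 + e3*x3*y3) * (e1*y1*z1 + e2*y2*z2 + e3*y3*z3)
        - (e1*y1*y1 + e2*y2*y2 + e3*y3*y3) * (e1*x1*z1 + e2*x2*z2 + e3*x3*z3))"
  by algebra

locale frame3 = orthonormal_frame g "{1..3::nat}" v for g :: "'a::euclidean_space \<Rightarrow> 'a \<Rightarrow> real" and v
begin

lemma sg_sq [simp]: "sg 1 * sg 1 = 1" "sg 2 * sg 2 = 1" "sg 3 * sg 3 = 1"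
  by (rule unit, simp)+

lemma sg_sq_left [simp]: "sg 1 * (sg 1 * x) = x" "sg 2 * (sg 2 * x) = x" "sg 3 * (sg 3 * x) = x"
  by (simp_all flip: mult.assoc)

lemma g_frame_offdiag [simp]:
  "g (v 1) (v 2) = 0" "g (v 2) (v 1) = 0" "g (v 1) (v 3) = 0" "g (v 3) (v 1) = 0" "g (v 2) (v 3) = 0" "g (v 3) (v 2) = 0"
  by (rule orthogonal; simp)+

definition coord :: "nat \<Rightarrow> 'a \<Rightarrow> real" where "coord i x = sg i * g x (v i)"

lemma coord_linear: "linear (coord i)"
  by (rule linearI) (simp_all add: coord_def g_simps algebra_simps)

lemma coord_expand: "x = coord 1 x *\<^sub>R v 1 + coord 2 x *\<^sub>R v 2 + coord 3 x *\<^sub>R v 3"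
  using frame_expand[of x] by (simp only: sum_1_3 coord_def)

text \<open>Three-forms on a three-dimensional space are a line; the factor is the determinant of
  the coordinates.\<close>

lemma alternating3_coord:
  assumes \<mu>: "alternating3 \<mu>"
  shows "\<mu> x y z = (coord 1 x * (coord 2 y * coord 3 z - coord 3 y * coord 2 z)
     - coord 2 x * (coord 1 y * coord 3 z - coord 3 y * coord 1 z)
     + coord 3 x * (coord 1 y * coord 2 z - coord 2 y * coord 1 z)) * \<mu> (v 1) (v 2) (v 3)"
proof -
  have diag: "\<mu> p p q = 0" "\<mu> p q p = 0" "\<mu> p q q = 0" for p q
    using \<mu> unfolding alternating3_def by blast+
  note sw = alternating3_swap[OF \<mu>] and lin = alternating3_linear[OF \<mu>]
  have perm: "\<mu> (v 2) (v 1) (v 3) = - \<mu> (v 1) (v 2) (v 3)" "\<mu> (v 1) (v 3) (v 2) = - \<mu> (v 1) (v 2) (v 3)"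
    "\<mu> (v 3) (v 2) (v 1) = - \<mu> (v 1) (v 2) (v 3)" "\<mu> (v 2) (v 3) (v 1) = \<mu> (v 1) (v 2) (v 3)"
    "\<mu> (v 3) (v 1) (v 2) = \<mu> (v 1) (v 2) (v 3)"
    using sw(1)[of "v 2" "v 1" "v 3"] sw(2)[of "v 1" "v 2" "v 3"] sw(1)[of "v 3" "v 2" "v 1"]
      sw(2)[of "v 2" "v 3" "v 1"] sw(1)[of "v 3" "v 1" "v 2"] by linarith+
  have "\<mu> x y z = \<mu> (coord 1 x *\<^sub>R v 1 + coord 2 x *\<^sub>R v 2 + coord 3 x *\<^sub>R v 3)
     (coord 1 y *\<^sub>R v 1 + coord 2 y *\<^sub>R v 2 + coord 3 y *\<^sub>R v 3)
     (coord 1 z *\<^sub>R v 1 + coord 2 z *\<^sub>R v 2 + coord 3 z *\<^sub>R v 3)"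
    by (simp only: coord_expand[symmetric])
  also have "\<dots> = (coord 1 x * (coord 2 y * coord 3 z - coord 3 y * coord 2 z)
     - coord 2 x * (coord 1 y * coord 3 z - coord 3 y * coord 1 z)
     + coord 3 x * (coord 1 y * coord 2 z - coord 2 y * coord 1 z)) * \<mu> (v 1) (v 2) (v 3)"
    unfolding lin[THEN linear_add] lin[THEN linear_scale] diag perm real_scaleR_def
    by algebra
  finally show ?thesis .
qed

end

section \<open>The volume form and the cross product in an oriented frame\<close>

locale oriented_frame3 = frame3 +
  fixes \<omega> :: "'a \<Rightarrow> 'a \<Rightarrow> 'a \<Rightarrow> real"
  assumes \<omega>_alt: "alternating3 \<omega>" and \<omega>_pos: "\<omega> (v 1) (v 2) (v 3) > 0"
begin

text \<open>The Gram determinant shows that the change of frame has determinant 1 or -1, and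
  orientation excludes -1. Hence the description defining \<open>vol_form\<close> is met by a
  multiple of \<open>\<omega>\<close>.\<close>

lemma oriented_orthonormal_volume:
  assumes w: "oriented_orthonormal g \<omega> w"
  shows "\<omega> (w 1) (w 2) (w 3) = \<omega> (v 1) (v 2) (v 3)"
proof -
  define p where "p a i = g (w a) (v i)" for a i
  define dp where "dp = p 1 1 * (p 2 2 * p 3 3 - p 2 3 * p 3 2) - p 1 2 * (p 2 1 * p 3 3 - p 2 3 * p 3 1)
    + p 1 3 * (p 2 1 * p 3 2 - p 2 2 * p 3 1)"
  have gram: "g (w a) (w b) = sg 1 * p a 1 * p b 1 + sg 2 * p a 2 * p b 2 + sg 3 * p a 3 * p b 3" for a b
    unfolding p_def by (subst g_frame) (rule sum_1_3)
  have orth: "g (w 1) (w 2) = 0" "g (w 1) (w 3) = 0" "g (w 2) (w 3) = 0"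
    using w unfolding oriented_orthonormal_def by auto
  have "dp\<^sup>2 * (sg 1 * sg 2 * sg 3) = g (w 1) (w 1) * (g (w 2) (w 2) * g (w 3) (w 3) - g (w 2) (w 3) * g (w 2) (w 3))
      - g (w 1) (w 2) * (g (w 1) (w 2) * g (w 3) (w 3) - g (w 2) (w 3) * g (w 1) (w 3))
      + g (w 1) (w 3) * (g (w 1) (w 2) * g (w 2) (w 3) - g (w 2) (w 2) * g (w 1) (w 3))"
    unfolding gram dp_def by (rule gram_det3)
  then have "dp\<^sup>2 * (sg 1 * sg 2 * sg 3) = g (w 1) (w 1) * (g (w 2) (w 2) * g (w 3) (w 3))"
    by (simp only: orth) simp
  then have "\<bar>dp\<^sup>2 * (sg 1 * sg 2 * sg 3)\<bar> = 1"
    using w unfolding oriented_orthonormal_def ball_1_3 by (simp add: abs_mult)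
  moreover have "\<bar>sg i\<bar> = 1" if "i \<in> {1..3}" for i
    using unit[OF that] by (metis abs_mult_self_eq abs_one abs_square_eq_1 power2_eq_square)
  ultimately have "dp\<^sup>2 = 1"
    by (simp add: abs_mult)
  \<comment> \<open>\<open>dp\<close> is built from the products \<open>g (w a) (v i)\<close>,
    whereas coordinates carry an extra factor \<open>sg i\<close>; \<open>d\<close> is the true
    determinant.\<close>
  define d where "d = sg 1 * sg 2 * sg 3 * dp"
  have "d\<^sup>2 = (sg 1 * sg 1) * (sg 2 * sg 2) * (sg 3 * sg 3) * dp\<^sup>2"
    unfolding d_def by algebra
  then have "d\<^sup>2 = 1" by (simp only: sg_sq \<open>dp\<^sup>2 = 1\<close>)
  have "\<omega> (w 1) (w 2) (w 3) = d * \<omega> (v 1) (v 2) (v 3)"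
    unfolding d_def dp_def p_def alternating3_coord[OF \<omega>_alt, of "w 1"] coord_def by algebra
  moreover have "\<omega> (w 1) (w 2) (w 3) > 0"
    using w unfolding oriented_orthonormal_def by simp
  ultimately have "d > 0" using \<omega>_pos by (simp add: zero_less_mult_iff)
  then have "d = 1" using \<open>d\<^sup>2 = 1\<close> by (simp add: power2_eq_1_iff)
  then show ?thesis using \<open>\<omega> (w 1) (w 2) (w 3) = d * _\<close> by simp
qed

lemma oriented_orthonormal_frame: "oriented_orthonormal g \<omega> v"
proof -
  have "\<bar>sg i\<bar> = 1" if "i \<in> {1..3}" for i
    using unit[OF that] by (metis abs_mult_self_eq abs_one abs_square_eq_1 power2_eq_square)
  then show ?thesis
    unfolding oriented_orthonormal_def using orthogonal \<omega>_pos by auto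
qed

lemma vol_form_eq: "vol_form g \<omega> = (\<lambda>x y z. \<omega> x y z / \<omega> (v 1) (v 2) (v 3))"
  unfolding vol_form_def
proof (rule the_equality)
  let ?vol = "\<lambda>x y z. \<omega> x y z / \<omega> (v 1) (v 2) (v 3)"
  have "alternating3 ?vol"
    by (rule alternating3_divide[OF \<omega>_alt])
  then show "alternating3 ?vol \<and> (\<forall>w. oriented_orthonormal g \<omega> w \<longrightarrow> ?vol (w 1) (w 2) (w 3) = 1)"
    using oriented_orthonormal_volume \<omega>_pos by simp
  fix \<mu> assume \<mu>: "alternating3 \<mu> \<and> (\<forall>w. oriented_orthonormal g \<omega> w \<longrightarrow> \<mu> (w 1) (w 2) (w 3) = 1)"
  then have "\<mu> (v 1) (v 2) (v 3) = 1" using oriented_orthonormal_frame by blast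
  then show "\<mu> = ?vol"
  proof (intro ext)
    fix x y z
    show "\<mu> x y z = ?vol x y z"
      using alternating3_coord[OF conjunct1[OF \<mu>], of x y z] \<open>\<mu> (v 1) (v 2) (v 3) = 1\<close>
        alternating3_coord[OF \<open>alternating3 ?vol\<close>, of x y z] \<omega>_pos by simp
  qed
qed

lemma vol_form_alternating: "alternating3 (vol_form g \<omega>)"
  and vol_form_frame: "vol_form g \<omega> (v 1) (v 2) (v 3) = 1"
proof -
  show "alternating3 (vol_form g \<omega>)"
    unfolding vol_form_eq by (rule alternating3_divide[OF \<omega>_alt])
  show "vol_form g \<omega> (v 1) (v 2) (v 3) = 1"
    using \<omega>_pos by (simp add: vol_form_eq)
qed

lemma alternating3_vol_form:
  assumes "alternating3 H"
  shows "H x y z = H (v 1) (v 2) (v 3) * vol_form g \<omega> x y z"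
  using alternating3_coord[OF assms, of x y z] alternating3_coord[OF vol_form_alternating, of x y z]
  by (simp add: vol_form_frame)

lemma g_cross_prod: "g (cross_prod g \<omega> x y) z = vol_form g \<omega> x y z"
proof -
  note lin = alternating3_linear(3)[OF vol_form_alternating]
  define c where "c = (\<Sum>i\<in>{1..3}. (sg i * vol_form g \<omega> x y (v i)) *\<^sub>R v i)"
  have c: "g c z = vol_form g \<omega> x y z" for z
  proof -
    have "g c z = vol_form g \<omega> x y (\<Sum>i\<in>{1..3}. (sg i * g z (v i)) *\<^sub>R v i)"
      by (simp add: c_def g_simps linear_sum[OF lin] linear_scale[OF lin] g_sym[of _ z] mult_ac)
    then show ?thesis by (simp only: frame_expand)
  qed
  have "cross_prod g \<omega> x y = c"
    unfolding cross_prod_def by (rule the_equality) (use c in \<open>auto intro!: g_nondeg\<close>)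
  then show ?thesis using c by simp
qed

lemma cross_prod_frame:
  "cross_prod g \<omega> (v 1) (v 2) = sg 3 *\<^sub>R v 3" "cross_prod g \<omega> (v 2) (v 3) = sg 1 *\<^sub>R v 1"
  "cross_prod g \<omega> (v 3) (v 1) = sg 2 *\<^sub>R v 2"
proof -
  have diag: "vol_form g \<omega> p q p = 0" "vol_form g \<omega> p q q = 0" for p q
    using vol_form_alternating unfolding alternating3_def by blast+
  note sw = alternating3_swap[OF vol_form_alternating]
  have cyc: "vol_form g \<omega> (v 2) (v 3) (v 1) = 1" "vol_form g \<omega> (v 3) (v 1) (v 2) = 1"
    using vol_form_frame sw(1)[of "v 2" "v 1" "v 3"] sw(2)[of "v 2" "v 3" "v 1"] sw(2)[of "v 1" "v 2" "v 3"]
      sw(1)[of "v 3" "v 1" "v 2"] by linarith+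
  have eq: "x = y" if "g x (v 1) = g y (v 1)" "g x (v 2) = g y (v 2)" "g x (v 3) = g y (v 3)" for x y
  proof (rule g_nondeg)
    fix i :: nat assume "i \<in> {1..3}"
    then have "i = 1 \<or> i = 2 \<or> i = 3" by auto
    then show "g x (v i) = g y (v i)" using that by metis
  qed
  show "cross_prod g \<omega> (v 1) (v 2) = sg 3 *\<^sub>R v 3" "cross_prod g \<omega> (v 2) (v 3) = sg 1 *\<^sub>R v 1"
    "cross_prod g \<omega> (v 3) (v 1) = sg 2 *\<^sub>R v 2"
    by (rule eq; simp only: g_cross_prod diag cyc vol_form_frame g_simps g_frame_offdiag sg_sq real_scaleR_def mult_zero_right)+
qed

end

subsection \<open>The Einstein equations in dimension three\<close>

text \<open>The relation \<open>[u, v] = L (u \<times> v)\<close> is required on frame pairs only,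
  where \<open>v 1 \<times> v 2\<close> is \<open>sg 3\<close> times \<open>v 3\<close>, and
  cyclically. In this form it mentions no orientation.\<close>

locale bracket_frame3 = frame3 g v + bracket_frame g "{1..3::nat}" v br H
  for g :: "'a::euclidean_space \<Rightarrow> 'a \<Rightarrow> real" and v br H +
  fixes L :: "'a \<Rightarrow> 'a"
  assumes L_linear: "linear L" and br_frame: "br (v 1) (v 2) = sg 3 *\<^sub>R L (v 3)"
    "br (v 2) (v 3) = sg 1 *\<^sub>R L (v 1)" "br (v 3) (v 1) = sg 2 *\<^sub>R L (v 2)"
begin

text \<open>Up to sign, the trace of \<open>br (v k)\<close> is the skew part of \<open>L\<close> in
  the other two indices.\<close>

lemma unimodular_iff:
  "unimodular br \<longleftrightarrow> g (L (v 1)) (v 2) = g (L (v 2)) (v 1) \<and> g (L (v 2)) (v 3) = g (L (v 3)) (v 2)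
     \<and> g (L (v 3)) (v 1) = g (L (v 1)) (v 3)"
proof -
  have br_frame': "br (v 2) (v 1) = - (sg 3 *\<^sub>R L (v 3))" "br (v 3) (v 2) = - (sg 1 *\<^sub>R L (v 1))"
    "br (v 1) (v 3) = - (sg 2 *\<^sub>R L (v 2))"
    by (subst br_skew, simp add: br_frame)+
  define tr where "tr x = trace_on UNIV (br x)" for x
  have tr: "tr x = (\<Sum>i\<in>{1..3}. sg i * g (br x (v i)) (v i))" for x
    unfolding tr_def by (rule frame_trace) (rule bilinear_linear(1)[OF br_bilinear])
  have tr_lin: "linear tr"
    by (rule linearI) (simp_all add: tr br_simps g_simps sum.distrib sum_distrib_left algebra_simps)
  have tr_frame: "tr (v 1) = sg 2 * sg 3 * (g (L (v 3)) (v 2) - g (L (v 2)) (v 3))"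
    "tr (v 2) = sg 1 * sg 3 * (g (L (v 1)) (v 3) - g (L (v 3)) (v 1))"
    "tr (v 3) = sg 1 * sg 2 * (g (L (v 2)) (v 1) - g (L (v 1)) (v 2))"
    by (simp_all add: tr sum_1_3 br_frame br_frame' br_self g_simps algebra_simps)
  have "sg 1 \<noteq> 0" "sg 2 \<noteq> 0" "sg 3 \<noteq> 0"
    using sg_sq by force+
  moreover have "unimodular br \<longleftrightarrow> tr (v 1) = 0 \<and> tr (v 2) = 0 \<and> tr (v 3) = 0"
  proof
    assume a: "tr (v 1) = 0 \<and> tr (v 2) = 0 \<and> tr (v 3) = 0"
    have "tr x = 0" for x
      by (subst coord_expand[of x])
        (simp add: linear_add[OF tr_lin] linear_scale[OF tr_lin] a)
    then show "unimodular br" by (simp add: unimodular_def tr_def)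
  qed (simp add: unimodular_def tr_def)
  ultimately show ?thesis
    by (simp add: tr_frame) argo
qed

text \<open>The bilinear form of \<open>tr L - 2 L\<close>, the trace being the signed sum in front.
  For a unimodular bracket its matrix in the frame is symmetric, while that of the endomorphism need
  not be when \<open>g\<close> is indefinite.\<close>

definition M :: "'a \<Rightarrow> 'a \<Rightarrow> real" where
  "M x y = (sg 1 * g (L (v 1)) (v 1) + sg 2 * g (L (v 2)) (v 2) + sg 3 * g (L (v 3)) (v 3)) * g x y
     - 2 * g (L x) y"

lemma M_bilinear: "bilinear M"
  unfolding bilinear_def
  by (auto intro!: linearI simp: M_def g_simps linear_add[OF L_linear] linear_scale[OF L_linear] algebra_simps)

text \<open>All three equations say that \<open>T s x y z\<close> is the form
  \<open>M + s h g\<close> at \<open>x\<close> and \<open>y \<times> z\<close>; each sign in front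
  comes from the cross product of two frame vectors.\<close>

lemma T_frame:
  assumes sym: "g (L (v 2)) (v 1) = g (L (v 1)) (v 2)" "g (L (v 3)) (v 2) = g (L (v 2)) (v 3)"
    "g (L (v 3)) (v 1) = g (L (v 1)) (v 3)" and i: "i \<in> {1..3}"
  shows "T s (v i) (v 1) (v 2) = sg 3 * (s * H (v 1) (v 2) (v 3) * g (v i) (v 3) + M (v i) (v 3))"
    "T s (v i) (v 2) (v 3) = sg 1 * (s * H (v 1) (v 2) (v 3) * g (v i) (v 1) + M (v i) (v 1))"
    "T s (v i) (v 3) (v 1) = sg 2 * (s * H (v 1) (v 2) (v 3) * g (v i) (v 2) + M (v i) (v 2))"
proof -
  have br_frame': "br (v 2) (v 1) = - (sg 3 *\<^sub>R L (v 3))" "br (v 3) (v 2) = - (sg 1 *\<^sub>R L (v 1))"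
    "br (v 1) (v 3) = - (sg 2 *\<^sub>R L (v 2))"
    by (subst br_skew, simp add: br_frame)+
  have diag: "H p p q = 0" "H p q p = 0" "H p q q = 0" for p q
    using H_alt unfolding alternating3_def by blast+
  note sw = alternating3_swap[OF H_alt]
  have cyc: "H (v 2) (v 3) (v 1) = H (v 1) (v 2) (v 3)" "H (v 3) (v 1) (v 2) = H (v 1) (v 2) (v 3)"
    using sw(1)[of "v 2" "v 1" "v 3"] sw(2)[of "v 2" "v 3" "v 1"] sw(2)[of "v 1" "v 2" "v 3"]
      sw(1)[of "v 3" "v 1" "v 2"] by linarith+
  have "i = 1 \<or> i = 2 \<or> i = 3" using i by auto
  then show "T s (v i) (v 1) (v 2) = sg 3 * (s * H (v 1) (v 2) (v 3) * g (v i) (v 3) + M (v i) (v 3))"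
    "T s (v i) (v 2) (v 3) = sg 1 * (s * H (v 1) (v 2) (v 3) * g (v i) (v 1) + M (v i) (v 1))"
    "T s (v i) (v 3) (v 1) = sg 2 * (s * H (v 1) (v 2) (v 3) * g (v i) (v 2) + M (v i) (v 2))"
    by (elim disjE; simp add: T_def M_def br_frame br_frame' br_self g_simps diag cyc sym algebra_simps)+
qed

lemma T_swap: "T s x z y = - T s x y z" and T_diag: "T s x y y = 0"
proof -
  show 1: "T s x z y = - T s x y z" for y z
    using br_skew[of x y] br_skew[of x z] br_skew[of y z]
    by (simp add: T_def g_simps alternating3_swap(2)[OF H_alt, of x z y])
  show "T s x y y = 0" using 1[of y y] by simp
qed

lemma ricci_bilinear: "bilinear (ricci s)"
proof -
  have "linear (\<lambda>y. T r x y z)" for r x z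
    by (rule linearI)
      (simp_all add: T_def br_simps g_simps alternating3_linear(2)[OF H_alt, THEN linear_add]
        alternating3_linear(2)[OF H_alt, THEN linear_scale] algebra_simps)
  note lin = this[THEN linear_add] this[THEN linear_scale]
  show ?thesis
    unfolding bilinear_def
    by (auto intro!: linearI simp: ricci_def lin sum_1_3 algebra_simps add_divide_distrib diff_divide_distrib)
qed

text \<open>The nine Ricci components on the frame give only six conditions because \<open>M\<close>
  is symmetric; together they are the entries of \<open>adj M = h\<^sup>2\<close> with respect to
  \<open>g\<close>.\<close>

lemma gen_einstein_iff_minors:
  assumes "unimodular br"
  defines "h \<equiv> H (v 1) (v 2) (v 3)"
  shows "gen_einstein br H g \<longleftrightarrow>
     M (v 2) (v 2) * M (v 3) (v 3) - M (v 2) (v 3) * M (v 2) (v 3) = h\<^sup>2 * sg 2 * sg 3 \<and>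
     M (v 3) (v 3) * M (v 1) (v 1) - M (v 1) (v 3) * M (v 1) (v 3) = h\<^sup>2 * sg 3 * sg 1 \<and>
     M (v 1) (v 1) * M (v 2) (v 2) - M (v 1) (v 2) * M (v 1) (v 2) = h\<^sup>2 * sg 1 * sg 2 \<and>
     M (v 1) (v 3) * M (v 2) (v 3) = M (v 1) (v 2) * M (v 3) (v 3) \<and>
     M (v 1) (v 2) * M (v 2) (v 3) = M (v 1) (v 3) * M (v 2) (v 2) \<and>
     M (v 1) (v 2) * M (v 1) (v 3) = M (v 2) (v 3) * M (v 1) (v 1)"
proof -
  have sym: "g (L (v 2)) (v 1) = g (L (v 1)) (v 2)" "g (L (v 3)) (v 2) = g (L (v 2)) (v 3)"
    "g (L (v 3)) (v 1) = g (L (v 1)) (v 3)"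
    using assms(1) by (simp_all add: unimodular_iff)
  then have M_sym: "M (v 2) (v 1) = M (v 1) (v 2)" "M (v 3) (v 2) = M (v 2) (v 3)" "M (v 3) (v 1) = M (v 1) (v 3)"
    by (simp_all add: M_def)
  note T = T_frame[OF sym, of 1, simplified] T_frame[OF sym, of 2, simplified] T_frame[OF sym, of 3, simplified]
  have T': "T s (v i) (v 2) (v 1) = - T s (v i) (v 1) (v 2)" "T s (v i) (v 3) (v 2) = - T s (v i) (v 2) (v 3)"
    "T s (v i) (v 1) (v 3) = - T s (v i) (v 3) (v 1)" for s i
    by (rule T_swap)+
  note expand = ricci_def sum_1_3 T T' T_diag M_sym h_def[symmetric]
  have ricci:
    "ricci 1 (v 1) (v 1) = (M (v 2) (v 2) * M (v 3) (v 3) - M (v 2) (v 3) * M (v 2) (v 3) - h\<^sup>2 * sg 2 * sg 3) / 2"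
    "ricci 1 (v 2) (v 2) = (M (v 3) (v 3) * M (v 1) (v 1) - M (v 1) (v 3) * M (v 1) (v 3) - h\<^sup>2 * sg 3 * sg 1) / 2"
    "ricci 1 (v 3) (v 3) = (M (v 1) (v 1) * M (v 2) (v 2) - M (v 1) (v 2) * M (v 1) (v 2) - h\<^sup>2 * sg 1 * sg 2) / 2"
    "ricci 1 (v 1) (v 2) = sg 1 * sg 2 * (M (v 1) (v 3) * M (v 2) (v 3) - M (v 1) (v 2) * M (v 3) (v 3)) / 2"
    "ricci 1 (v 2) (v 1) = sg 1 * sg 2 * (M (v 1) (v 3) * M (v 2) (v 3) - M (v 1) (v 2) * M (v 3) (v 3)) / 2"
    "ricci 1 (v 1) (v 3) = sg 1 * sg 3 * (M (v 1) (v 2) * M (v 2) (v 3) - M (v 1) (v 3) * M (v 2) (v 2)) / 2"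
    "ricci 1 (v 3) (v 1) = sg 1 * sg 3 * (M (v 1) (v 2) * M (v 2) (v 3) - M (v 1) (v 3) * M (v 2) (v 2)) / 2"
    "ricci 1 (v 2) (v 3) = sg 2 * sg 3 * (M (v 1) (v 2) * M (v 1) (v 3) - M (v 2) (v 3) * M (v 1) (v 1)) / 2"
    "ricci 1 (v 3) (v 2) = sg 2 * sg 3 * (M (v 1) (v 2) * M (v 1) (v 3) - M (v 2) (v 3) * M (v 1) (v 1)) / 2"
    by (simp_all add: expand power2_eq_square field_simps)
  have "sg 1 \<noteq> 0" "sg 2 \<noteq> 0" "sg 3 \<noteq> 0"
    using sg_sq by force+
  moreover have "(\<forall>u a. ricci 1 u a = 0) \<longleftrightarrow> (\<forall>i\<in>{1..3}. \<forall>j\<in>{1..3}. ricci 1 (v i) (v j) = 0)"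
    using bilinear_zero_iff[OF ricci_bilinear spanning] by simp
  ultimately show ?thesis
    unfolding gen_einstein_iff ball_1_3 ricci by auto
qed

end

section \<open>Existence of orthonormal frames for an indefinite metric\<close>

lemma orthogonal_independent:
  fixes g :: "'a::euclidean_space \<Rightarrow> 'a \<Rightarrow> real"
  assumes g: "bilinear g" and fin: "finite B" and nonnull: "\<And>b. b \<in> B \<Longrightarrow> g b b \<noteq> 0"
    and orth: "\<And>b c. b \<in> B \<Longrightarrow> c \<in> B \<Longrightarrow> b \<noteq> c \<Longrightarrow> g b c = 0"
  shows "independent B"
proof (rule independent_if_scalars_zero[OF fin])
  fix f x assume s: "(\<Sum>y\<in>B. f y *\<^sub>R y) = 0" and x: "x \<in> B"
  have "0 = g (\<Sum>y\<in>B. f y *\<^sub>R y) x" by (simp add: s bilin_simps[OF g])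
  also have "\<dots> = (\<Sum>y\<in>B. if y = x then f x * g x x else 0)"
    using orth x by (auto simp: bilin_simps[OF g] intro!: sum.cong)
  also have "\<dots> = f x * g x x" using fin x by simp
  finally show "f x = 0" using nonnull[OF x] by simp
qed

text \<open>Gram-Schmidt with one obstacle: the projection \<open>p y\<close> of a vector outside
  the span is nonzero, yet it may be null and cannot then be normalised.\<close>

lemma orthonormal_extend:
  fixes g :: "'a::euclidean_space \<Rightarrow> 'a \<Rightarrow> real"
  assumes metric: "pseudo_metric g" and fin: "finite B" and unit: "\<And>b. b \<in> B \<Longrightarrow> g b b * g b b = 1"
    and orth: "\<And>b c. b \<in> B \<Longrightarrow> c \<in> B \<Longrightarrow> b \<noteq> c \<Longrightarrow> g b c = 0" and card: "card B < DIM('a)"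
  obtains x where "g x x * g x x = 1" "\<And>b. b \<in> B \<Longrightarrow> g x b = 0"
proof -
  have g: "bilinear g" and sym: "\<And>x y. g x y = g y x" and nondeg: "\<And>x. (\<And>y. g x y = 0) \<Longrightarrow> x = 0"
    using metric by (auto simp: pseudo_metric_def)
  define p where "p x = x - (\<Sum>b\<in>B. (g b b * g x b) *\<^sub>R b)" for x
  have p: "g (p x) c = 0" if c: "c \<in> B" for x c
  proof -
    have "g (\<Sum>b\<in>B. (g b b * g x b) *\<^sub>R b) c = (\<Sum>b\<in>B. if b = c then g c c * g x c * g c c else 0)"
      using orth c by (auto simp: bilin_simps[OF g] intro!: sum.cong)
    also have "\<dots> = g x c" using fin c unit[OF c] by simp
    finally show ?thesis by (simp add: p_def bilin_simps[OF g])
  qed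
  have "span B \<noteq> UNIV"
    using card dim_le_card'[OF fin] by (metis dim_UNIV dim_span leD)
  then obtain y where y: "y \<notin> span B" by blast
  have "p y \<noteq> 0"
  proof
    assume "p y = 0"
    then have "y = (\<Sum>b\<in>B. (g b b * g y b) *\<^sub>R b)" by (simp add: p_def)
    then show False using y by (metis (no_types, lifting) span_base span_scale span_sum)
  qed
  then obtain z where z: "g (p y) z \<noteq> 0" using nondeg by blast
  have "g (p y) (p z) = g (p y) z"
    using p[of _ y] by (simp add: p_def[of z] bilin_simps[OF g])
  \<comment> \<open>Polarisation: as \<open>g (p y) (p z)\<close> is nonzero, the quadratic form
    cannot vanish on \<open>p y\<close>, \<open>p z\<close> and their sum at once.\<close>
  then have "g (p y + p z) (p y + p z) \<noteq> 0 \<or> g (p y) (p y) \<noteq> 0 \<or> g (p z) (p z) \<noteq> 0"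
    using z sym[of "p z" "p y"] by (auto simp: bilin_simps[OF g])
  moreover have "g (p y + p z) b = 0" if "b \<in> B" for b
    using p that by (simp add: bilin_simps[OF g])
  ultimately obtain x where x: "g x x \<noteq> 0" "\<And>b. b \<in> B \<Longrightarrow> g x b = 0"
    using p by metis
  show thesis
  proof (rule that)
    let ?c = "1 / sqrt \<bar>g x x\<bar>"
    have "?c * ?c = 1 / \<bar>g x x\<bar>" by simp
    then show "g (?c *\<^sub>R x) (?c *\<^sub>R x) * g (?c *\<^sub>R x) (?c *\<^sub>R x) = 1"
      using x(1) by (simp add: bilin_simps[OF g] abs_if split: if_splits)
    show "g (?c *\<^sub>R x) b = 0" if "b \<in> B" for b
      using x(2) that by (simp add: bilin_simps[OF g])
  qed
qed

lemma frame3I: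
  fixes g :: "'a::euclidean_space \<Rightarrow> 'a \<Rightarrow> real"
  assumes dim: "DIM('a) = 3" and metric: "pseudo_metric g" and unit: "\<And>i. i \<in> {1..3} \<Longrightarrow> g (v i) (v i) * g (v i) (v i) = 1"
    and orth: "g (v 1) (v 2) = 0" "g (v 1) (v 3) = 0" "g (v 2) (v 3) = 0"
  shows "frame3 g v"
proof -
  have g: "bilinear g" and sym: "\<And>x y. g x y = g y x"
    using metric by (auto simp: pseudo_metric_def)
  have three: "i = 1 \<or> i = 2 \<or> i = 3" if "i \<in> {1..3}" for i :: nat
    using that by auto
  have orth': "g (v i) (v j) = 0" if "i \<in> {1..3}" "j \<in> {1..3}" "i \<noteq> j" for i j
    using three[OF that(1)] three[OF that(2)] that(3) orth sym[of "v 2" "v 1"] sym[of "v 3" "v 1"] sym[of "v 3" "v 2"]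
    by auto
  have inj: "inj_on v {1..3}"
    using orth' unit by (intro inj_onI) (metis mult_zero_left zero_neq_one)
  have "independent (v ` {1..3})"
    by (rule orthogonal_independent[OF g]) (use orth' unit in \<open>force+\<close>)
  moreover have "card (v ` {1..3}) = DIM('a)"
    using card_image[OF inj] dim by simp
  ultimately have "span (v ` {1..3}) = UNIV"
    using card_ge_dim_independent[of "v ` {1..3}" UNIV] by auto
  then show ?thesis
    by unfold_locales (use metric unit orth' in auto)
qed

lemma alternating3_nonzero_frame:
  assumes "frame3 g v" "alternating3 \<omega>" "\<omega> \<noteq> (\<lambda>x y z. 0)"
  shows "\<omega> (v 1) (v 2) (v 3) \<noteq> 0"
proof
  interpret frame3 g v by fact
  assume "\<omega> (v 1) (v 2) (v 3) = 0"
  then have "\<omega> x y z = 0" for x y z using alternating3_coord[OF assms(2), of x y z] by simp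
  then show False using assms(3) by blast
qed

text \<open>The prescribed direction becomes the first frame vector; a wrong orientation is repaired
  by negating the third one, which is what the sign argument of the local \<open>v\<close>
  does.\<close>

lemma oriented_frame3_extend:
  fixes g :: "'a::euclidean_space \<Rightarrow> 'a \<Rightarrow> real"
  assumes dim: "DIM('a) = 3" and metric: "pseudo_metric g" and \<omega>: "alternating3 \<omega>" "\<omega> \<noteq> (\<lambda>x y z. 0)"
    and w: "g w w \<noteq> 0"
  obtains v c where "oriented_frame3 g v \<omega>" "w = c *\<^sub>R v 1"
proof -
  have g: "bilinear g" and sym: "\<And>x y. g x y = g y x"
    using metric by (auto simp: pseudo_metric_def)
  define x where "x = (1 / sqrt \<bar>g w w\<bar>) *\<^sub>R w"
  have "1 / sqrt \<bar>g w w\<bar> * (1 / sqrt \<bar>g w w\<bar>) = 1 / \<bar>g w w\<bar>" by simp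
  then have x: "g x x * g x x = 1"
    using w by (simp add: x_def bilin_simps[OF g] abs_if split: if_splits)
  have wx: "w = sqrt \<bar>g w w\<bar> *\<^sub>R x" using w by (simp add: x_def)
  obtain y where y: "g y y * g y y = 1" "g y x = 0"
    by (rule orthonormal_extend[OF metric, of "{x}"]) (use x dim in auto)
  obtain z where z: "g z z * g z z = 1" "g z x = 0" "g z y = 0"
    by (rule orthonormal_extend[OF metric, of "{x, y}"]) (use x y dim sym[of x y] in \<open>auto simp: card_insert_if\<close>)
  define v where "v s i = (if i = 1 then x else if i = 2 then y else s *\<^sub>R z)" for s :: real and i :: nat
  have frame: "frame3 g (v s)" if "s * s = 1" for s
  proof (rule frame3I[OF dim metric])
    have "s * s * g z z * (s * s * g z z) = 1" unfolding that using z by simp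
    then show "g (v s i) (v s i) * g (v s i) (v s i) = 1" if "i \<in> {1..3}" for i
      using x y by (auto simp: v_def bilin_simps[OF g] mult_ac)
  qed (use y z sym[of x y] sym[of x z] sym[of y z] in \<open>auto simp: v_def bilin_simps[OF g]\<close>)
  have flip: "\<omega> (v (-1) 1) (v (-1) 2) (v (-1) 3) = - \<omega> (v 1 1) (v 1 2) (v 1 3)"
    using linear_neg[OF alternating3_linear(3)[OF \<omega>(1)]] by (simp add: v_def)
  have nz: "\<omega> (v 1 1) (v 1 2) (v 1 3) \<noteq> 0"
    by (rule alternating3_nonzero_frame[OF frame \<omega>]) simp
  then have "\<omega> (v 1 1) (v 1 2) (v 1 3) > 0 \<or> \<omega> (v (-1) 1) (v (-1) 2) (v (-1) 3) > 0"
    unfolding flip by linarith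
  then obtain s where s: "s = 1 \<or> s = -1" "\<omega> (v s 1) (v s 2) (v s 3) > 0" by blast
  then have "oriented_frame3 g (v s) \<omega>"
    using frame[of s] \<omega>(1) by (auto simp: oriented_frame3_def oriented_frame3_axioms_def)
  then show thesis
    by (rule that[of _ "sqrt \<bar>g w w\<bar>"]) (use wx in \<open>simp add: v_def\<close>)
qed

lemma oriented_frame3_exists:
  fixes g :: "'a::euclidean_space \<Rightarrow> 'a \<Rightarrow> real"
  assumes dim: "DIM('a) = 3" and metric: "pseudo_metric g" and \<omega>: "alternating3 \<omega>" "\<omega> \<noteq> (\<lambda>x y z. 0)"
  obtains v where "oriented_frame3 g v \<omega>"
proof -
  obtain w where "g w w * g w w = 1"
    by (rule orthonormal_extend[OF metric, of "{}"]) (use dim in auto)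
  then have "g w w \<noteq> 0" by auto
  then show thesis using oriented_frame3_extend[OF assms] that by metis
qed

lemma oriented_orthonormalD:
  fixes g :: "'a::euclidean_space \<Rightarrow> 'a \<Rightarrow> real"
  assumes dim: "DIM('a) = 3" and metric: "pseudo_metric g" and \<omega>: "alternating3 \<omega>"
    and v: "oriented_orthonormal g \<omega> v"
  shows "oriented_frame3 g v \<omega>"
proof -
  have "g (v i) (v i) * g (v i) (v i) = 1" if "i \<in> {1..3}" for i
  proof -
    have "\<bar>g (v i) (v i)\<bar> = 1" using v that unfolding oriented_orthonormal_def by blast
    then show ?thesis by (metis abs_mult_self_eq mult_1)
  qed
  moreover have "g (v 1) (v 2) = 0" "g (v 1) (v 3) = 0" "g (v 2) (v 3) = 0" "\<omega> (v 1) (v 2) (v 3) > 0"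
    using v unfolding oriented_orthonormal_def by auto
  ultimately show ?thesis
    using frame3I[OF dim metric] \<omega> by (auto simp: oriented_frame3_def oriented_frame3_axioms_def)
qed

section \<open>Solving the cofactor equations\<close>

text \<open>An off-diagonal entry times a suitable diagonal cofactor vanishes by two of the
  off-diagonal equations, and that cofactor is a nonzero multiple of \<open>k\<close>. Afterwards
  the pairwise products of the three signed diagonal entries all equal \<open>k\<close>, so these
  entries agree.\<close>

lemma scalar_cofactors:
  fixes a11 a12 a13 a22 a23 a33 :: real
  assumes sq: "e1 * e1 = 1" "e2 * e2 = 1" "e3 * e3 = 1" and k: "k \<noteq> 0"
    and d1: "a22 * a33 - a23 * a23 = k * e2 * e3" and d2: "a33 * a11 - a13 * a13 = k * e3 * e1"
    and d3: "a11 * a22 - a12 * a12 = k * e1 * e2"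
    and o1: "a13 * a23 = a12 * a33" and o2: "a12 * a23 = a13 * a22" and o3: "a12 * a13 = a23 * a11"
  shows "a12 = 0 \<and> a13 = 0 \<and> a23 = 0 \<and> e1 * a11 = e3 * a33 \<and> e2 * a22 = e3 * a33"
proof -
  have nz: "e1 \<noteq> 0" "e2 \<noteq> 0" "e3 \<noteq> 0" using sq by auto
  have "a12 * (k * e3 * e1) = 0" using o1 o3 unfolding d2[symmetric] by algebra
  then have a12: "a12 = 0" using k nz by simp
  have "a13 * (k * e1 * e2) = 0" using o2 o3 unfolding d3[symmetric] by algebra
  then have a13: "a13 = 0" using k nz by simp
  have "a23 * (k * e1 * e2) = 0" using o2 o3 unfolding d3[symmetric] by algebra
  then have a23: "a23 = 0" using k nz by simp
  have b: "(e2 * a22) * (e3 * a33) = k" "(e3 * a33) * (e1 * a11) = k"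
    using d1 d2 sq unfolding a13 a23 by algebra+
  have c: "(e1 * a11) * (e2 * a22) = k"
    using d3 sq unfolding a12 by algebra
  have "e1 * a11 = e3 * a33" "e2 * a22 = e3 * a33"
    using b c k by (metis mult.commute mult_cancel_left mult_zero_left)+
  then show ?thesis using a12 a13 a23 by simp
qed

text \<open>The vector is the row through a nonzero diagonal entry, and \<open>\<kappa>\<close> is
  the inverse of that entry. If the diagonal is zero, so are the squares of the other
  entries.\<close>

lemma rank_one_cofactors:
  fixes a11 a12 a13 a22 a23 a33 :: real
  assumes "a22 * a33 = a23 * a23" "a33 * a11 = a13 * a13" "a11 * a22 = a12 * a12"
    "a13 * a23 = a12 * a33" "a12 * a23 = a13 * a22" "a12 * a13 = a23 * a11"
  obtains \<kappa> w1 w2 w3 where "a11 = \<kappa> * w1 * w1" "a12 = \<kappa> * w1 * w2" "a13 = \<kappa> * w1 * w3"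
    "a22 = \<kappa> * w2 * w2" "a23 = \<kappa> * w2 * w3" "a33 = \<kappa> * w3 * w3"
proof -
  consider "a11 \<noteq> 0" | "a22 \<noteq> 0" | "a33 \<noteq> 0" | "a11 = 0" "a22 = 0" "a33 = 0" by blast
  then show thesis
  proof cases
    case 1 then show thesis using that[of "1 / a11" a11 a12 a13] assms by (simp add: field_simps)
  next
    case 2 then show thesis using that[of "1 / a22" a12 a22 a23] assms by (simp add: field_simps)
  next
    case 3 then show thesis using that[of "1 / a33" a13 a23 a33] assms by (simp add: field_simps)
  next
    case 4 then show thesis using that[of 0 0 0 0] assms by simp
  qed
qed

context bracket_frame3
begin

lemma M_sym: "unimodular br \<Longrightarrow> M (v 2) (v 1) = M (v 1) (v 2) \<and> M (v 3) (v 2) = M (v 2) (v 3) \<and> M (v 3) (v 1) = M (v 1) (v 3)"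
  by (auto simp: unimodular_iff M_def)

lemma eq_on_frame:
  fixes b c :: "'a \<Rightarrow> 'a \<Rightarrow> real"
  assumes b: "bilinear b" and c: "bilinear c" and eq: "\<And>i j. i \<in> {1..3} \<Longrightarrow> j \<in> {1..3} \<Longrightarrow> b (v i) (v j) = c (v i) (v j)"
  shows "b x y = c x y"
proof -
  have "bilinear (\<lambda>x y. b x y - c x y)"
    unfolding bilinear_def
    by (auto intro!: linearI simp: bilin_simps[OF b] bilin_simps[OF c] algebra_simps)
  then have "\<forall>x y. b x y - c x y = 0"
    by (subst bilinear_zero_iff[OF _ spanning]) (use eq in auto)
  then show ?thesis by simp
qed

text \<open>In dimension three \<open>tr M = 3 tr L - 2 tr L = tr L\<close>, so \<open>M\<close>
  determines \<open>L\<close>.\<close>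

lemma L_from_M:
  assumes "\<And>x y. M x y = g (m x) y"
  defines "t \<equiv> sg 1 * g (L (v 1)) (v 1) + sg 2 * g (L (v 2)) (v 2) + sg 3 * g (L (v 3)) (v 3)"
  shows "L x = (1 / 2) *\<^sub>R (t *\<^sub>R x - m x)"
    and "t = sg 1 * M (v 1) (v 1) + sg 2 * M (v 2) (v 2) + sg 3 * M (v 3) (v 3)"
proof -
  show "L x = (1 / 2) *\<^sub>R (t *\<^sub>R x - m x)"
    by (rule g_nondeg) (simp add: g_simps assms(1)[symmetric] M_def t_def field_simps)
  show "t = sg 1 * M (v 1) (v 1) + sg 2 * M (v 2) (v 2) + sg 3 * M (v 3) (v 3)"
    by (simp add: M_def t_def right_diff_distrib mult.commute[of _ "sg _"])
qed

lemma einstein_L: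
  assumes uni: "unimodular br" and ein: "gen_einstein br H g"
  shows "(\<exists>c. \<forall>x. L x = c *\<^sub>R x) \<or>
    H (v 1) (v 2) (v 3) = 0 \<and> (\<exists>\<kappa> w. \<forall>x. L x = \<kappa> *\<^sub>R (g w w *\<^sub>R x - g w x *\<^sub>R w))"
proof (cases "H (v 1) (v 2) (v 3) = 0")
  case False
  note minors = gen_einstein_iff_minors[OF uni, THEN iffD1, OF ein]
  have k: "(H (v 1) (v 2) (v 3))\<^sup>2 \<noteq> 0" using False by simp
  have off: "M (v 1) (v 2) = 0" "M (v 1) (v 3) = 0" "M (v 2) (v 3) = 0"
    and diag: "sg 1 * M (v 1) (v 1) = sg 3 * M (v 3) (v 3)" "sg 2 * M (v 2) (v 2) = sg 3 * M (v 3) (v 3)"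
    using scalar_cofactors[OF sg_sq k] minors by blast+
  define c where "c = sg 3 * M (v 3) (v 3)"
  have diag': "M (v 1) (v 1) = c * sg 1" "M (v 2) (v 2) = c * sg 2" "M (v 3) (v 3) = c * sg 3"
    unfolding c_def using diag sg_sq by algebra+
  have "M x y = c * g x y" for x y
  proof (rule eq_on_frame[OF M_bilinear])
    show "bilinear (\<lambda>x y. c * g x y)"
      unfolding bilinear_def by (auto intro!: linearI simp: g_simps algebra_simps)
    fix i j :: nat assume "i \<in> {1..3}" "j \<in> {1..3}"
    then have "i = 1 \<or> i = 2 \<or> i = 3" "j = 1 \<or> j = 2 \<or> j = 3" by auto
    then show "M (v i) (v j) = c * g (v i) (v j)"
      using off diag' M_sym[OF uni] by (elim disjE) simp_all
  qed
  then have "M x y = g (c *\<^sub>R x) y" for x y by (simp add: g_simps)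
  note L = L_from_M(1)[OF this]
  show ?thesis
    by (rule disjI1, rule exI, rule allI, subst L, simp only: scaleR_left_diff_distrib[symmetric] scaleR_scaleR)
next
  case True
  note minors = gen_einstein_iff_minors[OF uni, THEN iffD1, OF ein, unfolded True, simplified]
  obtain \<kappa> w1 w2 w3 where *: "M (v 1) (v 1) = \<kappa> * w1 * w1" "M (v 1) (v 2) = \<kappa> * w1 * w2" "M (v 1) (v 3) = \<kappa> * w1 * w3"
    "M (v 2) (v 2) = \<kappa> * w2 * w2" "M (v 2) (v 3) = \<kappa> * w2 * w3" "M (v 3) (v 3) = \<kappa> * w3 * w3"
    by (rule rank_one_cofactors[of "M (v 2) (v 2)" "M (v 3) (v 3)" "M (v 2) (v 3)" "M (v 1) (v 1)" "M (v 1) (v 3)" "M (v 1) (v 2)"])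
      (use minors in auto)
  \<comment> \<open>The signs compensate those of \<open>g\<close>, so that \<open>w1\<close>,
    \<open>w2\<close>, \<open>w3\<close> are the products of \<open>w\<close> with the
    frame.\<close>
  define w where "w = (sg 1 * w1) *\<^sub>R v 1 + (sg 2 * w2) *\<^sub>R v 2 + (sg 3 * w3) *\<^sub>R v 3"
  have w: "g w (v 1) = w1" "g w (v 2) = w2" "g w (v 3) = w3"
    by (simp_all add: w_def g_simps)
  have M: "M x y = \<kappa> * g w x * g w y" for x y
  proof (rule eq_on_frame[OF M_bilinear])
    show "bilinear (\<lambda>x y. \<kappa> * g w x * g w y)"
      unfolding bilinear_def by (auto intro!: linearI simp: g_simps algebra_simps)
    fix i j :: nat assume "i \<in> {1..3}" "j \<in> {1..3}"
    then have "i = 1 \<or> i = 2 \<or> i = 3" "j = 1 \<or> j = 2 \<or> j = 3" by auto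
    then show "M (v i) (v j) = \<kappa> * g w (v i) * g w (v j)"
      using * w M_sym[OF uni] by (elim disjE) simp_all
  qed
  then have m: "M x y = g ((\<kappa> * g w x) *\<^sub>R w) y" for x y by (simp add: g_simps)
  have "g w w = sg 1 * w1 * w1 + sg 2 * w2 * w2 + sg 3 * w3 * w3"
    by (subst g_frame) (simp add: sum_1_3 w)
  then have "sg 1 * M (v 1) (v 1) + sg 2 * M (v 2) (v 2) + sg 3 * M (v 3) (v 3) = \<kappa> * g w w"
    by (simp add: * algebra_simps)
  then have "L x = (1 / 2) *\<^sub>R ((\<kappa> * g w w) *\<^sub>R x - (\<kappa> * g w x) *\<^sub>R w)" for x
    using L_from_M(1)[OF m, of x] L_from_M(2)[OF m] by simp
  then have "L x = (\<kappa> / 2) *\<^sub>R (g w w *\<^sub>R x - g w x *\<^sub>R w)" for x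
    by (simp add: scaleR_right_diff_distrib)
  then show ?thesis using True by blast
qed

end

subsection \<open>Model Lie algebras\<close>

lemma alternating_bilinear_expand:
  assumes b: "bilinear b" and alt: "\<And>x. b x x = 0"
  shows "b (x1 *\<^sub>R u1 + x2 *\<^sub>R u2 + x3 *\<^sub>R u3) (y1 *\<^sub>R u1 + y2 *\<^sub>R u2 + y3 *\<^sub>R u3)
    = (x1 * y2 - x2 * y1) *\<^sub>R b u1 u2 + (x2 * y3 - x3 * y2) *\<^sub>R b u2 u3 + (x3 * y1 - x1 * y3) *\<^sub>R b u3 u1"
proof -
  have "b u2 u1 = - b u1 u2" "b u3 u2 = - b u2 u3" "b u1 u3 = - b u3 u1"
    by (rule skew_bilinear[OF b alt])+
  then show ?thesis
    by (simp add: bilin_simps[OF b] alt algebra_simps)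
qed

lemma so_alg_iff: "A \<in> so_alg s \<longleftrightarrow> (\<forall>i j. s $ i * A $ i $ j + s $ j * A $ j $ i = 0)"
proof
  have form: "pe_form s x (axis i 1) = s $ i * x $ i" "pe_form s (axis i 1) x = s $ i * x $ i" for x and i :: 'a
    by (simp_all add: pe_form_def axis_def if_distrib[of "\<lambda>c. _ * c"] if_distrib[of "\<lambda>c. c * _"] cong: if_cong)
  assume A: "A \<in> so_alg s"
  show "\<forall>i j. s $ i * A $ i $ j + s $ j * A $ j $ i = 0"
  proof (intro allI)
    fix i j
    have "pe_form s (A *v axis j 1) (axis i 1) + pe_form s (axis j 1) (A *v axis i 1) = 0"
      using A unfolding so_alg_def by blast
    then show "s $ i * A $ i $ j + s $ j * A $ j $ i = 0"
      by (simp add: form matrix_vector_mult_basis column_def)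
  qed
next
  assume A: "\<forall>i j. s $ i * A $ i $ j + s $ j * A $ j $ i = 0"
  have "pe_form s (A *v x) y + pe_form s x (A *v y) = 0" for x y
  proof -
    have "pe_form s x (A *v y) = (\<Sum>j\<in>UNIV. \<Sum>i\<in>UNIV. s $ j * x $ j * (A $ j $ i * y $ i))"
      by (simp add: pe_form_def matrix_vector_mult_def sum_distrib_left)
    also have "\<dots> = (\<Sum>i\<in>UNIV. \<Sum>j\<in>UNIV. s $ j * x $ j * (A $ j $ i * y $ i))"
      by (rule sum.swap)
    finally have "pe_form s (A *v x) y + pe_form s x (A *v y)
        = (\<Sum>i\<in>UNIV. \<Sum>j\<in>UNIV. (s $ i * A $ i $ j + s $ j * A $ j $ i) * x $ j * y $ i)"
      by (simp add: pe_form_def matrix_vector_mult_def sum_distrib_left sum_distrib_right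
          sum.distrib[symmetric] algebra_simps)
    then show ?thesis using A by simp
  qed
  then show "A \<in> so_alg s" by (simp add: so_alg_def)
qed

lemma commutator_bilinear: "bilinear commutator" and commutator_self: "commutator A A = 0"
  unfolding bilinear_def
  by (auto intro!: linearI simp: commutator_def matrix_matrix_mult_def vec_eq_iff sum.distrib
      sum_distrib_left algebra_simps)

lemma e_bracket_bilinear: "bilinear e_bracket" and e_bracket_self: "e_bracket u u = 0"
proof -
  show "bilinear e_bracket"
    unfolding bilinear_def e_bracket_def
    by (auto intro!: linearI simp: bilin_simps[OF commutator_bilinear] matrix_vector_mult_def vec_eq_iff
        sum.distrib sum_distrib_left algebra_simps)
qed (simp add: e_bracket_def commutator_self zero_prod_def)

lemma mem_span_pair: "x \<in> span {a, b} \<longleftrightarrow> (\<exists>c d. x = c *\<^sub>R a + d *\<^sub>R b)"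
  by (simp add: span_insert[of a "{b}"] span_singleton image_iff diff_eq_eq add.commute)

context frame3
begin

text \<open>In dimension three an alternating bracket is fixed by its three cyclic values on a
  basis, so equal structure constants suffice.\<close>

lemma lie_isomorphic_frame:
  fixes br' :: "'b::real_vector \<Rightarrow> 'b \<Rightarrow> 'b"
  assumes br: "bilinear br" "\<And>x. br x x = 0" and br': "bilinear br'" "\<And>x. br' x x = 0"
    and T: "\<And>A. A \<in> T \<longleftrightarrow> (\<exists>a b c. A = a *\<^sub>R F1 + b *\<^sub>R F2 + c *\<^sub>R F3)"
    and indep: "\<And>a b c. a *\<^sub>R F1 + b *\<^sub>R F2 + c *\<^sub>R F3 = 0 \<Longrightarrow> a = 0 \<and> b = 0 \<and> c = 0"
    and frame: "br (v 1) (v 2) = c3 *\<^sub>R v 3" "br (v 2) (v 3) = c1 *\<^sub>R v 1" "br (v 3) (v 1) = c2 *\<^sub>R v 2"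
    and frame': "br' F1 F2 = c3 *\<^sub>R F3" "br' F2 F3 = c1 *\<^sub>R F1" "br' F3 F1 = c2 *\<^sub>R F2"
  shows "lie_isomorphic br T br'"
proof -
  define f where "f x = coord 1 x *\<^sub>R F1 + coord 2 x *\<^sub>R F2 + coord 3 x *\<^sub>R F3" for x
  note coord_simps = linear_add[OF coord_linear] linear_scale[OF coord_linear]
  have coord_frame: "coord 1 (v 1) = 1" "coord 1 (v 2) = 0" "coord 1 (v 3) = 0" "coord 2 (v 1) = 0"
    "coord 2 (v 2) = 1" "coord 2 (v 3) = 0" "coord 3 (v 1) = 0" "coord 3 (v 2) = 0" "coord 3 (v 3) = 1"
    by (simp_all add: coord_def)
  have lin: "linear f"
    by (rule linearI) (simp_all add: f_def coord_simps algebra_simps)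
  have f_v: "f (a *\<^sub>R v 1 + b *\<^sub>R v 2 + c *\<^sub>R v 3) = a *\<^sub>R F1 + b *\<^sub>R F2 + c *\<^sub>R F3" for a b c
    by (simp add: f_def coord_simps coord_frame)
  have "inj f"
  proof (rule linear_injective_0[OF lin, THEN iffD2], intro allI impI)
    fix x assume "f x = 0"
    then have "coord 1 x = 0 \<and> coord 2 x = 0 \<and> coord 3 x = 0"
      unfolding f_def by (rule indep)
    then show "x = 0" using coord_expand[of x] by simp
  qed
  moreover have "range f = T"
  proof (intro set_eqI iffI)
    fix A assume "A \<in> range f"
    then show "A \<in> T" unfolding T f_def by blast
  next
    fix A assume "A \<in> T"
    then show "A \<in> range f" unfolding T f_v[symmetric] by blast
  qed
  moreover have "f (br x y) = br' (f x) (f y)" for x y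
  proof -
    have "br x y = br (coord 1 x *\<^sub>R v 1 + coord 2 x *\<^sub>R v 2 + coord 3 x *\<^sub>R v 3)
        (coord 1 y *\<^sub>R v 1 + coord 2 y *\<^sub>R v 2 + coord 3 y *\<^sub>R v 3)"
      by (simp only: coord_expand[symmetric])
    also have "f \<dots> = br' (f x) (f y)"
      unfolding alternating_bilinear_expand[OF br] f_def[of x] f_def[of y] alternating_bilinear_expand[OF br']
        frame frame'
      by (simp add: linear_add[OF lin] linear_scale[OF lin]) (simp add: f_def coord_frame)
    finally show ?thesis .
  qed
  ultimately show ?thesis
    unfolding lie_isomorphic_def bij_betw_def using lin by blast
qed

lemma lie_isomorphic_so_alg:
  assumes br: "bilinear br" "\<And>x. br x x = 0" and nz: "\<beta> \<noteq> 0" "s \<noteq> 0"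
    and frame: "br (v 1) (v 2) = (\<beta> * s) *\<^sub>R v 3" "br (v 2) (v 3) = \<beta> *\<^sub>R v 1" "br (v 3) (v 1) = \<beta> *\<^sub>R v 2"
  shows "lie_isomorphic br (so_alg (vector [1, 1, s] :: real^3)) commutator"
proof -
  \<comment> \<open>The infinitesimal rotations about the three axes for the form with diagonal 1,
    1, \<open>s\<close>, scaled by \<open>\<beta>\<close> to match the structure constants.\<close>
  let ?F1 = "vector [vector [0, 0, 0], vector [0, 0, - \<beta> * s], vector [0, \<beta>, 0]] :: real^3^3"
  let ?F2 = "vector [vector [0, 0, \<beta> * s], vector [0, 0, 0], vector [- \<beta>, 0, 0]] :: real^3^3"
  let ?F3 = "vector [vector [0, - \<beta>, 0], vector [\<beta>, 0, 0], vector [0, 0, 0]] :: real^3^3"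
  show ?thesis
  proof (rule lie_isomorphic_frame[OF br commutator_bilinear commutator_self _ _ frame])
    fix A :: "real^3^3"
    show "A \<in> so_alg (vector [1, 1, s]) \<longleftrightarrow> (\<exists>a b c. A = a *\<^sub>R ?F1 + b *\<^sub>R ?F2 + c *\<^sub>R ?F3)"
    proof
      assume "A \<in> so_alg (vector [1, 1, s])"
      then have "A $ 1 $ 1 = 0" "A $ 2 $ 2 = 0" "A $ 3 $ 3 = 0" "A $ 1 $ 2 = - A $ 2 $ 1"
        "A $ 1 $ 3 = - (s * A $ 3 $ 1)" "A $ 2 $ 3 = - (s * A $ 3 $ 2)"
        using nz unfolding so_alg_iff forall_3 vector_3 by (simp_all add: eq_neg_iff_add_eq_0)
      then have "A = (A $ 3 $ 2 / \<beta>) *\<^sub>R ?F1 + (- A $ 3 $ 1 / \<beta>) *\<^sub>R ?F2 + (A $ 2 $ 1 / \<beta>) *\<^sub>R ?F3"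
        using nz by (simp add: vec_eq_iff forall_3)
      then show "\<exists>a b c. A = a *\<^sub>R ?F1 + b *\<^sub>R ?F2 + c *\<^sub>R ?F3" by blast
    qed (auto simp: so_alg_iff forall_3)
  qed (use nz in \<open>auto simp: vec_eq_iff forall_3 commutator_def matrix_matrix_mult_def sum_3\<close>)
qed

lemma lie_isomorphic_e_alg:
  assumes br: "bilinear br" "\<And>x. br x x = 0" and nz: "q \<noteq> 0" "s \<noteq> 0"
    and frame: "br (v 1) (v 2) = 0" "br (v 2) (v 3) = (s * q) *\<^sub>R v 1" "br (v 3) (v 1) = q *\<^sub>R v 2"
  shows "lie_isomorphic br (e_alg (vector [1, s] :: real^2)) e_bracket"
proof -
  \<comment> \<open>Two translations, and a rotation or boost \<open>?J\<close> scaled by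
    \<open>q\<close>: it sends the first unit vector to \<open>q\<close> times the second, and the
    second to \<open>- s * q\<close> times the first.\<close>
  let ?F1 = "(0, vector [1, 0]) :: (real^2^2) \<times> (real^2)"
  let ?F2 = "(0, vector [0, 1]) :: (real^2^2) \<times> (real^2)"
  let ?J = "vector [vector [0, - s * q], vector [q, 0]] :: real^2^2"
  have frame': "br (v 1) (v 2) = 0 *\<^sub>R v 3" using frame(1) by simp
  show ?thesis
  proof (rule lie_isomorphic_frame[OF br e_bracket_bilinear e_bracket_self _ _ frame' frame(2,3)])
    fix A :: "(real^2^2) \<times> (real^2)"
    show "A \<in> e_alg (vector [1, s]) \<longleftrightarrow> (\<exists>a b c. A = a *\<^sub>R ?F1 + b *\<^sub>R ?F2 + c *\<^sub>R (?J, 0))"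
    proof
      assume "A \<in> e_alg (vector [1, s])"
      then have "fst A \<in> so_alg (vector [1, s])" by (auto simp: e_alg_def)
      then have "fst A $ 1 $ 1 = 0" "fst A $ 1 $ 2 = - (s * fst A $ 2 $ 1)" "s * fst A $ 2 $ 2 = 0"
        unfolding so_alg_iff forall_2 vector_2 by (simp_all add: eq_neg_iff_add_eq_0)
      then have "A = (snd A $ 1) *\<^sub>R ?F1 + (snd A $ 2) *\<^sub>R ?F2 + (fst A $ 2 $ 1 / q) *\<^sub>R (?J, 0)"
        using nz by (simp add: prod_eq_iff vec_eq_iff forall_2)
      then show "\<exists>a b c. A = a *\<^sub>R ?F1 + b *\<^sub>R ?F2 + c *\<^sub>R (?J, 0)" by blast
    qed (auto simp: e_alg_def so_alg_iff forall_2)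
  qed (use nz in \<open>auto simp: vec_eq_iff forall_2 e_bracket_def commutator_def matrix_vector_mult_def
      matrix_matrix_mult_def sum_2 prod_eq_iff\<close>)
qed

end

text \<open>On skew matrices the commutator is the vector product of axial vectors, which is
  orthogonal to both factors; so \<open>k\<close> times a positive number is zero. This invariant
  separates \<open>so(3)\<close> from \<open>so(2,1)\<close>.\<close>

lemma is_so3_no_real_eigenvector:
  assumes so3: "is_so3 br" and eig: "br x y = k *\<^sub>R y" and "y \<noteq> 0"
  shows "k = 0"
proof -
  obtain f where f: "linear f" "bij_betw f UNIV (so_alg (vector [1, 1, 1] :: real^3))"
    "\<And>x y. f (br x y) = commutator (f x) (f y)"
    using so3 unfolding is_so3_def lie_isomorphic_def by blast
  have "f y \<noteq> 0"
    using f(2) \<open>y \<noteq> 0\<close> linear_0[OF f(1)] by (metis bij_betw_def injD)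
  have so: "f z \<in> so_alg (vector [1, 1, 1] :: real^3)" for z
    using f(2) by (auto simp: bij_betw_def)
  have skew: "f z $ i $ j = - f z $ j $ i" for z i j
  proof -
    have "(vector [1, 1, 1] :: real^3) $ i = 1" for i
      using exhaust_3[of i] by auto
    then show ?thesis using so[of z] unfolding so_alg_iff by (simp add: eq_neg_iff_add_eq_0)
  qed
  have diag: "f z $ i $ i = 0" for z i using skew[of z i i] by simp
  have "commutator (f x) (f y) = k *\<^sub>R f y"
    using f(3)[of x y] by (simp add: eig linear_scale[OF f(1)])
  then have c: "commutator (f x) (f y) $ i $ j = k * f y $ i $ j" for i j by simp
  \<comment> \<open>The axial vector of a skew matrix; the equations \<open>e\<close> are the
    components of its cross product.\<close>
  let ?a = "\<lambda>z. f z $ 3 $ 2" and ?b = "\<lambda>z. f z $ 1 $ 3" and ?c = "\<lambda>z. f z $ 2 $ 1"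
  have e: "?b x * ?c y - ?c x * ?b y = k * ?a y" "?c x * ?a y - ?a x * ?c y = k * ?b y"
    "?a x * ?b y - ?b x * ?a y = k * ?c y"
    using c[of 3 2] c[of 1 3] c[of 2 1]
    by (simp_all add: commutator_def matrix_matrix_mult_def sum_3 diag skew[of _ 2 3] skew[of _ 3 1] skew[of _ 1 2]
        algebra_simps)
  have "k * ((?a y)\<^sup>2 + (?b y)\<^sup>2 + (?c y)\<^sup>2) = (k * ?a y) * ?a y + (k * ?b y) * ?b y + (k * ?c y) * ?c y"
    by algebra
  also have "\<dots> = 0" unfolding e[symmetric] by algebra
  finally have "k = 0 \<or> (?a y)\<^sup>2 + (?b y)\<^sup>2 + (?c y)\<^sup>2 = 0" by simp
  moreover have "(?a y)\<^sup>2 + (?b y)\<^sup>2 + (?c y)\<^sup>2 \<noteq> 0"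
  proof
    assume "(?a y)\<^sup>2 + (?b y)\<^sup>2 + (?c y)\<^sup>2 = 0"
    then have "?a y = 0" "?b y = 0" "?c y = 0"
      by (smt (verit) zero_le_power2 power2_eq_iff_nonneg zero_eq_power2)+
    then have "f y = 0"
      using diag skew[of y 2 3] skew[of y 3 1] skew[of y 1 2] by (simp add: vec_eq_iff forall_3)
    then show False using \<open>f y \<noteq> 0\<close> by simp
  qed
  ultimately show ?thesis by blast
qed

lemma is_so3_nonabelian:
  assumes so3: "is_so3 br"
  shows "\<exists>x y. br x y \<noteq> 0"
proof (rule ccontr)
  assume "\<not> ?thesis"
  then have zero: "br x y = 0" for x y by blast
  obtain f where f: "linear f" "bij_betw f UNIV (so_alg (vector [1, 1, 1] :: real^3))"
    "\<And>x y. f (br x y) = commutator (f x) (f y)"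
    using so3 unfolding is_so3_def lie_isomorphic_def by blast
  let ?K1 = "vector [vector [0, 0, 0], vector [0, 0, - 1], vector [0, 1, 0]] :: real^3^3"
  let ?K2 = "vector [vector [0, 0, 1], vector [0, 0, 0], vector [- 1, 0, 0]] :: real^3^3"
  have "?K1 \<in> so_alg (vector [1, 1, 1])" "?K2 \<in> so_alg (vector [1, 1, 1])"
    by (auto simp: so_alg_iff forall_3)
  then have "?K1 \<in> range f" "?K2 \<in> range f"
    using f(2) by (simp_all only: bij_betw_def)
  then obtain x y where "f x = ?K1" "f y = ?K2" by auto
  then have "commutator ?K1 ?K2 = 0"
    using f(3)[of x y] zero linear_0[OF f(1)] by simp
  then show False
    by (simp add: vec_eq_iff forall_3 commutator_def matrix_matrix_mult_def sum_3)
qed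

subsection \<open>Classification\<close>

text \<open>The three factors are the eigenvalues of \<open>tr L - 2 L\<close>, and all their
  pairwise products equal \<open>h\<^sup>2\<close>. If \<open>h\<close> is nonzero they coincide. If
  \<open>h = 0\<close>, two of them vanish, which makes one \<open>\<alpha> i\<close> zero and the
  other two equal; when those vanish too, the case belongs to \<open>values1\<close>.\<close>

lemma cofactor_values_iff:
  "(\<alpha> 1 + \<alpha> 2 + \<alpha> 3 - 2 * \<alpha> 2) * (\<alpha> 1 + \<alpha> 2 + \<alpha> 3 - 2 * \<alpha> 3) = h\<^sup>2 \<and>
   (\<alpha> 1 + \<alpha> 2 + \<alpha> 3 - 2 * \<alpha> 3) * (\<alpha> 1 + \<alpha> 2 + \<alpha> 3 - 2 * \<alpha> 1) = h\<^sup>2 \<and>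
   (\<alpha> 1 + \<alpha> 2 + \<alpha> 3 - 2 * \<alpha> 1) * (\<alpha> 1 + \<alpha> 2 + \<alpha> 3 - 2 * \<alpha> 2) = h\<^sup>2
   \<longleftrightarrow> values1 \<alpha> h \<or> values2 \<alpha> h" (is "?L \<longleftrightarrow> ?R")
proof
  assume ?L
  define a b c where "a = \<alpha> 2 + \<alpha> 3 - \<alpha> 1" and "b = \<alpha> 3 + \<alpha> 1 - \<alpha> 2" and "c = \<alpha> 1 + \<alpha> 2 - \<alpha> 3"
  have eqs: "b * c = h\<^sup>2" "c * a = h\<^sup>2" "a * b = h\<^sup>2"
    using \<open>?L\<close> unfolding a_def b_def c_def by (simp_all add: algebra_simps)
  show ?R
  proof (cases "h = 0")
    case False
    then have "h\<^sup>2 \<noteq> 0" by simp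
    then have abc: "a = b" "b = c"
      using eqs by (metis mult.commute mult_cancel_left mult_zero_left)+
    then have "c\<^sup>2 = h\<^sup>2" using eqs by (simp add: power2_eq_square)
    then have "c = h \<or> c = - h" by (simp add: power2_eq_iff)
    then show ?thesis using abc unfolding values1_def a_def b_def c_def by auto
  next
    case True
    then have "b = 0 \<and> c = 0 \<or> c = 0 \<and> a = 0 \<or> a = 0 \<and> b = 0" using eqs by auto
    then have "\<alpha> 1 = 0 \<and> \<alpha> 2 = \<alpha> 3 \<or> \<alpha> 2 = 0 \<and> \<alpha> 3 = \<alpha> 1 \<or> \<alpha> 3 = 0 \<and> \<alpha> 1 = \<alpha> 2"
      unfolding a_def b_def c_def by argo
    then show ?thesis
      using True unfolding values1_def values2_def cyclic3_def
      by (elim disjE; cases "\<alpha> 1 = 0"; cases "\<alpha> 2 = 0"; simp)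
  qed
qed (auto simp: values1_def values2_def cyclic3_def power2_eq_square)

lemma alternating3_independent:
  fixes x y z :: "'a::real_vector"
  assumes \<mu>: "alternating3 \<mu>" and nz: "\<mu> x y z \<noteq> 0"
  shows "x \<noteq> y" "x \<noteq> z" "y \<noteq> z" "independent {x, y, z}"
proof -
  have alt: "\<mu> p p q = 0" "\<mu> p q p = 0" "\<mu> p q q = 0" for p q
    using \<mu> unfolding alternating3_def by blast+
  note lin = alternating3_linear[OF \<mu>]
  show ne: "x \<noteq> y" "x \<noteq> z" "y \<noteq> z" using nz alt by metis+
  show "independent {x, y, z}"
  proof (rule independent_if_scalars_zero)
    fix f u assume "(\<Sum>p\<in>{x, y, z}. f p *\<^sub>R p) = 0" and u: "u \<in> {x, y, z}"
    then have s: "f x *\<^sub>R x + (f y *\<^sub>R y + f z *\<^sub>R z) = 0" using ne by simp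
    have "\<mu> (f x *\<^sub>R x + (f y *\<^sub>R y + f z *\<^sub>R z)) y z = f x * \<mu> x y z"
      "\<mu> x (f x *\<^sub>R x + (f y *\<^sub>R y + f z *\<^sub>R z)) z = f y * \<mu> x y z"
      "\<mu> x y (f x *\<^sub>R x + (f y *\<^sub>R y + f z *\<^sub>R z)) = f z * \<mu> x y z"
      by (simp_all add: lin[THEN linear_add] lin[THEN linear_scale] alt)
    then have "f x = 0 \<and> f y = 0 \<and> f z = 0"
      using nz unfolding s lin[THEN linear_0] by simp
    then show "f u = 0" using u by auto
  qed simp
qed

text \<open>Moving \<open>z\<close> along the null vector \<open>w\<close> changes the square of
  \<open>z\<close> by a linear term with nonzero coefficient, so every value \<open>c\<close> is
  attained.\<close>

lemma null_vector_indefinite: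
  assumes "pseudo_metric g" "g w w = 0" "w \<noteq> 0"
  shows "indefinite_on g UNIV"
proof -
  have g: "bilinear g" and sym: "\<And>x y. g x y = g y x"
    using assms(1) by (auto simp: pseudo_metric_def)
  obtain z where z: "g w z \<noteq> 0" using assms unfolding pseudo_metric_def by blast
  have "g (z + ((c - g z z) / (2 * g w z)) *\<^sub>R w) (z + ((c - g z z) / (2 * g w z)) *\<^sub>R w) = c" for c
    using z by (simp add: bilin_simps[OF g] sym[of z w] assms(2) field_simps)
  from this[of 1] this[of "-1"] show ?thesis
    unfolding indefinite_on_def by (metis UNIV_I less_numeral_extra(1) neg_less_0_iff_less)
qed

context frame3
begin

lemma frame_diagonalizable:
  assumes "\<And>i. i \<in> {1..3} \<Longrightarrow> L (v i) = \<alpha> i *\<^sub>R v i"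
  shows "diagonalizable L"
  unfolding diagonalizable_def
proof (intro exI[of _ "v ` {1..3}"] conjI ballI)
  have "g (v i) (v i) \<noteq> 0" if "i \<in> {1..3}" for i using unit[OF that] by auto
  then show "independent (v ` {1..3})"
    using orthogonal by (intro orthogonal_independent[OF g_bilinear]) (auto, metis)
  show "\<exists>c. L b = c *\<^sub>R b" if "b \<in> v ` {1..3}" for b using that assms by auto
qed (rule spanning)

lemma bracket_expand:
  assumes "bilinear br" "\<And>x. br x x = 0"
  shows "br x y = (coord 1 x * coord 2 y - coord 2 x * coord 1 y) *\<^sub>R br (v 1) (v 2)
    + (coord 2 x * coord 3 y - coord 3 x * coord 2 y) *\<^sub>R br (v 2) (v 3)
    + (coord 3 x * coord 1 y - coord 1 x * coord 3 y) *\<^sub>R br (v 3) (v 1)"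
proof -
  have "br x y = br (coord 1 x *\<^sub>R v 1 + coord 2 x *\<^sub>R v 2 + coord 3 x *\<^sub>R v 3)
      (coord 1 y *\<^sub>R v 1 + coord 2 y *\<^sub>R v 2 + coord 3 y *\<^sub>R v 3)"
    by (simp only: coord_expand[symmetric])
  then show ?thesis by (simp only: alternating_bilinear_expand[OF assms])
qed

lemma coord_frame [simp]:
  "coord 1 (v 1) = 1" "coord 1 (v 2) = 0" "coord 1 (v 3) = 0" "coord 2 (v 1) = 0"
  "coord 2 (v 2) = 1" "coord 2 (v 3) = 0" "coord 3 (v 1) = 0" "coord 3 (v 2) = 0" "coord 3 (v 3) = 1"
  by (simp_all add: coord_def)

lemma g_coord: "g x y = sg 1 * coord 1 x * coord 1 y + sg 2 * coord 2 x * coord 2 y + sg 3 * coord 3 x * coord 3 y"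
  by (subst g_frame) (simp add: sum_1_3 coord_def mult_ac)

lemma sg_cases: "i \<in> {1..3} \<Longrightarrow> sg i = 1 \<or> sg i = -1"
  using unit by (simp add: square_eq_1_iff)

lemma frame_nonzero: "i \<in> {1..3} \<Longrightarrow> v i \<noteq> 0"
  using unit[of i] by (auto simp: g_simps)

text \<open>With \<open>s = sg 3 * sg 1\<close> the structure constants are those of
  \<open>so_alg\<close> for the diagonal 1, 1, \<open>s\<close>, scaled by
  \<open>\<alpha> * sg 1\<close>, and \<open>s = 1\<close> exactly when all three signs agree. For
  \<open>s = -1\<close> a nonzero real eigenvalue excludes \<open>so(3)\<close>.\<close>

lemma isotropic_bracket:
  assumes br: "bilinear br" "\<And>x. br x x = 0" and sg: "sg 1 = sg 2"
    and frame: "br (v 1) (v 2) = (\<alpha> * sg 3) *\<^sub>R v 3" "br (v 2) (v 3) = (\<alpha> * sg 1) *\<^sub>R v 1"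
      "br (v 3) (v 1) = (\<alpha> * sg 2) *\<^sub>R v 2"
  shows "\<alpha> = 0 \<Longrightarrow> abelian_on br UNIV \<and> flat_metric br g"
    and "\<alpha> \<noteq> 0 \<Longrightarrow> is_so21 br \<or> is_so3 br"
    and "is_so3 br \<longleftrightarrow> definite_on g UNIV \<and> \<alpha> \<noteq> 0"
proof -
  have zero: "br x y = 0" if "\<alpha> = 0" for x y
    by (subst bracket_expand[OF br]) (simp add: frame that)
  show "abelian_on br UNIV \<and> flat_metric br g" if "\<alpha> = 0"
    using zero[OF that] unfolding abelian_on_def flat_metric_def metric_levi_civita_def
    by (intro conjI exI[of _ "\<lambda>_ _. 0"]) (auto simp: bilinear_def g_simps intro!: linearI)
  have nz: "sg 1 \<noteq> 0" "sg 3 \<noteq> 0" using sg_sq by force+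
  define s where "s = sg 3 * sg 1"
  have s: "br (v 1) (v 2) = (\<alpha> * sg 1 * s) *\<^sub>R v 3" "br (v 3) (v 1) = (\<alpha> * sg 1) *\<^sub>R v 2"
    using frame sg by (simp_all add: s_def mult_ac)
  have iso: "lie_isomorphic br (so_alg (vector [1, 1, s] :: real^3)) commutator" if "\<alpha> \<noteq> 0"
    by (rule lie_isomorphic_so_alg[OF br _ _ s(1) frame(2) s(2)]) (use that nz in \<open>auto simp: s_def\<close>)
  have s_cases: "s = 1 \<and> sg 3 = sg 1 \<or> s = -1 \<and> sg 3 = - sg 1"
    using sg_cases[of 1] sg_cases[of 3] by (auto simp: s_def)
  show "is_so21 br \<or> is_so3 br" if "\<alpha> \<noteq> 0"
    using iso[OF that] s_cases by (auto simp: is_so21_def is_so3_def)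
  show "is_so3 br \<longleftrightarrow> definite_on g UNIV \<and> \<alpha> \<noteq> 0"
  proof (cases "\<alpha> = 0")
    case True
    then show ?thesis using zero is_so3_nonabelian by blast
  next
    case False
    show ?thesis
      using s_cases
    proof (elim disjE conjE)
      assume *: "s = 1" "sg 3 = sg 1"
      define c where "c = sg 1"
      have "g x x = c * ((coord 1 x)\<^sup>2 + (coord 2 x)\<^sup>2 + (coord 3 x)\<^sup>2)" for x
        unfolding c_def by (subst g_coord) (simp add: * sg[symmetric] power2_eq_square algebra_simps)
      moreover have "(coord 1 x)\<^sup>2 + (coord 2 x)\<^sup>2 + (coord 3 x)\<^sup>2 > 0" if "x \<noteq> 0" for x
      proof -
        have "coord 1 x \<noteq> 0 \<or> coord 2 x \<noteq> 0 \<or> coord 3 x \<noteq> 0"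
          using that coord_expand[of x] by auto
        then show ?thesis
          by (metis add_nonneg_pos add_pos_nonneg zero_le_power2 zero_less_power2 add_nonneg_nonneg)
      qed
      moreover have "c = 1 \<or> c = -1" using sg_cases[of 1] by (simp add: c_def)
      ultimately have "definite_on g UNIV"
        unfolding definite_on_def by (metis mult_1 mult_minus1 neg_less_0_iff_less)
      then show ?thesis using False iso * by (simp add: is_so3_def)
    next
      assume *: "s = -1" "sg 3 = - sg 1"
      have "\<not> definite_on g UNIV"
        unfolding definite_on_def using * nz frame_nonzero[of 1] frame_nonzero[of 3]
        by (metis UNIV_I atLeastAtMost_iff less_asym neg_0_less_iff_less numeral_le_iff one_le_numeral order_refl)
      moreover have "\<not> is_so3 br"
      proof
        assume so3: "is_so3 br"
        \<comment> \<open>A null vector of the Lorentzian plane spanned by \<open>v 2\<close> and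
          \<open>v 3\<close> is an eigenvector of the boost \<open>br (v 1)\<close>.\<close>
        have "br (v 1) (v 2 - v 3) = (\<alpha> * sg 1) *\<^sub>R (v 2 - v 3)"
          using skew_bilinear[OF br, of "v 1" "v 3"] s *
          by (simp add: bilin_simps[OF br(1)] algebra_simps)
        moreover have "v 2 - v 3 \<noteq> 0"
        proof
          assume "v 2 - v 3 = 0"
          then have "g (v 2 - v 3) (v 2) = 0" by (simp add: g_simps)
          then show False using nz sg by (simp add: g_simps)
        qed
        ultimately show False using is_so3_no_real_eigenvector[OF so3] False nz by force
      qed
      ultimately show ?thesis by blast
    qed
  qed
qed

text \<open>The vectors \<open>v 1\<close> and \<open>v 2\<close> span an abelian ideal on which
  \<open>br (v 3)\<close> acts as an infinitesimal rotation or boost, depending on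
  \<open>sg 1 * sg 2\<close>.\<close>

lemma metabelian_bracket:
  assumes br: "bilinear br" "\<And>x. br x x = 0" and \<alpha>: "\<alpha> \<noteq> 0"
    and frame: "br (v 1) (v 2) = 0" "br (v 2) (v 3) = (\<alpha> * sg 1) *\<^sub>R v 1" "br (v 3) (v 1) = (\<alpha> * sg 2) *\<^sub>R v 2"
  shows "flat_metric br g" "abelian_on br (derived_algebra br)" "dim (derived_algebra br) = 2"
    "is_e2 br \<and> definite_on g (derived_algebra br) \<or> is_e11 br \<and> indefinite_on g (derived_algebra br)"
proof -
  have nz: "sg 1 \<noteq> 0" "sg 2 \<noteq> 0" using sg_sq by force+
  have expand: "br x y = ((coord 2 x * coord 3 y - coord 3 x * coord 2 y) * (\<alpha> * sg 1)) *\<^sub>R v 1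
      + ((coord 3 x * coord 1 y - coord 1 x * coord 3 y) * (\<alpha> * sg 2)) *\<^sub>R v 2" for x y
    by (subst bracket_expand[OF br]) (simp add: frame)
  note coord_simps = linear_add[OF coord_linear] linear_scale[OF coord_linear]
  have coord_br: "coord 1 (br x y) = (coord 2 x * coord 3 y - coord 3 x * coord 2 y) * (\<alpha> * sg 1)"
    "coord 2 (br x y) = (coord 3 x * coord 1 y - coord 1 x * coord 3 y) * (\<alpha> * sg 2)"
    "coord 3 (br x y) = 0" for x y
    by (simp_all add: expand[of x y] coord_simps)
  show "flat_metric br g"
    unfolding flat_metric_def metric_levi_civita_def
  \<comment> \<open>As both nonzero constants equal \<open>\<alpha>\<close>, \<open>br (v 3)\<close>
    is skew for \<open>g\<close>, so this is a metric connection. It is flat because all its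
    operators are multiples of one operator and \<open>coord 3\<close> vanishes on brackets.\<close>
  proof (intro exI[of _ "\<lambda>x y. coord 3 x *\<^sub>R br (v 3) y"] conjI allI)
    show "bilinear (\<lambda>x y. coord 3 x *\<^sub>R br (v 3) y)"
      unfolding bilinear_def by (auto intro!: linearI simp: coord_simps bilin_simps[OF br(1)] algebra_simps)
    show "g (coord 3 x *\<^sub>R br (v 3) y) z + g y (coord 3 x *\<^sub>R br (v 3) z) = 0" for x y z
    proof -
      have "g (br (v 3) y) z = \<alpha> * (coord 1 y * coord 2 z - coord 2 y * coord 1 z)" for y z
        by (subst g_coord) (simp add: coord_br algebra_simps)
      note br3 = this
      show ?thesis
        unfolding g_simps g_sym[of y "br (v 3) z"] br3 by (simp add: algebra_simps)
    qed
    show "coord 3 x *\<^sub>R br (v 3) y - coord 3 y *\<^sub>R br (v 3) x = br x y" for x y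
      by (simp add: expand algebra_simps)
    show "coord 3 x *\<^sub>R br (v 3) (coord 3 y *\<^sub>R br (v 3) z) - coord 3 y *\<^sub>R br (v 3) (coord 3 x *\<^sub>R br (v 3) z)
        - coord 3 (br x y) *\<^sub>R br (v 3) z = 0" for x y z
      by (simp add: coord_br bilin_simps[OF br(1)])
  qed
  have derived: "derived_algebra br = span {v 1, v 2}"
    unfolding derived_algebra_def
  proof (rule span_eq[THEN iffD2], intro conjI)
    show "{br x y |x y. True} \<subseteq> span {v 1, v 2}"
      by (auto simp: mem_span_pair) (use expand in blast)
    have "v 1 = (1 / (\<alpha> * sg 1)) *\<^sub>R br (v 2) (v 3)" "v 2 = (1 / (\<alpha> * sg 2)) *\<^sub>R br (v 3) (v 1)"
      using \<alpha> nz by (simp_all add: frame)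
    then show "{v 1, v 2} \<subseteq> span {br x y |x y. True}"
      by (metis (mono_tags, lifting) empty_subsetI insert_subset mem_Collect_eq span_base span_scale)
  qed
  have "v 1 \<noteq> v 2" using g_frame_offdiag nz by metis
  moreover have "independent {v 1, v 2}"
    by (rule orthogonal_independent[OF g_bilinear]) (use nz in auto)
  ultimately show "dim (derived_algebra br) = 2"
    by (simp add: derived dim_eq_card_independent)
  show "abelian_on br (derived_algebra br)"
    by (auto simp: abelian_on_def derived mem_span_pair expand coord_simps)
  \<comment> \<open>Matches the model with \<open>q = \<alpha> * sg 2\<close>, since then
    \<open>s * q = \<alpha> * sg 1\<close>.\<close>
  define s where "s = sg 1 * sg 2"
  have "br (v 2) (v 3) = (s * (\<alpha> * sg 2)) *\<^sub>R v 1"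
    by (simp add: frame s_def mult_ac)
  then have iso: "lie_isomorphic br (e_alg (vector [1, s] :: real^2)) e_bracket"
    using lie_isomorphic_e_alg[OF br _ _ frame(1) _ frame(3)] \<alpha> nz by (simp add: s_def)
  have "s = 1 \<and> sg 2 = sg 1 \<or> s = -1 \<and> sg 2 = - sg 1"
    using sg_cases[of 1] sg_cases[of 2] by (auto simp: s_def)
  then show "is_e2 br \<and> definite_on g (derived_algebra br) \<or> is_e11 br \<and> indefinite_on g (derived_algebra br)"
  proof (elim disjE conjE)
    assume *: "s = 1" "sg 2 = sg 1"
    define c where "c = sg 1"
    have "g x x = c * ((coord 1 x)\<^sup>2 + (coord 2 x)\<^sup>2) \<and> (x \<noteq> 0 \<longrightarrow> (coord 1 x)\<^sup>2 + (coord 2 x)\<^sup>2 > 0)"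
      if "x \<in> span {v 1, v 2}" for x
    proof
      have 0: "coord 3 x = 0" using that by (auto simp: mem_span_pair coord_simps)
      show "g x x = c * ((coord 1 x)\<^sup>2 + (coord 2 x)\<^sup>2)"
        unfolding c_def by (subst g_coord) (simp add: 0 * power2_eq_square algebra_simps)
      show "x \<noteq> 0 \<longrightarrow> (coord 1 x)\<^sup>2 + (coord 2 x)\<^sup>2 > 0"
        using coord_expand[of x] 0 by (auto simp: sum_power2_gt_zero_iff)
    qed
    moreover have "c = 1 \<or> c = -1" using sg_cases[of 1] by (simp add: c_def)
    ultimately have "definite_on g (span {v 1, v 2})"
      unfolding definite_on_def by (metis mult_1 mult_minus1 neg_less_0_iff_less)
    then show ?thesis using iso * by (simp add: is_e2_def derived)
  next
    assume *: "s = -1" "sg 2 = - sg 1"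
    have "v 1 \<in> span {v 1, v 2}" "v 2 \<in> span {v 1, v 2}" by (simp_all add: span_base)
    then have "indefinite_on g (span {v 1, v 2})"
      unfolding indefinite_on_def using sg_cases[of 1] * by force
    then show ?thesis using iso * by (simp add: is_e11_def derived)
  qed
qed

end

context bracket_frame3
begin

text \<open>In an eigenframe \<open>M\<close> is diagonal and the minor equations become products of
  eigenvalues. The equivalence serves both to determine the constants and to realise them.\<close>

lemma eigenframe_einstein:
  assumes eig: "\<And>i. i \<in> {1..3} \<Longrightarrow> L (v i) = \<alpha> i *\<^sub>R v i"
  shows "unimodular br"
    and "gen_einstein br H g \<longleftrightarrow> values1 \<alpha> (H (v 1) (v 2) (v 3)) \<or> values2 \<alpha> (H (v 1) (v 2) (v 3))"
proof -
  have L: "L (v 1) = \<alpha> 1 *\<^sub>R v 1" "L (v 2) = \<alpha> 2 *\<^sub>R v 2" "L (v 3) = \<alpha> 3 *\<^sub>R v 3"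
    by (rule eig, simp)+
  show uni: "unimodular br"
    by (simp add: unimodular_iff L g_simps)
  define t where "t = \<alpha> 1 + \<alpha> 2 + \<alpha> 3"
  have t: "sg 1 * g (L (v 1)) (v 1) + sg 2 * g (L (v 2)) (v 2) + sg 3 * g (L (v 3)) (v 3) = t"
    by (simp add: L g_simps t_def mult.left_commute)
  have off: "M (v 1) (v 2) = 0" "M (v 1) (v 3) = 0" "M (v 2) (v 3) = 0"
    by (simp_all add: M_def L g_simps)
  have diag: "M (v 1) (v 1) = (t - 2 * \<alpha> 1) * sg 1" "M (v 2) (v 2) = (t - 2 * \<alpha> 2) * sg 2"
    "M (v 3) (v 3) = (t - 2 * \<alpha> 3) * sg 3"
    unfolding M_def t by (simp_all add: L g_simps algebra_simps)
  \<comment> \<open>Both sides of a diagonal minor equation carry the same two frame signs.\<close>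
  have cancel: "(x * a) * (y * b) - 0 * 0 = k * a * b \<longleftrightarrow> x * y = k"
    if "a * a = 1" "b * b = 1" for x y a b k :: real
  proof -
    have "a * b \<noteq> 0" using that by auto
    moreover have "(x * a) * (y * b) - 0 * 0 = (x * y) * (a * b)" "k * a * b = k * (a * b)" by simp_all
    ultimately show ?thesis by (metis mult_cancel_right)
  qed
  show "gen_einstein br H g \<longleftrightarrow> values1 \<alpha> (H (v 1) (v 2) (v 3)) \<or> values2 \<alpha> (H (v 1) (v 2) (v 3))"
    unfolding gen_einstein_iff_minors[OF uni] off diag cancel[OF sg_sq(2,3)] cancel[OF sg_sq(3,1)] cancel[OF sg_sq(1,2)]
    unfolding t_def cofactor_values_iff[symmetric] by simp
qed

end

text \<open>Three-cycles are even, so the orientation survives.\<close>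

lemma oriented_frame3_rotate:
  fixes g :: "'a::euclidean_space \<Rightarrow> 'a \<Rightarrow> real"
  assumes dim: "DIM('a) = 3" and v: "oriented_frame3 g v \<omega>" and cyc: "(a, b, c) \<in> cyclic3"
  shows "oriented_frame3 g (\<lambda>i. v (if i = 1 then a else if i = 2 then b else c)) \<omega>"
proof -
  interpret oriented_frame3 g v \<omega> by fact
  have abc: "a = 1 \<and> b = 2 \<and> c = 3 \<or> a = 2 \<and> b = 3 \<and> c = 1 \<or> a = 3 \<and> b = 1 \<and> c = 2"
    using cyc by (auto simp: cyclic3_def)
  have "frame3 g (\<lambda>i. v (if i = 1 then a else if i = 2 then b else c))"
    by (rule frame3I[OF dim metric]) (use abc in auto)
  moreover have "\<omega> (v a) (v b) (v c) = \<omega> (v 1) (v 2) (v 3)"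
  proof -
    note sw = alternating3_swap[OF \<omega>_alt]
    have "\<omega> (v 2) (v 3) (v 1) = \<omega> (v 1) (v 2) (v 3)" "\<omega> (v 3) (v 1) (v 2) = \<omega> (v 1) (v 2) (v 3)"
      using sw(1)[of "v 2" "v 1" "v 3"] sw(2)[of "v 2" "v 3" "v 1"] sw(2)[of "v 1" "v 2" "v 3"]
        sw(1)[of "v 3" "v 1" "v 2"] by linarith+
    then show ?thesis using abc by auto
  qed
  ultimately show ?thesis
    using \<omega>_alt \<omega>_pos by (simp add: oriented_frame3_def oriented_frame3_axioms_def)
qed

lemma oriented_frame3_bracket:
  assumes v: "oriented_frame3 g v \<omega>" and E: "einstein_group br \<omega> g H" and L: "linear L"
    and br: "\<And>x y. br x y = L (cross_prod g \<omega> x y)"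
  shows "bracket_frame3 g v br H L"
proof -
  interpret oriented_frame3 g v \<omega> by fact
  have "bilinear br" "\<And>x. br x x = 0" "alternating3 H"
    using E unfolding einstein_group_def lie_bracket_def by blast+
  moreover have "br (v 1) (v 2) = sg 3 *\<^sub>R L (v 3)" "br (v 2) (v 3) = sg 1 *\<^sub>R L (v 1)"
    "br (v 3) (v 1) = sg 2 *\<^sub>R L (v 2)"
    by (simp_all add: br cross_prod_frame linear_scale[OF L])
  ultimately show ?thesis
    by unfold_locales (simp_all add: linear_add[OF L] linear_scale[OF L])
qed

lemma adapted_frame_iff:
  "adapted_frame br \<omega> g H v \<alpha> h \<longleftrightarrow> oriented_orthonormal g \<omega> v \<and>
     br (v 1) (v 2) = (\<alpha> 3 * g (v 3) (v 3)) *\<^sub>R v 3 \<and> br (v 2) (v 3) = (\<alpha> 1 * g (v 1) (v 1)) *\<^sub>R v 1 \<and>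
     br (v 3) (v 1) = (\<alpha> 2 * g (v 2) (v 2)) *\<^sub>R v 2 \<and>
     (\<forall>x y z. H x y z = h * vol_form g \<omega> x y z) \<and> g (v 1) (v 1) = g (v 2) (v 2)"
  by (auto simp: adapted_frame_def cyclic3_def)

lemma eigenframe_adapted:
  assumes v: "oriented_frame3 g v \<omega>" and br: "bracket_frame3 g v br H L" and sg: "g (v 1) (v 1) = g (v 2) (v 2)"
    and eig: "\<And>i. i \<in> {1..3} \<Longrightarrow> L (v i) = \<alpha> i *\<^sub>R v i"
  shows "adapted_frame br \<omega> g H v \<alpha> (H (v 1) (v 2) (v 3))"
proof -
  interpret oriented_frame3 g v \<omega> by fact
  interpret bracket_frame3 g v br H L by fact
  show ?thesis
    unfolding adapted_frame_iff
  proof (intro conjI allI)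
    show "H x y z = H (v 1) (v 2) (v 3) * vol_form g \<omega> x y z" for x y z
      by (rule alternating3_vol_form[OF H_alt])
  qed (simp_all add: oriented_orthonormal_frame br_frame eig sg mult.commute)
qed

lemma adapted_frame_classification:
  fixes g :: "'a::euclidean_space \<Rightarrow> 'a \<Rightarrow> real"
  assumes dim: "DIM('a) = 3" and E: "einstein_group br \<omega> g H" and L: "linear L"
    and brL: "\<And>x y. br x y = L (cross_prod g \<omega> x y)" and adapted: "adapted_frame br \<omega> g H v \<alpha> h"
  shows "(values1 \<alpha> h \<and> (h = 0 \<longrightarrow> abelian_on br UNIV \<and> flat_metric br g) \<and>
      (h \<noteq> 0 \<longrightarrow> is_so21 br \<or> is_so3 br) \<and> (is_so3 br \<longleftrightarrow> definite_on g UNIV \<and> h \<noteq> 0)) \<or>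
    (values2 \<alpha> h \<and> flat_metric br g \<and> abelian_on br (derived_algebra br) \<and> dim (derived_algebra br) = 2 \<and>
      ((is_e2 br \<and> definite_on g (derived_algebra br)) \<or> (is_e11 br \<and> indefinite_on g (derived_algebra br))))"
proof -
  have v: "oriented_frame3 g v \<omega>"
    by (rule oriented_orthonormalD[OF dim]) (use E adapted in \<open>auto simp: einstein_group_def adapted_frame_def\<close>)
  interpret oriented_frame3 g v \<omega> by fact
  interpret bracket_frame3 g v br H L by (rule oriented_frame3_bracket[OF v E L brL])
  have frame: "br (v 1) (v 2) = (\<alpha> 3 * sg 3) *\<^sub>R v 3" "br (v 2) (v 3) = (\<alpha> 1 * sg 1) *\<^sub>R v 1"
    "br (v 3) (v 1) = (\<alpha> 2 * sg 2) *\<^sub>R v 2" and sg: "sg 1 = sg 2"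
    and H: "H x y z = h * vol_form g \<omega> x y z" for x y z
    using adapted by (simp_all add: adapted_frame_iff)
  have "L (v i) = \<alpha> i *\<^sub>R v i" if "i \<in> {1..3}" for i
  proof -
    have "i = 1 \<or> i = 2 \<or> i = 3" using that by auto
    then have "sg i *\<^sub>R L (v i) = (\<alpha> i * sg i) *\<^sub>R v i"
      using br_frame frame by auto
    \<comment> \<open>A second factor \<open>sg i\<close> inverts the first, which isolates
      \<open>L (v i)\<close>.\<close>
    then have "sg i *\<^sub>R (sg i *\<^sub>R L (v i)) = sg i *\<^sub>R ((\<alpha> i * sg i) *\<^sub>R v i)" by (rule arg_cong)
    then show ?thesis using unit[OF that] by (simp add: mult.left_commute[of "sg i"])
  qed
  moreover have "H (v 1) (v 2) (v 3) = h" by (simp add: H vol_form_frame)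
  ultimately have "values1 \<alpha> h \<or> values2 \<alpha> h"
    using eigenframe_einstein(2)[of \<alpha>] E by (simp add: einstein_group_def)
  then show ?thesis
  proof
    assume 1: "values1 \<alpha> h"
    then have "\<alpha> 1 = \<alpha> 3" "\<alpha> 2 = \<alpha> 3" "\<alpha> 3 = 0 \<longleftrightarrow> h = 0" by (auto simp: values1_def)
    then show ?thesis
      using isotropic_bracket[OF br_bilinear br_self sg, of "\<alpha> 3"] frame 1 by auto
  next
    assume 2: "values2 \<alpha> h"
    then obtain a b c where cyc: "(a, b, c) \<in> cyclic3" and \<alpha>: "\<alpha> a = \<alpha> b" "\<alpha> a \<noteq> 0" "\<alpha> c = 0"
      by (auto simp: values2_def)
    \<comment> \<open>The rotation puts the vanishing constant in third place, as
      \<open>metabelian_bracket\<close> expects.\<close>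
    interpret u: oriented_frame3 g "\<lambda>i. v (if i = 1 then a else if i = 2 then b else c)" \<omega>
      by (rule oriented_frame3_rotate[OF dim v cyc])
    have "br (v a) (v b) = 0" "br (v b) (v c) = (\<alpha> a * sg a) *\<^sub>R v a" "br (v c) (v a) = (\<alpha> a * sg b) *\<^sub>R v b"
      using cyc frame \<alpha> by (auto simp: cyclic3_def)
    then show ?thesis
      using u.metabelian_bracket[OF br_bilinear br_self \<alpha>(2)] 2 by simp
  qed
qed

text \<open>For non-null \<open>w\<close> the map
  \<open>g w w *\<^sub>R x - g w x *\<^sub>R w\<close> kills \<open>w\<close> and is a scalar on its
  orthogonal complement, so any orthonormal frame starting with \<open>w\<close> normalised is an
  eigenframe. Only a nonzero null \<open>w\<close> escapes.\<close>

lemma eigenframe_or_null: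
  fixes g :: "'a::euclidean_space \<Rightarrow> 'a \<Rightarrow> real"
  assumes dim: "DIM('a) = 3" and E: "einstein_group br \<omega> g H" and L: "linear L"
    and brL: "\<And>x y. br x y = L (cross_prod g \<omega> x y)"
  obtains (eigen) v \<alpha> where "oriented_frame3 g v \<omega>" "\<And>i. i \<in> {1..3} \<Longrightarrow> L (v i) = \<alpha> i *\<^sub>R v i"
  | (null) \<kappa> w where "\<And>x. L x = (\<kappa> * g w x) *\<^sub>R w" "g w w = 0" "\<kappa> \<noteq> 0" "w \<noteq> 0" "\<And>x y z. H x y z = 0"
proof -
  have metric: "pseudo_metric g" and \<omega>: "alternating3 \<omega>" "\<omega> \<noteq> (\<lambda>x y z. 0)"
    using E by (auto simp: einstein_group_def)
  obtain v where v: "oriented_frame3 g v \<omega>"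
    by (rule oriented_frame3_exists[OF dim metric \<omega>])
  interpret oriented_frame3 g v \<omega> by fact
  interpret bracket_frame3 g v br H L by (rule oriented_frame3_bracket[OF v E L brL])
  have "unimodular br" "gen_einstein br H g" using E by (auto simp: einstein_group_def)
  from einstein_L[OF this] show thesis
  proof (elim disjE exE conjE)
    fix c assume "\<forall>x. L x = c *\<^sub>R x"
    then show thesis using eigen[OF v, of "\<lambda>_. c"] by simp
  next
    fix \<kappa> w assume H0: "H (v 1) (v 2) (v 3) = 0" and Lw: "\<forall>x. L x = \<kappa> *\<^sub>R (g w w *\<^sub>R x - g w x *\<^sub>R w)"
    show thesis
    proof (cases "g w w = 0")
      case False
      obtain u c where u: "oriented_frame3 g u \<omega>" and w: "w = c *\<^sub>R u 1"
        by (rule oriented_frame3_extend[OF dim metric \<omega> False])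
      interpret u: oriented_frame3 g u \<omega> by fact
      have "L (u i) = (if i = 1 then 0 else \<kappa> * g w w) *\<^sub>R u i" if "i \<in> {1..3}" for i
      proof -
        have "i = 1 \<or> i = 2 \<or> i = 3" using that by auto
        then show ?thesis by (auto simp: Lw) (auto simp: w g_simps)
      qed
      then show thesis by (rule eigen[OF u])
    next
      case True
      show thesis
      proof (cases "\<kappa> = 0 \<or> w = 0")
        case True
        then have "L x = 0" for x using Lw by (auto simp: g_simps)
        then show thesis using eigen[OF v, of "\<lambda>_. 0"] by simp
      next
        case False
        have "H x y z = 0" for x y z
          using alternating3_vol_form[OF H_alt, of x y z] H0 by simp
        then show thesis
          using null[of "- \<kappa>" w] Lw True False by simp
      qed
    qed
  qed
qed

text \<open>Here \<open>L\<close> is nonzero with square zero. An eigenvector not orthogonal to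
  \<open>w\<close> would have eigenvalue 0, yet \<open>L\<close> maps it to a nonzero multiple of
  \<open>w\<close>; so all eigenvectors lie in the proper subspace orthogonal to
  \<open>w\<close>.\<close>

lemma null_not_diagonalizable:
  assumes metric: "pseudo_metric g" and L: "\<And>x. L x = (\<kappa> * g w x) *\<^sub>R w"
    and w: "g w w = 0" "\<kappa> \<noteq> 0" "w \<noteq> 0"
  shows "\<not> diagonalizable L"
proof
  have g: "bilinear g" using metric by (auto simp: pseudo_metric_def)
  assume "diagonalizable L"
  then obtain B where B: "independent B" "span B = UNIV" "\<And>b. b \<in> B \<Longrightarrow> \<exists>c. L b = c *\<^sub>R b"
    unfolding diagonalizable_def by blast
  have "g w b = 0" if b: "b \<in> B" for b
  proof (rule ccontr)
    assume nz: "g w b \<noteq> 0"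
    obtain c where c: "L b = c *\<^sub>R b" using B(3) b by blast
    then have "g w (L b) = c * g w b" by (simp add: bilin_simps[OF g])
    moreover have "g w (L b) = 0" by (simp add: L w bilin_simps[OF g])
    ultimately have "L b = 0" using nz c by simp
    then show False using nz w by (simp add: L)
  qed
  then have "g w x = 0" for x
    using B(2) bilinear_linear(1)[OF g, of w] linear_eq_0_on_span[of "g w" B x] by auto
  then show False using metric w by (auto simp: pseudo_metric_def)
qed

text \<open>The bracket of \<open>x\<close> and \<open>y\<close> is
  \<open>\<kappa> * vol(x, y, w)\<close> times \<open>w\<close>, so \<open>w\<close> is central and
  spans the derived algebra; any \<open>x\<close>, \<open>y\<close> that complete \<open>w\<close>
  to a basis are Heisenberg generators.\<close>

lemma null_heisenberg:
  fixes g :: "'a::euclidean_space \<Rightarrow> 'a \<Rightarrow> real"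
  assumes dim: "DIM('a) = 3" and v: "oriented_frame3 g v \<omega>"
    and brL: "\<And>x y. br x y = (\<kappa> * g w (cross_prod g \<omega> x y)) *\<^sub>R w" and nz: "\<kappa> \<noteq> 0" "w \<noteq> 0"
  shows "is_heisenberg br"
proof -
  interpret oriented_frame3 g v \<omega> by fact
  let ?vol = "vol_form g \<omega>"
  note alt = vol_form_alternating
  have alt0: "?vol p q q = 0" "?vol p q p = 0" for p q
    using alt unfolding alternating3_def by blast+
  have br: "br x y = (\<kappa> * ?vol x y w) *\<^sub>R w" for x y
    by (simp add: brL g_sym[of w] g_cross_prod)
  obtain x y where xy: "?vol x y w \<noteq> 0"
  proof (rule ccontr)
    assume "\<not> thesis"
    then have "g (cross_prod g \<omega> x y) w = 0" for x y using that g_cross_prod by metis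
    \<comment> \<open>The cross products of the frame are again frame vectors up to sign, so a
      vector orthogonal to all of them is zero.\<close>
    from this[of "v 1" "v 2"] this[of "v 2" "v 3"] this[of "v 3" "v 1"]
    have "coord 1 w = 0" "coord 2 w = 0" "coord 3 w = 0"
      by (auto simp: cross_prod_frame g_simps coord_def g_sym[of w])
    then show False using nz coord_expand[of w] by simp
  qed
  let ?R = "(\<kappa> * ?vol x y w) *\<^sub>R w"
  have "?vol x y ?R = \<kappa> * ?vol x y w * ?vol x y w"
    using linear_scale[OF alternating3_linear(3)[OF alt]] by simp
  then have "?vol x y ?R \<noteq> 0" using xy nz by simp
  note ind = alternating3_independent[of ?vol x y ?R, OF alt this]
  have "card {x, y, ?R} = DIM('a)" using ind(1-3) dim by simp
  then have "span {x, y, ?R} = UNIV"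
    using card_ge_dim_independent[of "{x, y, ?R}" UNIV] ind(4) by auto
  moreover have "br x ?R = 0" "br y ?R = 0"
    using linear_scale[OF alternating3_linear(2)[OF alt]] by (simp_all add: br alt0)
  ultimately show ?thesis
    unfolding is_heisenberg_def using ind br by blast
qed

section \<open>Realisation of all listed values\<close>

text \<open>The Euclidean basis serves as the frame: \<open>g\<close> gets the prescribed signs on
  it, \<open>\<omega>\<close> is its determinant, and \<open>L\<close> is diagonal with entries
  \<open>\<alpha> i\<close>.\<close>

lemma einstein_group_exists:
  fixes s \<alpha> :: "nat \<Rightarrow> real" and h :: real
  assumes dim: "DIM('a::euclidean_space) = 3" and s: "\<forall>a\<in>{1..3}. s a = 1 \<or> s a = - 1" "s 1 = s 2"
    and vals: "values1 \<alpha> h \<or> values2 \<alpha> h"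
  shows "\<exists>(br :: 'a \<Rightarrow> 'a \<Rightarrow> 'a) \<omega> g H v. einstein_group br \<omega> g H \<and> adapted_frame br \<omega> g H v \<alpha> h \<and>
    (\<forall>a\<in>{1..3}. g (v a) (v a) = s a)"
proof -
  obtain v :: "nat \<Rightarrow> 'a" where v: "bij_betw v {1..3} Basis"
    using ex_bij_betw_nat_finite_1[OF finite_Basis] dim by metis
  have three: "i = 1 \<or> i = 2 \<or> i = 3" if "i \<in> {1..3}" for i :: nat
    using that by auto
  have inner_v: "v 1 \<bullet> v 1 = 1" "v 2 \<bullet> v 2 = 1" "v 3 \<bullet> v 3 = 1" "v 1 \<bullet> v 2 = 0" "v 2 \<bullet> v 1 = 0"
    "v 1 \<bullet> v 3 = 0" "v 3 \<bullet> v 1 = 0" "v 2 \<bullet> v 3 = 0" "v 3 \<bullet> v 2 = 0"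
  proof -
    have "v i \<bullet> v j = (if i = j then 1 else 0)" if "i \<in> {1..3}" "j \<in> {1..3}" for i j
    proof -
      have "v i \<in> Basis" "v j \<in> Basis" using v that by (auto simp: bij_betw_def)
      then have "v i \<bullet> v j = (if v i = v j then 1 else 0)" by (rule inner_Basis)
      moreover have "v i = v j \<longleftrightarrow> i = j"
        using v that by (auto simp: bij_betw_def dest: inj_onD)
      ultimately show ?thesis by simp
    qed
    then show "v 1 \<bullet> v 1 = 1" "v 2 \<bullet> v 2 = 1" "v 3 \<bullet> v 3 = 1" "v 1 \<bullet> v 2 = 0" "v 2 \<bullet> v 1 = 0"
      "v 1 \<bullet> v 3 = 0" "v 3 \<bullet> v 1 = 0" "v 2 \<bullet> v 3 = 0" "v 3 \<bullet> v 2 = 0" by simp_all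
  qed
  have eqI: "x = y" if "x \<bullet> v 1 = y \<bullet> v 1" "x \<bullet> v 2 = y \<bullet> v 2" "x \<bullet> v 3 = y \<bullet> v 3" for x y :: 'a
  proof (rule euclidean_eqI)
    fix b :: 'a assume "b \<in> Basis"
    then have "b \<in> v ` {1..3}" using v by (simp add: bij_betw_def)
    then obtain i where "i \<in> {1..3}" "b = v i" by blast
    then show "x \<bullet> b = y \<bullet> b" using that three by blast
  qed
  have sq: "s 1 * s 1 = 1" "s 2 * s 2 = 1" "s 3 * s 3 = 1"
    using s(1) unfolding ball_1_3 by auto
  define g where "g x y = s 1 * (x \<bullet> v 1) * (y \<bullet> v 1) + s 2 * (x \<bullet> v 2) * (y \<bullet> v 2) + s 3 * (x \<bullet> v 3) * (y \<bullet> v 3)"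
    for x y :: 'a
  define \<omega> where "\<omega> x y z = (x \<bullet> v 1) * ((y \<bullet> v 2) * (z \<bullet> v 3) - (y \<bullet> v 3) * (z \<bullet> v 2))
      - (x \<bullet> v 2) * ((y \<bullet> v 1) * (z \<bullet> v 3) - (y \<bullet> v 3) * (z \<bullet> v 1))
      + (x \<bullet> v 3) * ((y \<bullet> v 1) * (z \<bullet> v 2) - (y \<bullet> v 2) * (z \<bullet> v 1))" for x y z :: 'a
  define H where "H x y z = h * \<omega> x y z" for x y z
  define L where "L x = (\<alpha> 1 * (x \<bullet> v 1)) *\<^sub>R v 1 + (\<alpha> 2 * (x \<bullet> v 2)) *\<^sub>R v 2 + (\<alpha> 3 * (x \<bullet> v 3)) *\<^sub>R v 3" for x :: 'a
  \<comment> \<open>\<open>L\<close> applied to the cross product, in coordinates; the factors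
    \<open>s i\<close> come from the cross product.\<close>
  define br where "br x y = ((x \<bullet> v 2 * (y \<bullet> v 3) - x \<bullet> v 3 * (y \<bullet> v 2)) * (s 1 * \<alpha> 1)) *\<^sub>R v 1
      + ((x \<bullet> v 3 * (y \<bullet> v 1) - x \<bullet> v 1 * (y \<bullet> v 3)) * (s 2 * \<alpha> 2)) *\<^sub>R v 2
      + ((x \<bullet> v 1 * (y \<bullet> v 2) - x \<bullet> v 2 * (y \<bullet> v 1)) * (s 3 * \<alpha> 3)) *\<^sub>R v 3" for x y :: 'a
  have g_v: "g x (v i) = s i * (x \<bullet> v i)" if "i \<in> {1..3}" for x i
    using three[OF that] by (auto simp: g_def inner_v)
  have metric: "pseudo_metric g"
    unfolding pseudo_metric_def
  proof (intro conjI allI impI)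
    show "bilinear g"
      unfolding bilinear_def by (auto intro!: linearI simp: g_def inner_add_left algebra_simps)
    show "g x y = g y x" for x y by (simp add: g_def)
    fix x assume "\<forall>y. g x y = 0"
    then have "g x (v i) = 0" for i by blast
    then show "x = 0"
      using g_v[of 1 x] g_v[of 2 x] g_v[of 3 x] sq by (intro eqI) auto
  qed
  have \<omega>_alt: "alternating3 \<omega>"
    unfolding alternating3_def by (auto intro!: linearI simp: \<omega>_def inner_add_left algebra_simps)
  have \<omega>_v: "\<omega> (v 1) (v 2) (v 3) = 1" by (simp add: \<omega>_def inner_v)
  have sg: "g (v i) (v i) = s i" if "i \<in> {1..3}" for i
    using three[OF that] g_v[OF that, of "v i"] inner_v by auto
  have "frame3 g v"
  proof (rule frame3I[OF dim metric])
    show "g (v i) (v i) * g (v i) (v i) = 1" if "i \<in> {1..3}" for i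
      unfolding sg[OF that] using three[OF that] sq by auto
  qed (simp_all add: g_v inner_v)
  then have v: "oriented_frame3 g v \<omega>"
    using \<omega>_alt \<omega>_v by (simp add: oriented_frame3_def oriented_frame3_axioms_def)
  interpret oriented_frame3 g v \<omega> by fact
  have br_bilinear: "bilinear br"
    unfolding bilinear_def by (auto intro!: linearI simp: br_def inner_add_left algebra_simps)
  have br_self: "br x x = 0" for x by (simp add: br_def)
  have H_alt: "alternating3 H"
    using \<omega>_alt unfolding alternating3_def H_def
    by (auto intro!: linearI simp: \<omega>_def inner_add_left algebra_simps)
  have L_v: "L (v i) = \<alpha> i *\<^sub>R v i" if "i \<in> {1..3}" for i
    using three[OF that] by (auto simp: L_def inner_v)
  have br: "bracket_frame3 g v br H L"
  proof unfold_locales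
    show "br (v 1) (v 2) = sg 3 *\<^sub>R L (v 3)" "br (v 2) (v 3) = sg 1 *\<^sub>R L (v 1)" "br (v 3) (v 1) = sg 2 *\<^sub>R L (v 2)"
      by (simp_all add: sg L_v) (simp_all add: br_def inner_v)
  qed (use br_bilinear br_self H_alt in \<open>auto simp: L_def inner_add_left algebra_simps\<close>)
  interpret bracket_frame3 g v br H L by fact
  have H_v: "H (v 1) (v 2) (v 3) = h" by (simp add: H_def \<omega>_v)
  have "lie_bracket br"
    unfolding lie_bracket_def
  proof (intro conjI allI br_bilinear br_self)
    have br_v: "br x y \<bullet> v 1 = (x \<bullet> v 2 * (y \<bullet> v 3) - x \<bullet> v 3 * (y \<bullet> v 2)) * (s 1 * \<alpha> 1)"
      "br x y \<bullet> v 2 = (x \<bullet> v 3 * (y \<bullet> v 1) - x \<bullet> v 1 * (y \<bullet> v 3)) * (s 2 * \<alpha> 2)"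
      "br x y \<bullet> v 3 = (x \<bullet> v 1 * (y \<bullet> v 2) - x \<bullet> v 2 * (y \<bullet> v 1)) * (s 3 * \<alpha> 3)" for x y
      by (simp_all add: br_def inner_add_left inner_v)
    \<comment> \<open>For structure constants of this diagonal shape the Jacobi identity is a
      polynomial identity in the coordinates, valid for all \<open>\<alpha>\<close>.\<close>
    show "br x (br y z) + br y (br z x) + br z (br x y) = 0" for x y z
      by (rule eqI; simp only: inner_add_left br_v inner_zero_left; algebra)
  qed
  moreover have "unimodular br" "gen_einstein br H g"
    using eigenframe_einstein[OF L_v] vals by (simp_all add: H_v)
  moreover have "\<omega> \<noteq> (\<lambda>x y z. 0)" using \<omega>_v by (metis zero_neq_one)
  ultimately have "einstein_group br \<omega> g H"
    using \<omega>_alt metric H_alt by (simp add: einstein_group_def)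
  moreover have "adapted_frame br \<omega> g H v \<alpha> h"
    using eigenframe_adapted[OF v br _ L_v] s(2) by (simp add: sg H_v)
  ultimately show ?thesis using sg by blast
qed

lemma adapted_frame_exists:
  fixes g :: "'a::euclidean_space \<Rightarrow> 'a \<Rightarrow> real"
  assumes dim: "DIM('a) = 3" and E: "einstein_group br \<omega> g H" and L: "linear L"
    and brL: "\<And>x y. br x y = L (cross_prod g \<omega> x y)" and diag: "diagonalizable L"
  shows "\<exists>v \<alpha> h. adapted_frame br \<omega> g H v \<alpha> h"
  using dim E L brL
proof (cases rule: eigenframe_or_null)
  case (eigen v \<alpha>)
  interpret oriented_frame3 g v \<omega> by fact
  \<comment> \<open>Two of three signs agree, and a cyclic rotation moves them to the first two
    places.\<close>
  have "sg 1 = sg 2 \<or> sg 2 = sg 3 \<or> sg 3 = sg 1"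
    using sg_cases[of 1] sg_cases[of 2] sg_cases[of 3] by auto
  then have "\<exists>a b c. (a, b, c) \<in> cyclic3 \<and> sg a = sg b"
    unfolding cyclic3_def by blast
  then obtain a b c where cyc: "(a, b, c) \<in> cyclic3" and sg: "sg a = sg b" by blast
  define \<sigma> :: "nat \<Rightarrow> nat" where "\<sigma> i = (if i = 1 then a else if i = 2 then b else c)" for i
  have u: "oriented_frame3 g (\<lambda>i. v (\<sigma> i)) \<omega>"
    unfolding \<sigma>_def by (rule oriented_frame3_rotate[OF dim eigen(1) cyc])
  have "\<sigma> i \<in> {1..3}" for i
    using cyc by (auto simp: \<sigma>_def cyclic3_def)
  then have "L (v (\<sigma> i)) = \<alpha> (\<sigma> i) *\<^sub>R v (\<sigma> i)" for i by (rule eigen(2))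
  then have "adapted_frame br \<omega> g H (\<lambda>i. v (\<sigma> i)) (\<lambda>i. \<alpha> (\<sigma> i)) (H (v (\<sigma> 1)) (v (\<sigma> 2)) (v (\<sigma> 3)))"
    using eigenframe_adapted[OF u oriented_frame3_bracket[OF u E L brL]] sg by (simp add: \<sigma>_def)
  then show ?thesis by blast
next
  case (null \<kappa> w)
  then show ?thesis using null_not_diagonalizable[of g L \<kappa> w] E diag by (simp add: einstein_group_def)
qed

lemma nondiagonalizable_classification:
  fixes g :: "'a::euclidean_space \<Rightarrow> 'a \<Rightarrow> real"
  assumes dim: "DIM('a) = 3" and E: "einstein_group br \<omega> g H" and L: "linear L"
    and brL: "\<And>x y. br x y = L (cross_prod g \<omega> x y)" and nondiag: "\<not> diagonalizable L"
  shows "indefinite_on g UNIV \<and> (\<exists>h. (\<forall>x y z. H x y z = h * vol_form g \<omega> x y z) \<and> h = 0) \<and> is_heisenberg br"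
  using dim E L brL
proof (cases rule: eigenframe_or_null)
  case (eigen v \<alpha>)
  interpret oriented_frame3 g v \<omega> by fact
  show ?thesis using frame_diagonalizable[OF eigen(2)] nondiag by blast
next
  case (null \<kappa> w)
  have metric: "pseudo_metric g" and \<omega>: "alternating3 \<omega>" "\<omega> \<noteq> (\<lambda>x y z. 0)"
    using E by (auto simp: einstein_group_def)
  obtain v where v: "oriented_frame3 g v \<omega>"
    by (rule oriented_frame3_exists[OF dim metric \<omega>])
  have "br x y = (\<kappa> * g w (cross_prod g \<omega> x y)) *\<^sub>R w" for x y
    by (simp only: brL null(1))
  then have "is_heisenberg br"
    by (rule null_heisenberg[OF dim v _ null(3,4)])
  then show ?thesis
    using null_vector_indefinite[OF metric null(2,4)] null(5) by simp
qed

theorem theorem3p4: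
  assumes "DIM('a::euclidean_space) = 3"
  shows
    "(\<forall>(br :: 'a \<Rightarrow> 'a \<Rightarrow> 'a) (\<omega> :: 'a \<Rightarrow> 'a \<Rightarrow> 'a \<Rightarrow> real) (g :: 'a \<Rightarrow> 'a \<Rightarrow> real)
        (H :: 'a \<Rightarrow> 'a \<Rightarrow> 'a \<Rightarrow> real) (L :: 'a \<Rightarrow> 'a).
        einstein_group br \<omega> g H \<and> linear L \<and> (\<forall>u v. br u v = L (cross_prod g \<omega> u v)) \<longrightarrow>
        (diagonalizable L \<longrightarrow>
          (\<exists>v \<alpha> h. adapted_frame br \<omega> g H v \<alpha> h) \<and>
          (\<forall>v \<alpha> h. adapted_frame br \<omega> g H v \<alpha> h \<longrightarrow>
            (values1 \<alpha> h \<and>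
              (h = 0 \<longrightarrow> abelian_on br UNIV \<and> flat_metric br g) \<and>
              (h \<noteq> 0 \<longrightarrow> is_so21 br \<or> is_so3 br) \<and>
              (is_so3 br \<longleftrightarrow> definite_on g UNIV \<and> h \<noteq> 0))
            \<or>
            (values2 \<alpha> h \<and> flat_metric br g \<and>
              abelian_on br (derived_algebra br) \<and> dim (derived_algebra br) = 2 \<and>
              ((is_e2 br \<and> definite_on g (derived_algebra br)) \<or>
               (is_e11 br \<and> indefinite_on g (derived_algebra br)))))) \<and>
        (\<not> diagonalizable L \<longrightarrow>
          indefinite_on g UNIV \<and>
          (\<exists>h. (\<forall>x y z. H x y z = h * vol_form g \<omega> x y z) \<and> h = 0) \<and>
          is_heisenberg br)) \<and>
     (\<forall>(s :: nat \<Rightarrow> real) (\<alpha> :: nat \<Rightarrow> real) (h :: real).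
        (\<forall>a\<in>{1..3}. s a = 1 \<or> s a = - 1) \<and> s 1 = s 2 \<and> (values1 \<alpha> h \<or> values2 \<alpha> h) \<longrightarrow>
        (\<exists>(br :: 'a \<Rightarrow> 'a \<Rightarrow> 'a) \<omega> g H v.
           einstein_group br \<omega> g H \<and> adapted_frame br \<omega> g H v \<alpha> h \<and>
           (\<forall>a\<in>{1..3}. g (v a) (v a) = s a)))"
proof (intro conjI allI impI, goal_cases)
  case (1 br \<omega> g H L)
  then show ?case using adapted_frame_exists[OF assms, of br \<omega> g H L] by blast
next
  case (2 br \<omega> g H L v \<alpha> h)
  then show ?case using adapted_frame_classification[OF assms, of br \<omega> g H L v \<alpha> h] by blast
next
  case (3 br \<omega> g H L)
  then show ?case using nondiagonalizable_classification[OF assms, of br \<omega> g H L] by blast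
next
  case (4 br \<omega> g H L)
  then show ?case using nondiagonalizable_classification[OF assms, of br \<omega> g H L] by blast
next
  case (5 br \<omega> g H L)
  then show ?case using nondiagonalizable_classification[OF assms, of br \<omega> g H L] by blast
next
  case (6 s \<alpha> h)
  then show ?case using einstein_group_exists[OF assms, of s \<alpha> h] by blast
qed

end
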